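(* Let $p,q\ge 2$ be integers with $p+q$ even, and let $m\ge0$ be an integer with $m+3\le (p+q)/2$. Let $M^{\pm}(m)$ be the $(\mathfrak g,K)$-modules for $\mathrm O(p,q)$ defined in the context. Then the Gelfand-Kirillov dimension $\operatorname{Dim}$ and the Bernstein degree $\operatorname{Deg}$ of $M^{\pm}(m)$ are given by $$\operatorname{Dim} M^{\pm}(m)=p+q-3,\qquad \operatorname{Deg} M^{\pm}(m)=\frac{4(m+1)\,(p+q-4)!}{(p-2)!\,(q-2)!}.$$
   Context: Notation: $\mathbb N=\{0,1,2,\dots\}$. $G=\mathrm O(p,q)=\{g\in \mathrm{GL}_{p+q}(\mathbb R): {}^tg I_{p,q}g=I_{p,q}\}$ with $I_{p,q}=\mathrm{diag}(1_p,-1_q)$; $K\simeq \mathrm O(p)\times \mathrm O(q)$ is the block-diagonal maximal compact subgroup; $\mathfrak g=\mathfrak o(p,q)\otimes_{\mathbb R}\mathbb C$. With $E_{a,b}$ the matrix units, $\mathfrak g$ is spanned by $X^+_{i,j}=E_{i,j}-E_{j,i}$ ($1\le i,j\le p$), $X^+_{p+i,p+j}=E_{p+i,p+j}-E_{p+j,p+i}$ ($1\le i,j\le q$), and $X^-_{i,j}=E_{i,p+j}+E_{p+j,i}$ ($1\le i\le p$, $1\le j\le q$). Let $x=(x_1,\dots,x_p)$, $y=(y_1,\dots,y_q)$ be the coordinates on $V=\mathbb R^p\times\mathbb R^q$. $\mathfrak g$ acts by the linear map $\pi$ into polynomial-coefficient differential operators on $V$: $\pi(X^+_{i,j})=-x_j\partial_{x_i}+x_i\partial_{x_j}$,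 $\pi(X^+_{p+i,p+j})=-y_j\partial_{y_i}+y_i\partial_{y_j}$, $\pi(X^-_{i,j})=\sqrt{-1}\,(x_iy_j+\partial_{x_i}\partial_{y_j})$; this is a Lie algebra homomorphism. $K$ acts on functions on $V$ by $(a,d)\cdot f(x,y)=f(a^{-1}x,d^{-1}y)$. Put $E_x=\sum x_i\partial_{x_i}$, $r_x^2=\sum x_i^2$, $\Delta_x=\sum\partial_{x_i}^2$, $E_y=\sum y_j\partial_{y_j}$, $r_y^2=\sum y_j^2$, $\Delta_y=\sum\partial_{y_j}^2$, $\rho_x=r_x^2/2$, $\rho_y=r_y^2/2$, and $H=-E_x-\frac p2+E_y+\frac q2$, $X^+=-\frac12(\Delta_x+r_y^2)$, $X^-=\frac12(r_x^2+\Delta_y)$. These satisfy $[H,X^\pm]=\pm2X^\pm$, $[X^+,X^-]=H$ and commute with $\pi(\mathfrak g)$. $\mathcal H^k(\mathbb R^n)$ is the space of homogeneous harmonic polynomials of degree $k$ on $\mathbb R^n$. For $\alpha\in\mathbb C\setminus(-\mathbb N)$ let $\Psi_\alpha(u)=\sum_{n\ge0}\frac{(-1)^n}{n!\,(\alpha)_n}u^n$ with $(\alpha)_n=\alpha(\alpha+1)\cdots(\alpha+n-1)$, and $\psi_\alpha=\Psi_\alpha(r_x^2r_y^2/4)=\Psi_\alpha(\rho_x\rho_y)$. Let $\mathcal E$ be the complex linear span of all functions $h_1(x)h_2(y)\rho_x^a\rho_y^b\psi_\alpha$ with $h_1\in\mathcal H^k(\mathbb R^p)$, $h_2\in\mathcal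 H^l(\mathbb R^q)$, $k,l,a,b\in\mathbb N$, $\alpha\in\mathbb C\setminus(-\mathbb N)$. $\mathcal E$ is stable under $\mathfrak g$, $K$ and $H,X^\pm$. For $m\in\mathbb N$, $M^{+}(m)$ consists of $0$ and all $f\in\mathcal E$ with $Hf=mf$, $X^+f=0$, $(X^-)^jf\ne0$ for $1\le j\le m$, and $(X^-)^{m+1}f=0$; $M^{-}(m)$ consists of $0$ and all $f\in\mathcal E$ with $Hf=-mf$, $X^-f=0$, $(X^+)^jf\neq0$ for $1\le j\le m$, and $(X^+)^{m+1}f=0$. They carry the restricted actions of $\mathfrak g$ (via $\pi$) and $K$. Gelfand-Kirillov dimension and Bernstein degree: for a finitely generated $U(\mathfrak g)$-module $M$, choose a finite-dimensional subspace $M_0$ with $M=U(\mathfrak g)M_0$, and put $M_n=U_n(\mathfrak g)M_0$, where $U_n(\mathfrak g)$ is the span of products of at most $n$ elements of $\mathfrak g$. There is a polynomial $\psi_M(t)\in\mathbb Q[t]$ with $\psi_M(n)=\dim(M_n/M_{n-1})$ for all sufficiently large $n$; if its leading term is $\frac{e}{(d-1)!}t^{d-1}$, then $\operatorname{Dim}M:=d$ and $\operatorname{Deg}M:=e$ (these are independent of the choice of $M_0$). *)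

theory Defs
  imports "HOL-Analysis.Analysis" "HOL-Library.Function_Algebras"
    "HOL-Computational_Algebra.Polynomial"
begin

definition cscale :: "complex \<Rightarrow> ('a \<Rightarrow> complex) \<Rightarrow> 'a \<Rightarrow> complex" where
  "cscale c f = (\<lambda>z. c * f z)"

global_interpretation cfun: vector_space "cscale :: complex \<Rightarrow> ('a \<Rightarrow> complex) \<Rightarrow> _"
  by unfold_locales (auto simp: cscale_def algebra_simps fun_eq_iff)

text \<open>The index types \<open>'p\<close> and \<open>'q\<close> have \<open>p\<close> and \<open>q\<close> elements; rows and columns of
  \<open>(p + q) \<times> (p + q)\<close> matrices are indexed by \<open>'p + 'q\<close>, where \<open>Inl i\<close> stands for the index \<open>i\<close>
  and \<open>Inr j\<close> for the index \<open>p + j\<close>.\<close>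

definition Ipq :: "real^('p::finite + 'q::finite)^('p + 'q)" where
  "Ipq = (\<chi> a b. if a = b then (case a of Inl i \<Rightarrow> 1 | Inr j \<Rightarrow> - 1) else 0)"

definition o_pq :: "(real^('p::finite + 'q::finite)^('p + 'q)) set" where
  "o_pq = {A. transpose A ** Ipq + Ipq ** A = 0}"

text \<open>The complexification, realised inside the complex matrices.\<close>

definition lie_g :: "(complex^('p::finite + 'q::finite)^('p + 'q)) set" where
  "lie_g = {(\<chi> a b. Complex (B $ a $ b) (C $ a $ b)) | B C. B \<in> o_pq \<and> C \<in> o_pq}"

definition munit :: "'n::finite \<Rightarrow> 'n \<Rightarrow> complex^'n^'n" where
  "munit a b = (\<chi> c d. if c = a \<and> d = b then 1 else 0)"

definition Xplus_x :: "'p::finite \<Rightarrow> 'p \<Rightarrow> complex^('p + 'q::finite)^('p + 'q)" where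
  "Xplus_x i j = munit (Inl i) (Inl j) - munit (Inl j) (Inl i)"

definition Xplus_y :: "'q::finite \<Rightarrow> 'q \<Rightarrow> complex^('p::finite + 'q)^('p + 'q)" where
  "Xplus_y i j = munit (Inr i) (Inr j) - munit (Inr j) (Inr i)"

definition Xminus :: "'p::finite \<Rightarrow> 'q::finite \<Rightarrow> complex^('p + 'q)^('p + 'q)" where
  "Xminus i j = munit (Inl i) (Inr j) + munit (Inr j) (Inl i)"

definition dir_deriv :: "'a::real_normed_vector \<Rightarrow> ('a \<Rightarrow> complex) \<Rightarrow> 'a \<Rightarrow> complex" where
  "dir_deriv v f z = vector_derivative (\<lambda>t. f (z + t *\<^sub>R v)) (at 0)"

type_synonym ('p, 'q) funs = "(real^'p) \<times> (real^'q) \<Rightarrow> complex"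

definition cx :: "'p::finite \<Rightarrow> ('p, 'q::finite) funs" where
  "cx i z = complex_of_real (fst z $ i)"

definition cy :: "'q::finite \<Rightarrow> ('p::finite, 'q) funs" where
  "cy j z = complex_of_real (snd z $ j)"

definition dx :: "'p::finite \<Rightarrow> ('p, 'q::finite) funs \<Rightarrow> ('p, 'q) funs" where
  "dx i = dir_deriv (axis i 1, 0)"

definition dy :: "'q::finite \<Rightarrow> ('p::finite, 'q) funs \<Rightarrow> ('p, 'q) funs" where
  "dy j = dir_deriv (0, axis j 1)"

text \<open>Every matrix \<open>A\<close> in \<open>lie_g\<close> equals
  \<open>\<Sum>i j. (A\<^sub>i\<^sub>j / 2) X\<^sup>+\<^sub>i\<^sub>j\<close> (over the two diagonal blocks) plus \<open>\<Sum>i j. A\<^sub>i\<^sub>,\<^sub>p\<^sub>+\<^sub>j X\<^sup>-\<^sub>i\<^sub>j\<close>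
  (lemma \<open>lie_g_expansion\<close>), so the linear map \<open>\<pi>\<close> prescribed on the \<open>X\<^sup>+\<close> and \<open>X\<^sup>-\<close> is given by
  the following formula. The lemmas \<open>pi_act_Xplus_x\<close>, \<open>pi_act_Xplus_y\<close> and \<open>pi_act_Xminus\<close> confirm
  that it takes the prescribed values.\<close>

definition pi_act ::
  "complex^('p::finite + 'q::finite)^('p + 'q) \<Rightarrow> ('p, 'q) funs \<Rightarrow> ('p, 'q) funs" where
  "pi_act A f z =
     (\<Sum>i\<in>UNIV. \<Sum>j\<in>UNIV. A $ Inl i $ Inl j / 2 * (- cx j z * dx i f z + cx i z * dx j f z))
   + (\<Sum>i\<in>UNIV. \<Sum>j\<in>UNIV. A $ Inr i $ Inr j / 2 * (- cy j z * dy i f z + cy i z * dy j f z))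
   + (\<Sum>i\<in>UNIV. \<Sum>j\<in>UNIV. A $ Inl i $ Inr j * (\<i> * (cx i z * cy j z * f z + dx i (dy j f) z)))"

lemma sum2_delta:
  fixes G :: "'a::finite \<Rightarrow> 'b::finite \<Rightarrow> complex"
  shows "(\<Sum>i\<in>UNIV. \<Sum>j\<in>UNIV. (if i = a \<and> j = b then 1 else 0) * G i j) = G a b"
proof -
  have "(\<Sum>i\<in>UNIV. \<Sum>j\<in>UNIV. (if i = a \<and> j = b then 1 else 0) * G i j)
      = (\<Sum>i\<in>UNIV. if i = a then G a b else 0)"
  proof (rule sum.cong[OF refl])
    fix i
    have "(\<Sum>j\<in>UNIV. (if i = a \<and> j = b then 1 else 0) * G i j)
        = (\<Sum>j\<in>UNIV. if j = b then (if i = a then G a b else 0) else 0)"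
      by (rule sum.cong[OF refl]) auto
    then show "(\<Sum>j\<in>UNIV. (if i = a \<and> j = b then 1 else 0) * G i j) = (if i = a then G a b else 0)"
      by simp
  qed
  then show ?thesis by simp
qed

lemma sum2_delta_diff:
  fixes G :: "'a::finite \<Rightarrow> 'a \<Rightarrow> complex"
  shows "(\<Sum>i\<in>UNIV. \<Sum>j\<in>UNIV.
      ((if i = a \<and> j = b then 1 else 0) - (if i = b \<and> j = a then 1 else 0)) / 2 * G i j)
    = (G a b - G b a) / 2"
proof -
  have "(\<Sum>i\<in>UNIV. \<Sum>j\<in>UNIV.
      ((if i = a \<and> j = b then 1 else 0) - (if i = b \<and> j = a then 1 else 0)) / 2 * G i j)
    = (\<Sum>i\<in>UNIV. \<Sum>j\<in>UNIV. (if i = a \<and> j = b then 1 else 0) * (G i j / 2))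
    - (\<Sum>i\<in>UNIV. \<Sum>j\<in>UNIV. (if i = b \<and> j = a then 1 else 0) * (G i j / 2))"
    unfolding sum_subtractf[symmetric]
    by (intro sum.cong refl) (auto simp: field_simps)
  then show ?thesis unfolding sum2_delta by (simp add: diff_divide_distrib)
qed

lemma X_entries:
  "Xplus_x i j $ Inl a $ Inl b =
    (if a = i \<and> b = j then 1 else 0) - (if a = j \<and> b = i then 1 else 0)"
  "Xplus_x i j $ Inl a $ Inr d = 0" "Xplus_x i j $ Inr c $ Inl b = 0" "Xplus_x i j $ Inr c $ Inr d = 0"
  "Xplus_y k l $ Inr c $ Inr d =
    (if c = k \<and> d = l then 1 else 0) - (if c = l \<and> d = k then 1 else 0)"
  "Xplus_y k l $ Inl a $ Inr d = 0" "Xplus_y k l $ Inr c $ Inl b = 0" "Xplus_y k l $ Inl a $ Inl b = 0"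
  "Xminus i k $ Inl a $ Inr d = (if a = i \<and> d = k then 1 else 0)"
  "Xminus i k $ Inr c $ Inl b = (if b = i \<and> c = k then 1 else 0)"
  "Xminus i k $ Inl a $ Inl b = 0" "Xminus i k $ Inr c $ Inr d = 0"
  by (simp_all add: Xplus_x_def Xplus_y_def Xminus_def munit_def)

lemma pi_act_Xplus_x:
  "pi_act (Xplus_x i j) f = (\<lambda>z. - cx j z * dx i f z + cx i z * dx j f z)"
  unfolding pi_act_def X_entries sum2_delta_diff by (rule ext) simp

lemma pi_act_Xplus_y:
  "pi_act (Xplus_y i j) f = (\<lambda>z. - cy j z * dy i f z + cy i z * dy j f z)"
  unfolding pi_act_def X_entries sum2_delta_diff by (rule ext) simp

lemma pi_act_Xminus:
  "pi_act (Xminus i j) f = (\<lambda>z. \<i> * (cx i z * cy j z * f z + dx i (dy j f) z))"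
  unfolding pi_act_def X_entries sum2_delta by (rule ext) simp

lemma o_pq_entries:
  assumes "A \<in> o_pq"
  shows "A $ Inl i $ Inl j = - A $ Inl j $ Inl i" "A $ Inr k $ Inr l = - A $ Inr l $ Inr k"
    "A $ Inr l $ Inl i = A $ Inl i $ Inr l"
proof -
  have *: "(transpose A ** Ipq + Ipq ** A) $ a $ b = 0" for a b
    using assms by (simp add: o_pq_def)
  have **: "A $ b $ a * Ipq $ b $ b + Ipq $ a $ a * A $ a $ b = 0" for a b
  proof -
    have "(transpose A ** Ipq) $ a $ b = (\<Sum>k\<in>UNIV. if k = b then A $ b $ a * Ipq $ b $ b else 0)"
      unfolding matrix_matrix_mult_def transpose_def vec_lambda_beta
      by (rule sum.cong[OF refl]) (simp add: Ipq_def)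
    moreover have "(Ipq ** A) $ a $ b = (\<Sum>k\<in>UNIV. if k = a then Ipq $ a $ a * A $ a $ b else 0)"
      unfolding matrix_matrix_mult_def vec_lambda_beta
      by (rule sum.cong[OF refl]) (simp add: Ipq_def)
    ultimately show ?thesis using *[of a b] by simp
  qed
  show "A $ Inl i $ Inl j = - A $ Inl j $ Inl i" using **[of "Inl j" "Inl i"] by (simp add: Ipq_def)
  show "A $ Inr k $ Inr l = - A $ Inr l $ Inr k" using **[of "Inr l" "Inr k"] by (simp add: Ipq_def)
  show "A $ Inr l $ Inl i = A $ Inl i $ Inr l" using **[of "Inl i" "Inr l"] by (simp add: Ipq_def)
qed

lemma lie_g_entries:
  assumes "A \<in> lie_g"
  shows "A $ Inl i $ Inl j = - A $ Inl j $ Inl i" "A $ Inr k $ Inr l = - A $ Inr l $ Inr k"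
    "A $ Inr l $ Inl i = A $ Inl i $ Inr l"
proof -
  obtain B C where BC: "B \<in> o_pq" "C \<in> o_pq" and A: "A = (\<chi> a b. Complex (B $ a $ b) (C $ a $ b))"
    using assms unfolding lie_g_def by blast
  show "A $ Inl i $ Inl j = - A $ Inl j $ Inl i"
    using o_pq_entries(1)[OF BC(1), of i j] o_pq_entries(1)[OF BC(2), of i j]
    unfolding A by (simp add: complex_eq_iff)
  show "A $ Inr k $ Inr l = - A $ Inr l $ Inr k"
    using o_pq_entries(2)[OF BC(1), of k l] o_pq_entries(2)[OF BC(2), of k l]
    unfolding A by (simp add: complex_eq_iff)
  show "A $ Inr l $ Inl i = A $ Inl i $ Inr l"
    using o_pq_entries(3)[OF BC(1), of l i] o_pq_entries(3)[OF BC(2), of l i]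
    unfolding A by (simp add: complex_eq_iff)
qed

lemma lie_g_expansion:
  fixes A :: "complex^('p::finite + 'q::finite)^('p + 'q)"
  assumes "A \<in> lie_g"
  shows "A $ a $ b =
     (\<Sum>i\<in>UNIV. \<Sum>j\<in>UNIV. A $ Inl i $ Inl j / 2 * Xplus_x i j $ a $ b)
   + (\<Sum>i\<in>UNIV. \<Sum>j\<in>UNIV. A $ Inr i $ Inr j / 2 * Xplus_y i j $ a $ b)
   + (\<Sum>i\<in>UNIV. \<Sum>j\<in>UNIV. A $ Inl i $ Inr j * Xminus i j $ a $ b)"
proof -
  have e1: "(\<Sum>i\<in>UNIV. \<Sum>j\<in>UNIV. F i j * ((if c = i \<and> d = j then 1 else 0)
      - (if c = j \<and> d = i then 1 else 0))) = F c d - F d c"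
    for F :: "'n::finite \<Rightarrow> 'n \<Rightarrow> complex" and c d
  proof -
    have "(\<Sum>i\<in>UNIV. \<Sum>j\<in>UNIV. F i j * ((if c = i \<and> d = j then 1 else 0)
        - (if c = j \<and> d = i then 1 else 0)))
      = (\<Sum>i\<in>UNIV. \<Sum>j\<in>UNIV. (if i = c \<and> j = d then 1 else 0) * F i j)
      - (\<Sum>i\<in>UNIV. \<Sum>j\<in>UNIV. (if i = d \<and> j = c then 1 else 0) * F i j)"
      unfolding sum_subtractf[symmetric]
    proof (intro sum.cong refl)
      fix i j
      show "F i j * ((if c = i \<and> d = j then 1 else 0) - (if c = j \<and> d = i then 1 else 0))
        = (if i = c \<and> j = d then 1 else 0) * F i j - (if i = d \<and> j = c then 1 else 0) * F i j"
        unfolding eq_commute[of c] eq_commute[of d]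
        by (simp only: right_diff_distrib mult.commute[of "F i j"] conj_commute)
    qed
    then show ?thesis unfolding sum2_delta .
  qed
  have e2: "(\<Sum>i\<in>UNIV. \<Sum>j\<in>UNIV. F i j * (if c = i \<and> d = j then 1 else 0)) = F c d"
    for F :: "'n::finite \<Rightarrow> 'm::finite \<Rightarrow> complex" and c d
  proof -
    have "(\<Sum>i\<in>UNIV. \<Sum>j\<in>UNIV. F i j * (if c = i \<and> d = j then 1 else 0))
      = (\<Sum>i\<in>UNIV. \<Sum>j\<in>UNIV. (if i = c \<and> j = d then 1 else 0) * F i j)"
      by (intro sum.cong refl) auto
    then show ?thesis unfolding sum2_delta .
  qed
  show ?thesis
  proof (cases a)
    case a: (Inl i)
    show ?thesis
    proof (cases b)
      case b: (Inl j)
      show ?thesis unfolding a b X_entries e1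
        using lie_g_entries(1)[OF assms, of j i] by simp
    next
      case b: (Inr l)
      show ?thesis unfolding a b X_entries e2 by simp
    qed
  next
    case a: (Inr k)
    show ?thesis
    proof (cases b)
      case b: (Inl j)
      show ?thesis unfolding a b X_entries e2
        using lie_g_entries(3)[OF assms, of k j] by simp
    next
      case b: (Inr l)
      show ?thesis unfolding a b X_entries e1
        using lie_g_entries(2)[OF assms, of l k] by simp
    qed
  qed
qed

definition Euler_x :: "('p::finite, 'q::finite) funs \<Rightarrow> ('p, 'q) funs" where
  "Euler_x f z = (\<Sum>i\<in>UNIV. cx i z * dx i f z)"

definition Euler_y :: "('p::finite, 'q::finite) funs \<Rightarrow> ('p, 'q) funs" where
  "Euler_y f z = (\<Sum>j\<in>UNIV. cy j z * dy j f z)"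

definition Lap_x :: "('p::finite, 'q::finite) funs \<Rightarrow> ('p, 'q) funs" where
  "Lap_x f z = (\<Sum>i\<in>UNIV. dx i (dx i f) z)"

definition Lap_y :: "('p::finite, 'q::finite) funs \<Rightarrow> ('p, 'q) funs" where
  "Lap_y f z = (\<Sum>j\<in>UNIV. dy j (dy j f) z)"

definition r2_x :: "('p::finite, 'q::finite) funs" where
  "r2_x z = (\<Sum>i\<in>UNIV. (cx i z)\<^sup>2)"

definition r2_y :: "('p::finite, 'q::finite) funs" where
  "r2_y z = (\<Sum>j\<in>UNIV. (cy j z)\<^sup>2)"

definition rho_x :: "('p::finite, 'q::finite) funs" where
  "rho_x z = r2_x z / 2"

definition rho_y :: "('p::finite, 'q::finite) funs" where
  "rho_y z = r2_y z / 2"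

definition sl2_H :: "('p::finite, 'q::finite) funs \<Rightarrow> ('p, 'q) funs" where
  "sl2_H f z = - Euler_x f z - of_nat CARD('p) / 2 * f z + Euler_y f z + of_nat CARD('q) / 2 * f z"

definition sl2_Xp :: "('p::finite, 'q::finite) funs \<Rightarrow> ('p, 'q) funs" where
  "sl2_Xp f z = - (1 / 2) * (Lap_x f z + r2_y z * f z)"

definition sl2_Xm :: "('p::finite, 'q::finite) funs \<Rightarrow> ('p, 'q) funs" where
  "sl2_Xm f z = 1 / 2 * (r2_x z * f z + Lap_y f z)"

definition homogeneous_polys :: "nat \<Rightarrow> (real^'n::finite \<Rightarrow> complex) set" where
  "homogeneous_polys k =
     cfun.span {\<lambda>x. \<Prod>i\<in>UNIV. complex_of_real (x $ i) ^ d i | d. (\<Sum>i\<in>UNIV. d i) = k}"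

definition harmonic_polys :: "nat \<Rightarrow> (real^'n::finite \<Rightarrow> complex) set" where
  "harmonic_polys k = {h \<in> homogeneous_polys k.
     \<forall>x. (\<Sum>i\<in>UNIV. dir_deriv (axis i 1) (dir_deriv (axis i 1) h) x) = 0}"

definition Psi :: "complex \<Rightarrow> complex \<Rightarrow> complex" where
  "Psi \<alpha> u = (\<Sum>n. (- 1) ^ n / (fact n * pochhammer \<alpha> n) * u ^ n)"

definition psi :: "complex \<Rightarrow> ('p::finite, 'q::finite) funs" where
  "psi \<alpha> z = Psi \<alpha> (rho_x z * rho_y z)"

definition space_E :: "('p::finite, 'q::finite) funs set" where
  "space_E = cfun.span
     {\<lambda>z. h1 (fst z) * h2 (snd z) * rho_x z ^ a * rho_y z ^ b * psi \<alpha> z | h1 h2 k l a b \<alpha>.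
        h1 \<in> harmonic_polys k \<and> h2 \<in> harmonic_polys l \<and> \<alpha> \<notin> \<int>\<^sub>\<le>\<^sub>0}"

definition M_plus :: "nat \<Rightarrow> ('p::finite, 'q::finite) funs set" where
  "M_plus m = {0} \<union> {f \<in> space_E.
     sl2_H f = cscale (of_nat m) f \<and> sl2_Xp f = 0 \<and>
     (\<forall>j\<in>{1..m}. (sl2_Xm ^^ j) f \<noteq> 0) \<and> (sl2_Xm ^^ (m + 1)) f = 0}"

definition M_minus :: "nat \<Rightarrow> ('p::finite, 'q::finite) funs set" where
  "M_minus m = {0} \<union> {f \<in> space_E.
     sl2_H f = cscale (- of_nat m) f \<and> sl2_Xm f = 0 \<and>
     (\<forall>j\<in>{1..m}. (sl2_Xp ^^ j) f \<noteq> 0) \<and> (sl2_Xp ^^ (m + 1)) f = 0}"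

text \<open>Only the action of the Lie algebra enters. A module is given by a set \<open>g\<close> of Lie algebra
  elements, their action \<open>act\<close> on functions and the underlying space \<open>M\<close> of functions.
  \<open>U_filt g act n M0\<close> is \<open>U\<^sub>n(g) M\<^sub>0\<close>, as \<open>U\<^sub>n(g)\<close> is spanned by the products of at most \<open>n\<close> elements
  of \<open>g\<close>; the union over \<open>n\<close> is \<open>U(g) M\<^sub>0\<close>.\<close>

definition U_filt ::
  "'g set \<Rightarrow> ('g \<Rightarrow> ('a \<Rightarrow> complex) \<Rightarrow> 'a \<Rightarrow> complex) \<Rightarrow> nat \<Rightarrow> ('a \<Rightarrow> complex) set \<Rightarrow>
    ('a \<Rightarrow> complex) set" where
  "U_filt g act n M0 =
     cfun.span {foldr act As v | As v. set As \<subseteq> g \<and> length As \<le> n \<and> v \<in> M0}"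

definition generating_subspace ::
  "'g set \<Rightarrow> ('g \<Rightarrow> ('a \<Rightarrow> complex) \<Rightarrow> 'a \<Rightarrow> complex) \<Rightarrow> ('a \<Rightarrow> complex) set \<Rightarrow>
    ('a \<Rightarrow> complex) set \<Rightarrow> bool" where
  "generating_subspace g act M M0 \<longleftrightarrow>
     (\<exists>B. finite B \<and> M0 = cfun.span B) \<and> M = (\<Union>n. U_filt g act n M0)"

text \<open>The dimension of \<open>V / W\<close> for finite-dimensional spaces \<open>W \<subseteq> V\<close>.\<close>

definition quot_dim :: "('a \<Rightarrow> complex) set \<Rightarrow> ('a \<Rightarrow> complex) set \<Rightarrow> nat" where
  "quot_dim V W = cfun.dim V - cfun.dim W"

definition has_Dim_Deg ::
  "'g set \<Rightarrow> ('g \<Rightarrow> ('a \<Rightarrow> complex) \<Rightarrow> 'a \<Rightarrow> complex) \<Rightarrow> ('a \<Rightarrow> complex) set \<Rightarrow>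
    nat \<Rightarrow> rat \<Rightarrow> bool" where
  "has_Dim_Deg g act M d e \<longleftrightarrow> (\<exists>M0 \<psi>. generating_subspace g act M M0 \<and>
     (\<forall>\<^sub>F n in sequentially.
        poly \<psi> (of_nat n) = of_nat (quot_dim (U_filt g act n M0) (U_filt g act (n - 1) M0))) \<and>
     \<psi> \<noteq> 0 \<and> d \<ge> 1 \<and> degree \<psi> = d - 1 \<and> lead_coeff \<psi> = e / fact (d - 1))"

text \<open>The values do not depend on the choice of \<open>M0\<close>, which is why a definite description is used:
  \<open>GK_Dim\<close> and \<open>Bernstein_Deg\<close> are specified exactly when some generating subspace yields a nonzero
  Hilbert polynomial and all of them that do yield the same values.\<close>

definition GK_Dim ::
  "'g set \<Rightarrow> ('g \<Rightarrow> ('a \<Rightarrow> complex) \<Rightarrow> 'a \<Rightarrow> complex) \<Rightarrow> ('a \<Rightarrow> complex) set \<Rightarrow> nat" where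
  "GK_Dim g act M = (THE d. \<exists>e. has_Dim_Deg g act M d e)"

definition Bernstein_Deg ::
  "'g set \<Rightarrow> ('g \<Rightarrow> ('a \<Rightarrow> complex) \<Rightarrow> 'a \<Rightarrow> complex) \<Rightarrow> ('a \<Rightarrow> complex) set \<Rightarrow> rat" where
  "Bernstein_Deg g act M = (THE e. \<exists>d. has_Dim_Deg g act M d e)"

end

theory Submission
  imports Defs
begin

text \<open>Put \<open>\<kappa> = k + p/2\<close>. Separating the joint eigenspaces of \<open>H\<close> and of the Casimir operators of \<open>O(p)\<close>
  and \<open>O(q)\<close> in \<open>E\<close>, and solving the resulting Bessel equation for \<open>X\<^sup>+\<close> on each of them, shows that \<open>M\<^sup>+(m)\<close> is spanned
  by the functions \<open>h\<^sub>1(x) h\<^sub>2(y) \<rho>\<^sub>y\<^sup>b \<psi>\<^sub>\<kappa>\<close> with \<open>h\<^sub>1\<close>, \<open>h\<^sub>2\<close> harmonic of degrees \<open>k\<close>, \<open>l\<close>, \<open>b \<le> m\<close> and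
  \<open>2l + 4b + q = 2k + p + 2m\<close>. The noncompact root vectors move \<open>k\<close> by at most one, and the sum of
  \<open>\<pi>(X\<^sup>-\<^sub>i\<^sub>j)\<close> applied to the \<open>(\<partial>\<^sub>i h\<^sub>1)(\<partial>\<^sub>j h\<^sub>2) \<rho>\<^sub>y\<^sup>b \<psi>\<^sub>\<kappa>\<close> is a multiple of \<open>h\<^sub>1 h\<^sub>2 \<rho>\<^sub>y\<^sup>b \<psi>\<^sub>\<kappa>\<^sub>+\<^sub>1\<close>, nonzero for large \<open>k\<close>.
  Hence the span of all terms with \<open>k \<le> K\<close> generates for large \<open>K\<close>, and applying \<open>U\<^sub>n\<close> to it gives the
  terms with \<open>k \<le> K + n\<close>. The \<open>n\<close>-th graded piece therefore has dimension
  \<open>dim H\<^sup>k(\<real>\<^sup>p) * (\<Sum>b\<le>m. dim H\<^sup>l(\<real>\<^sup>q))\<close> with \<open>k = K + n\<close>, a polynomial in \<open>n\<close> of degree \<open>(p - 2) + (q - 2)\<close> with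
  leading coefficient \<open>4(m + 1) / ((p - 2)! (q - 2)!)\<close>. Exchanging \<open>x\<close> and \<open>y\<close> turns \<open>M\<^sup>+\<close> into \<open>M\<^sup>-\<close>.\<close>

section \<open>Directional derivatives of iterated entire functions\<close>

text \<open>In \<open>space_E\<close> every \<alpha> and all exponents occur, and one function has
  many such expressions, so coefficients cannot be compared directly. Unique coordinates arise by
  fixing the degrees k, l and exponents a, b, one of them 0: the coefficient of a product of
  harmonic basis elements is then an entire series in w = \<open>rho_x\<close> \<open>rho_y\<close>,
  determined by values on products of spheres. On it X^+ acts by a two-term recursion with indicial
  factor (a + n)(a + n + \<kappa> - 1), which forces a = 0 and, up to a scalar, \<alpha> = \<kappa>.
  The bound b \<le> m comes from injectivity of (X^-)^(m+1) where b > m. Conversely, for b \<le> m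
  the relations of sl2 make (X^-)^(m+1) f a vector killed by X^+ in a block on which X^+ is
  injective. Stability under the noncompact root vectors rests on a coefficient that vanishes for b
  = m, where b + 1 would leave the range. In the degree, dim H^k(R^n) contributes 2 / (n - 2)! for x
  and for y, and m + 1 counts the values of b. \<open>GK_Dim\<close> and
  \<open>Bernstein_Deg\<close> are definite descriptions, so all generating subspaces have to be
  compared; this is done through the growth of the filtration dimensions.\<close>

definition cst :: "complex \<Rightarrow> 'a \<Rightarrow> complex" where
  "cst c = (\<lambda>_. c)"

lemma cst_apply [simp]: "cst c z = c"
  by (simp add: cst_def)

lemma cscale_eq: "cscale c f = cst c * f"
  by (simp add: cscale_def fun_eq_iff)

lemma cst_0: "cst 0 = 0" and cst_1: "cst 1 = 1"
  by (simp_all add: fun_eq_iff)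

text \<open>A class of smooth functions that contains \<open>space_E\<close> and is closed under all operators involved; on it
  directional derivatives are linear, satisfy the Leibniz rule and commute.\<close>

inductive is_nice :: "('a::real_normed_vector \<Rightarrow> complex) \<Rightarrow> bool" where
  is_nice_cst: "is_nice (cst c)"
| is_nice_lin: "bounded_linear l \<Longrightarrow> is_nice (\<lambda>z. complex_of_real (l z))"
| is_nice_add: "is_nice f \<Longrightarrow> is_nice g \<Longrightarrow> is_nice (f + g)"
| is_nice_mult: "is_nice f \<Longrightarrow> is_nice g \<Longrightarrow> is_nice (f * g)"
| is_nice_comp: "is_nice f \<Longrightarrow> fps_conv_radius g = \<infinity> \<Longrightarrow> is_nice (\<lambda>z. eval_fps g (f z))"

definition nice :: "('a::real_normed_vector \<Rightarrow> complex) set" where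
  "nice = Collect is_nice"

lemma nice_cst [simp, intro]: "cst c \<in> nice"
  and nice_lin: "bounded_linear l \<Longrightarrow> (\<lambda>z. complex_of_real (l z)) \<in> nice"
  and nice_add [simp, intro]: "f \<in> nice \<Longrightarrow> g \<in> nice \<Longrightarrow> f + g \<in> nice"
  and nice_mult [simp, intro]: "f \<in> nice \<Longrightarrow> g \<in> nice \<Longrightarrow> f * g \<in> nice"
  and nice_comp: "f \<in> nice \<Longrightarrow> fps_conv_radius h = \<infinity> \<Longrightarrow> (\<lambda>z. eval_fps h (f z)) \<in> nice"
  by (auto simp: nice_def intro: is_nice.intros)

lemma nice_induct [consumes 1, case_names cst lin add mult comp]:
  assumes "f \<in> nice"
    and "\<And>c. P (cst c)"
    and "\<And>l. bounded_linear l \<Longrightarrow> P (\<lambda>z. complex_of_real (l z))"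
    and "\<And>f g. f \<in> nice \<Longrightarrow> P f \<Longrightarrow> g \<in> nice \<Longrightarrow> P g \<Longrightarrow> P (f + g)"
    and "\<And>f g. f \<in> nice \<Longrightarrow> P f \<Longrightarrow> g \<in> nice \<Longrightarrow> P g \<Longrightarrow> P (f * g)"
    and "\<And>f g. f \<in> nice \<Longrightarrow> P f \<Longrightarrow> fps_conv_radius g = \<infinity> \<Longrightarrow> P (\<lambda>z. eval_fps g (f z))"
  shows "P f"
  using assms(1) unfolding nice_def mem_Collect_eq
proof (induction rule: is_nice.induct)
  case (is_nice_add f g)
  then show ?case unfolding nice_def by (intro assms(4)) (auto simp: nice_def)
next
  case (is_nice_mult f g)
  then show ?case unfolding nice_def by (intro assms(5)) (auto simp: nice_def)
next
  case (is_nice_comp f g)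
  then show ?case unfolding nice_def by (intro assms(6)) (auto simp: nice_def)
qed (rule assms(2), rule assms(3))

lemma fps_conv_radius_deriv_inf:
  fixes g :: "complex fps"
  assumes "fps_conv_radius g = \<infinity>"
  shows "fps_conv_radius (fps_deriv g) = \<infinity>"
  using fps_conv_radius_deriv[of g] assms by auto

text \<open>\<open>vector_derivative\<close> is an arbitrary value where no derivative exists, so
  the rules of calculus are proved for this predicate, which carries existence at every
  point.\<close>

definition has_dd :: "'a::real_normed_vector \<Rightarrow> ('a \<Rightarrow> complex) \<Rightarrow> ('a \<Rightarrow> complex) \<Rightarrow> bool" where
  "has_dd v f D \<longleftrightarrow> (\<forall>z. ((\<lambda>t. f (z + t *\<^sub>R v)) has_vector_derivative D z) (at 0))"

lemma has_dd_imp_dir_deriv: "has_dd v f D \<Longrightarrow> dir_deriv v f = D"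
  unfolding has_dd_def dir_deriv_def by (rule ext) (simp add: vector_derivative_at)

lemma has_dd_cst: "has_dd v (cst c) 0"
  unfolding has_dd_def by simp

lemma has_dd_lin:
  assumes "bounded_linear l"
  shows "has_dd v (\<lambda>z. complex_of_real (l z)) (cst (complex_of_real (l v)))"
  unfolding has_dd_def
proof (intro allI)
  fix z
  interpret bounded_linear l by fact
  have "((\<lambda>t. complex_of_real (l z + t * l v)) has_vector_derivative complex_of_real (l v)) (at 0)"
    unfolding has_vector_derivative_complex_iff by (auto intro!: derivative_eq_intros)
  then show "((\<lambda>t. complex_of_real (l (z + t *\<^sub>R v))) has_vector_derivative cst (complex_of_real (l v)) z) (at 0)"
    by (simp add: add scale)
qed

lemma has_dd_add: "has_dd v f F \<Longrightarrow> has_dd v g G \<Longrightarrow> has_dd v (f + g) (F + G)"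
  unfolding has_dd_def by (auto intro!: derivative_eq_intros)

lemma has_dd_mult: "has_dd v f F \<Longrightarrow> has_dd v g G \<Longrightarrow> has_dd v (f * g) (F * g + f * G)"
  unfolding has_dd_def
proof (intro allI)
  fix z
  assume "\<forall>z. ((\<lambda>t. f (z + t *\<^sub>R v)) has_vector_derivative F z) (at 0)"
    "\<forall>z. ((\<lambda>t. g (z + t *\<^sub>R v)) has_vector_derivative G z) (at 0)"
  then have "((\<lambda>t. f (z + t *\<^sub>R v)) has_vector_derivative F z) (at 0)"
    "((\<lambda>t. g (z + t *\<^sub>R v)) has_vector_derivative G z) (at 0)" by auto
  from has_vector_derivative_mult[OF this]
  show "((\<lambda>t. (f * g) (z + t *\<^sub>R v)) has_vector_derivative (F * g + f * G) z) (at 0)"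
    by (simp add: add.commute)
qed

lemma has_dd_comp:
  assumes "has_dd v f F" "fps_conv_radius g = \<infinity>"
  shows "has_dd v (\<lambda>z. eval_fps g (f z)) (\<lambda>z. F z * eval_fps (fps_deriv g) (f z))"
  unfolding has_dd_def
proof (intro allI)
  fix z
  have 1: "((\<lambda>t. f (z + t *\<^sub>R v)) has_vector_derivative F z) (at 0)"
    using assms(1) by (simp add: has_dd_def)
  have 2: "(eval_fps g has_field_derivative eval_fps (fps_deriv g) (f (z + 0 *\<^sub>R v))) (at (f (z + 0 *\<^sub>R v)))"
    using has_field_derivative_eval_fps[of "f (z + 0 *\<^sub>R v)" g UNIV] assms(2) by simp
  show "((\<lambda>t. eval_fps g (f (z + t *\<^sub>R v))) has_vector_derivative F z * eval_fps (fps_deriv g) (f z)) (at 0)"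
    using field_vector_diff_chain_at[OF 1 2] by (simp add: o_def)
qed

text \<open>Structural induction. The derivative stays in the class because the derivative of an
  entire series is entire; hence all iterated derivatives exist.\<close>

lemma nice_has_dd: "f \<in> nice \<Longrightarrow> \<exists>D\<in>nice. has_dd v f D"
proof (induction rule: nice_induct)
  case (cst c)
  show ?case using has_dd_cst nice_cst[of 0] cst_0 by metis
next
  case (lin l)
  then show ?case using has_dd_lin nice_cst by blast
next
  case (add f g)
  then show ?case using has_dd_add nice_add by blast
next
  case (mult f g)
  then obtain F G where "F \<in> nice" "G \<in> nice" "has_dd v f F" "has_dd v g G" by auto
  then show ?case using has_dd_mult mult.hyps
    by (metis nice_add nice_mult)
next
  case (comp f g)
  then obtain F where F: "F \<in> nice" "has_dd v f F" by auto
  have "F * (\<lambda>z. eval_fps (fps_deriv g) (f z)) \<in> nice"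
    using F comp.hyps fps_conv_radius_deriv_inf by (auto intro!: nice_comp)
  moreover have "F * (\<lambda>z. eval_fps (fps_deriv g) (f z)) = (\<lambda>z. F z * eval_fps (fps_deriv g) (f z))"
    by (simp add: fun_eq_iff)
  ultimately show ?case using has_dd_comp[OF F(2) comp.hyps(2)] by auto
qed

lemma nice_dd: "f \<in> nice \<Longrightarrow> has_dd v f (dir_deriv v f)"
  using nice_has_dd has_dd_imp_dir_deriv by metis

lemma nice_dir_deriv [simp, intro]: "f \<in> nice \<Longrightarrow> dir_deriv v f \<in> nice"
  using nice_has_dd has_dd_imp_dir_deriv by metis

lemma dir_deriv_cst [simp]: "dir_deriv v (cst c) = 0"
  by (rule has_dd_imp_dir_deriv[OF has_dd_cst])

lemma dir_deriv_lin:
  "bounded_linear l \<Longrightarrow> dir_deriv v (\<lambda>z. complex_of_real (l z)) = cst (complex_of_real (l v))"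
  by (rule has_dd_imp_dir_deriv[OF has_dd_lin])

lemma dir_deriv_add:
  "f \<in> nice \<Longrightarrow> g \<in> nice \<Longrightarrow> dir_deriv v (f + g) = dir_deriv v f + dir_deriv v g"
  by (intro has_dd_imp_dir_deriv has_dd_add nice_dd)

lemma dir_deriv_mult:
  "f \<in> nice \<Longrightarrow> g \<in> nice \<Longrightarrow> dir_deriv v (f * g) = dir_deriv v f * g + f * dir_deriv v g"
  by (intro has_dd_imp_dir_deriv has_dd_mult nice_dd)

lemma dir_deriv_comp:
  "f \<in> nice \<Longrightarrow> fps_conv_radius g = \<infinity> \<Longrightarrow>
    dir_deriv v (\<lambda>z. eval_fps g (f z)) = dir_deriv v f * (\<lambda>z. eval_fps (fps_deriv g) (f z))"
  by (rule trans[OF has_dd_imp_dir_deriv[OF has_dd_comp[OF nice_dd]]]) (auto simp: fun_eq_iff)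

text \<open>Symmetry of second derivatives by structural induction: sums and products inherit it,
  and for a composition both orders give the same expression in the first and second derivatives of
  \<open>f\<close>.\<close>

lemma dir_deriv_commute:
  "f \<in> nice \<Longrightarrow> dir_deriv v (dir_deriv w f) = dir_deriv w (dir_deriv v f)"
proof (induction rule: nice_induct)
  case (cst c)
  show ?case unfolding dir_deriv_cst by (metis dir_deriv_cst cst_0)
next
  case (lin l)
  show ?case unfolding dir_deriv_lin[OF lin] dir_deriv_cst by (rule refl)
next
  case (add f g)
  then show "dir_deriv v (dir_deriv w (f + g)) = dir_deriv w (dir_deriv v (f + g))" by (simp add: dir_deriv_add)
next
  case (mult f g)
  then show "dir_deriv v (dir_deriv w (f * g)) = dir_deriv w (dir_deriv v (f * g))" by (simp add: dir_deriv_mult dir_deriv_add nice_mult algebra_simps)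
next
  case (comp f g)
  have *: "dir_deriv v (dir_deriv w (\<lambda>z. eval_fps g (f z))) =
      dir_deriv v (dir_deriv w f) * (\<lambda>z. eval_fps (fps_deriv g) (f z))
      + dir_deriv w f * (dir_deriv v f * (\<lambda>z. eval_fps (fps_deriv (fps_deriv g)) (f z)))" for v w
    using comp by (simp only: dir_deriv_comp dir_deriv_mult nice_comp nice_dir_deriv fps_conv_radius_deriv_inf)
  show "dir_deriv v (dir_deriv w (\<lambda>z. eval_fps g (f z))) = dir_deriv w (dir_deriv v (\<lambda>z. eval_fps g (f z)))"
    unfolding * comp.IH by (simp only: mult.left_commute)
qed

lemma nice_0 [simp, intro]: "0 \<in> nice" and nice_1 [simp, intro]: "1 \<in> nice"
  using nice_cst[of 0] nice_cst[of 1] by (simp_all add: cst_0 cst_1)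

lemma nice_minus [simp, intro]: "f \<in> nice \<Longrightarrow> - f \<in> nice"
proof -
  assume "f \<in> nice"
  then have "cst (-1) * f \<in> nice" by blast
  moreover have "cst (-1) * f = - f" by (simp add: fun_eq_iff)
  ultimately show ?thesis by simp
qed

lemma nice_diff [simp, intro]: "f \<in> nice \<Longrightarrow> g \<in> nice \<Longrightarrow> f - g \<in> nice"
  using nice_add[of f "- g"] by simp

lemma nice_numeral [simp, intro]: "numeral n \<in> nice"
  using nice_cst[of "numeral n"] by (simp add: cst_def numeral_fun)

lemma nice_sum [simp, intro]: "(\<And>i. i \<in> I \<Longrightarrow> f i \<in> nice) \<Longrightarrow> sum f I \<in> nice"
  by (induction I rule: infinite_finite_induct) auto

lemma nice_power [simp, intro]: "f \<in> nice \<Longrightarrow> f ^ n \<in> nice"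
  by (induction n) auto

lemma nice_cscale [simp, intro]: "f \<in> nice \<Longrightarrow> cscale c f \<in> nice"
  by (simp add: cscale_eq)

lemma dir_deriv_0 [simp]: "dir_deriv v 0 = 0"
  using dir_deriv_cst[of v 0] by (simp add: cst_0)

lemma dir_deriv_minus: "f \<in> nice \<Longrightarrow> dir_deriv v (- f) = - dir_deriv v f"
proof -
  assume f: "f \<in> nice"
  then have "dir_deriv v (- f) + dir_deriv v f = 0"
    using dir_deriv_add[of "- f" f v] by simp
  then show ?thesis by (simp add: eq_neg_iff_add_eq_0)
qed

lemma dir_deriv_diff:
  "f \<in> nice \<Longrightarrow> g \<in> nice \<Longrightarrow> dir_deriv v (f - g) = dir_deriv v f - dir_deriv v g"
  using dir_deriv_add[of f "- g" v] by (simp add: dir_deriv_minus)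

lemma dir_deriv_sum:
  "(\<And>i. i \<in> I \<Longrightarrow> f i \<in> nice) \<Longrightarrow> dir_deriv v (sum f I) = (\<Sum>i\<in>I. dir_deriv v (f i))"
  by (induction I rule: infinite_finite_induct) (auto simp: dir_deriv_add)

lemma dir_deriv_cst_mult: "f \<in> nice \<Longrightarrow> dir_deriv v (cst c * f) = cst c * dir_deriv v f"
  by (simp add: dir_deriv_mult)

lemma dir_deriv_cscale: "f \<in> nice \<Longrightarrow> dir_deriv v (cscale c f) = cscale c (dir_deriv v f)"
  by (simp add: cscale_eq dir_deriv_cst_mult)

lemma nice_subspace: "cfun.subspace nice"
  by (auto simp: cfun.subspace_def)

lemma cst_simps:
  "cst a + cst b = cst (a + b)" "cst a * cst b = cst (a * b)" "cst a - cst b = cst (a - b)"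
  "- cst a = cst (- a)"
  by (simp_all add: fun_eq_iff)

lemma numeral_eq_cst: "numeral n = cst (numeral n)"
  by (simp add: fun_eq_iff)

lemma sum_fun_apply [simp]: "sum f I z = (\<Sum>i\<in>I. f i z)" for f :: "'i \<Rightarrow> 'a \<Rightarrow> complex"
  by (induction I rule: infinite_finite_induct) auto

lemma power_fun_apply: "(f ^ n) z = f z ^ n" for f :: "'a \<Rightarrow> complex"
  by (induction n) auto

section \<open>Euler, Laplace and Casimir operators\<close>

text \<open>Used for \<open>\<real>\<^sup>n\<close> itself and for the two groups of coordinates on \<open>\<real>\<^sup>p \<times> \<real>\<^sup>q\<close>.\<close>

locale coords =
  fixes e :: "'n::finite \<Rightarrow> 'a::real_normed_vector" and l :: "'n \<Rightarrow> 'a \<Rightarrow> real"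
  assumes bounded_linear_l: "bounded_linear (l i)"
    and l_e: "l i (e j) = (if i = j then 1 else 0)"
begin

definition X :: "'n \<Rightarrow> 'a \<Rightarrow> complex" where "X i = (\<lambda>z. complex_of_real (l i z))"
definition D :: "'n \<Rightarrow> ('a \<Rightarrow> complex) \<Rightarrow> 'a \<Rightarrow> complex" where "D i = dir_deriv (e i)"
text \<open>The factor 1/2 makes the coordinates the partial derivatives of
  \<open>rho\<close>.\<close>

definition rho :: "'a \<Rightarrow> complex" where "rho = cst (1/2) * (\<Sum>i\<in>UNIV. X i * X i)"
definition Eul :: "('a \<Rightarrow> complex) \<Rightarrow> 'a \<Rightarrow> complex" where "Eul f = (\<Sum>i\<in>UNIV. X i * D i f)"
definition Lap :: "('a \<Rightarrow> complex) \<Rightarrow> 'a \<Rightarrow> complex" where "Lap f = (\<Sum>i\<in>UNIV. D i (D i f))"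
definition Rot :: "'n \<Rightarrow> 'n \<Rightarrow> ('a \<Rightarrow> complex) \<Rightarrow> 'a \<Rightarrow> complex" where
  "Rot i j f = X i * D j f - X j * D i f"
text \<open>The sum runs over ordered pairs, so this is twice the usual sum over i < j; hence the
  factor 2 in \<open>Cas_eq\<close> and in the eigenvalues.\<close>

definition Cas :: "('a \<Rightarrow> complex) \<Rightarrow> 'a \<Rightarrow> complex" where
  "Cas f = (\<Sum>i\<in>UNIV. \<Sum>j\<in>UNIV. Rot i j (Rot i j f))"

lemma nice_X [simp, intro]: "X i \<in> nice"
  unfolding X_def by (rule nice_lin[OF bounded_linear_l])

lemma nice_D [simp, intro]: "f \<in> nice \<Longrightarrow> D i f \<in> nice"
  by (simp add: D_def)

lemma nice_ops [simp, intro]: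
  shows nice_rho: "rho \<in> nice"
    and nice_Eul: "f \<in> nice \<Longrightarrow> Eul f \<in> nice"
    and nice_Lap: "f \<in> nice \<Longrightarrow> Lap f \<in> nice"
    and nice_Rot: "f \<in> nice \<Longrightarrow> Rot i j f \<in> nice"
    and nice_Cas: "f \<in> nice \<Longrightarrow> Cas f \<in> nice"
  by (auto simp: rho_def Eul_def Lap_def Rot_def Cas_def)

lemma D_X: "D i (X j) = (if i = j then 1 else 0)"
  unfolding D_def X_def by (simp add: dir_deriv_lin[OF bounded_linear_l] l_e cst_0 cst_1)

lemma D_simps:
  shows D_cst: "D i (cst c) = 0"
    and D_0: "D i 0 = 0"
    and D_add: "f \<in> nice \<Longrightarrow> g \<in> nice \<Longrightarrow> D i (f + g) = D i f + D i g"
    and D_diff: "f \<in> nice \<Longrightarrow> g \<in> nice \<Longrightarrow> D i (f - g) = D i f - D i g"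
    and D_mult: "f \<in> nice \<Longrightarrow> g \<in> nice \<Longrightarrow> D i (f * g) = D i f * g + f * D i g"
    and D_sum: "(\<And>k. k \<in> I \<Longrightarrow> F k \<in> nice) \<Longrightarrow> D i (sum F I) = (\<Sum>k\<in>I. D i (F k))"
    and D_cscale: "f \<in> nice \<Longrightarrow> D i (cscale c f) = cscale c (D i f)"
  by (simp_all add: D_def dir_deriv_add dir_deriv_mult dir_deriv_sum dir_deriv_diff
      dir_deriv_cscale)

lemma D_commute: "f \<in> nice \<Longrightarrow> D i (D j f) = D j (D i f)"
  unfolding D_def by (rule dir_deriv_commute)

lemma delta_mult: "(if P then 1 else 0) * f = (if P then f else 0)"
    "f * (if P then 1 else 0) = (if P then f else 0)" for f :: "'a \<Rightarrow> complex"
  by simp_all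

lemma D_rho: "D i rho = X i"
proof -
  have "D i rho = cst (1/2) * (X i + X i)"
    unfolding rho_def by (simp flip: sum_distrib_left add: D_simps D_X sum.distrib delta_mult)
  then show ?thesis by (simp add: fun_eq_iff)
qed

lemma Eul_mult: "f \<in> nice \<Longrightarrow> g \<in> nice \<Longrightarrow> Eul (f * g) = Eul f * g + f * Eul g"
  by (simp add: Eul_def D_mult sum.distrib sum_distrib_left sum_distrib_right algebra_simps)

lemma Eul_add: "f \<in> nice \<Longrightarrow> g \<in> nice \<Longrightarrow> Eul (f + g) = Eul f + Eul g"
  and Eul_diff: "f \<in> nice \<Longrightarrow> g \<in> nice \<Longrightarrow> Eul (f - g) = Eul f - Eul g"
  by (simp_all add: Eul_def D_simps sum.distrib algebra_simps sum_subtractf)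

lemma Eul_cst: "Eul (cst c) = 0"
  and Eul_0: "Eul 0 = 0"
  by (simp_all add: Eul_def D_simps)

lemma Eul_cscale: "f \<in> nice \<Longrightarrow> Eul (cscale c f) = cscale c (Eul f)"
  by (simp add: cscale_eq Eul_mult Eul_cst)

lemma Eul_sum: "(\<And>k. k \<in> I \<Longrightarrow> F k \<in> nice) \<Longrightarrow> Eul (sum F I) = (\<Sum>k\<in>I. Eul (F k))"
  by (induction I rule: infinite_finite_induct) (auto simp: Eul_0 Eul_add)

lemma Eul_X: "Eul (X i) = X i"
  by (simp add: Eul_def D_X delta_mult)

lemma Eul_rho: "Eul rho = 2 * rho"
  by (simp add: Eul_def D_rho) (simp add: rho_def fun_eq_iff)

lemma Lap_add: "f \<in> nice \<Longrightarrow> g \<in> nice \<Longrightarrow> Lap (f + g) = Lap f + Lap g"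
  and Lap_diff: "f \<in> nice \<Longrightarrow> g \<in> nice \<Longrightarrow> Lap (f - g) = Lap f - Lap g"
  by (simp_all add: Lap_def D_simps sum.distrib sum_subtractf)

lemma Lap_0: "Lap 0 = 0"
  by (simp add: Lap_def D_simps)

lemma Lap_mult:
  "f \<in> nice \<Longrightarrow> g \<in> nice \<Longrightarrow> Lap (f * g) = Lap f * g + 2 * (\<Sum>i\<in>UNIV. D i f * D i g) + f * Lap g"
  by (simp add: Lap_def D_simps sum.distrib sum_distrib_left sum_distrib_right algebra_simps)

lemma Lap_cscale: "f \<in> nice \<Longrightarrow> Lap (cscale c f) = cscale c (Lap f)"
  by (simp add: Lap_def D_simps cfun.scale_sum_right)

lemma Lap_sum: "(\<And>k. k \<in> I \<Longrightarrow> F k \<in> nice) \<Longrightarrow> Lap (sum F I) = (\<Sum>k\<in>I. Lap (F k))"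
  by (induction I rule: infinite_finite_induct) (auto simp: Lap_0 Lap_add)

lemma Lap_X: "Lap (X i) = 0"
proof -
  have "D k (D k (X i)) = 0" for k
    by (cases "k = i") (use D_cst[of k 1] in \<open>simp_all add: D_X D_0 cst_1\<close>)
  then show ?thesis by (simp add: Lap_def)
qed

lemma Lap_rho: "Lap rho = cst (of_nat CARD('n))"
  by (simp add: Lap_def D_rho D_X fun_eq_iff)

lemma Lap_rho_mult: "f \<in> nice \<Longrightarrow> Lap (rho * f) = cst (of_nat CARD('n)) * f + 2 * Eul f + rho * Lap f"
  by (simp add: Lap_mult Lap_rho D_rho Eul_def)

lemma Lap_X_mult: "f \<in> nice \<Longrightarrow> Lap (X i * f) = 2 * D i f + X i * Lap f"
  by (simp add: Lap_mult Lap_X D_X delta_mult)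

lemma D_Lap: "f \<in> nice \<Longrightarrow> Lap (D i f) = D i (Lap f)"
  by (simp add: Lap_def D_sum D_commute[of "D _ f"] D_commute[of f i])

lemma D_Eul: "f \<in> nice \<Longrightarrow> D i (Eul f) = D i f + Eul (D i f)"
  by (simp add: Eul_def D_simps D_X sum.distrib delta_mult D_commute[of f i])

lemma Lap_Eul: "f \<in> nice \<Longrightarrow> Lap (Eul f) = 2 * Lap f + Eul (Lap f)"
proof -
  assume f: "f \<in> nice"
  have "Lap (Eul f) = (\<Sum>i\<in>UNIV. 2 * D i (D i f) + Eul (D i (D i f)))"
    unfolding Lap_def using f by (intro sum.cong refl) (simp add: D_Eul D_add algebra_simps)
  also have "\<dots> = 2 * Lap f + Eul (Lap f)"
    using f by (simp add: sum.distrib Lap_def Eul_sum sum_distrib_left)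
  finally show ?thesis .
qed

lemma Rot_add: "f \<in> nice \<Longrightarrow> g \<in> nice \<Longrightarrow> Rot i j (f + g) = Rot i j f + Rot i j g"
  and Rot_cst: "Rot i j (cst c) = 0"
  and Rot_mult: "f \<in> nice \<Longrightarrow> g \<in> nice \<Longrightarrow> Rot i j (f * g) = Rot i j f * g + f * Rot i j g"
  by (simp_all add: Rot_def D_simps algebra_simps)

lemma Rot_0: "Rot i j 0 = 0"
  by (simp add: Rot_def D_simps)

lemma Rot_cst_mult: "f \<in> nice \<Longrightarrow> Rot i j (cst c * f) = cst c * Rot i j f"
  by (simp add: Rot_mult Rot_cst)

text \<open>If the gradient is parallel to the position vector, the two terms of \<open>Rot\<close>
  cancel.\<close>

lemma Rot_radial:
  assumes "f \<in> nice" "\<And>i. D i f = X i * g"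
  shows "Rot i j f = 0"
  by (simp add: Rot_def assms)

lemma Rot_mult_radial:
  assumes "f \<in> nice" "g \<in> nice" "\<And>i j. Rot i j f = 0"
  shows "Rot i j (f * g) = f * Rot i j g"
  using assms by (simp add: Rot_mult)

lemma Cas_mult_radial:
  assumes "f \<in> nice" "g \<in> nice" "\<And>i j. Rot i j f = 0"
  shows "Cas (f * g) = f * Cas g"
  using assms by (simp add: Cas_def Rot_mult_radial sum_distrib_left)

lemma Cas_add: "f \<in> nice \<Longrightarrow> g \<in> nice \<Longrightarrow> Cas (f + g) = Cas f + Cas g"
  by (simp add: Cas_def Rot_add sum.distrib)

lemma Cas_cscale: "f \<in> nice \<Longrightarrow> Cas (cscale c f) = cscale c (Cas f)"
  by (simp add: cscale_eq Cas_mult_radial Rot_cst)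

lemma Rot_Lap: "f \<in> nice \<Longrightarrow> Lap (Rot i j f) = Rot i j (Lap f)"
  by (simp add: Rot_def Lap_diff Lap_X_mult D_Lap D_commute[of f i] algebra_simps)

lemma Cas_Lap: "f \<in> nice \<Longrightarrow> Lap (Cas f) = Cas (Lap f)"
  by (simp add: Cas_def Lap_sum Rot_Lap)

lemma Cas_rho: "f \<in> nice \<Longrightarrow> Cas (rho * f) = rho * Cas f"
  by (rule Cas_mult_radial) (auto intro!: Rot_radial[of _ 1] simp: D_rho)

text \<open>The polar form of the Laplacian: r^2 \<Delta> = E^2 + (n - 2) E plus half of
  \<open>Cas\<close>. It expresses \<open>rho * Lap\<close> through operators that act on products
  of harmonic and radial functions by scalars or by first-order operators on the radial
  part.\<close>

lemma Cas_eq: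
  assumes f: "f \<in> nice"
  shows "Cas f = 2 * (2 * rho * Lap f - Eul (Eul f) - (cst (of_nat CARD('n)) - 2) * Eul f)"
proof -
  define P where "P i j g = X i * D j g" for i j g
  have nP [simp]: "P i j g \<in> nice" if "g \<in> nice" for i j g using that by (simp add: P_def)
  have Rot_P: "Rot i j g = P i j g - P j i g" for i j g by (simp add: Rot_def P_def)
  have P_diff: "P i j (g - h) = P i j g - P i j h" if "g \<in> nice" "h \<in> nice" for i j g h
    using that by (simp add: P_def D_simps algebra_simps)
  have "Cas f = (\<Sum>i\<in>UNIV. \<Sum>j\<in>UNIV. P i j (P i j f) - P i j (P j i f) - P j i (P i j f) + P j i (P j i f))"
    unfolding Cas_def using f by (intro sum.cong refl) (simp add: Rot_P P_diff algebra_simps)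
  also have "\<dots> = (\<Sum>i\<in>UNIV. \<Sum>j\<in>UNIV. P i j (P i j f)) - (\<Sum>i\<in>UNIV. \<Sum>j\<in>UNIV. P i j (P j i f))
      - (\<Sum>i\<in>UNIV. \<Sum>j\<in>UNIV. P j i (P i j f)) + (\<Sum>i\<in>UNIV. \<Sum>j\<in>UNIV. P j i (P j i f))"
    by (simp add: sum.distrib sum_subtractf)
  also have "(\<Sum>i\<in>UNIV. \<Sum>j\<in>UNIV. P j i (P j i f)) = (\<Sum>i\<in>UNIV. \<Sum>j\<in>UNIV. P i j (P i j f))"
    by (rule sum.swap)
  also have "(\<Sum>i\<in>UNIV. \<Sum>j\<in>UNIV. P j i (P i j f)) = (\<Sum>i\<in>UNIV. \<Sum>j\<in>UNIV. P i j (P j i f))"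
    by (rule sum.swap)
  also have "(\<Sum>i\<in>UNIV. \<Sum>j\<in>UNIV. P i j (P i j f)) = Eul f + 2 * rho * Lap f"
  proof -
    have "P i j (P i j f) = (if i = j then X i * D j f else 0) + (X i * X i) * D j (D j f)" for i j
      unfolding P_def using f by (simp add: D_simps D_X algebra_simps)
    then have "(\<Sum>i\<in>UNIV. \<Sum>j\<in>UNIV. P i j (P i j f)) = Eul f + (\<Sum>i\<in>UNIV. X i * X i) * Lap f"
      unfolding Lap_def sum_product by (simp add: sum.distrib delta_mult Eul_def)
    also have "(\<Sum>i\<in>UNIV. X i * X i) = 2 * rho" by (simp add: rho_def fun_eq_iff)
    finally show ?thesis .
  qed
  also have "(\<Sum>i\<in>UNIV. \<Sum>j\<in>UNIV. P i j (P j i f)) = cst (of_nat CARD('n)) * Eul f + Eul (Eul f) - Eul f"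
  proof -
    have "P i j (P j i f) = X i * D i f + X i * (X j * D j (D i f))" for i j
      unfolding P_def using f by (simp add: D_simps D_X algebra_simps cst_1)
    then have "(\<Sum>i\<in>UNIV. \<Sum>j\<in>UNIV. P i j (P j i f)) = cst (of_nat CARD('n)) * Eul f + (\<Sum>i\<in>UNIV. X i * Eul (D i f))"
      by (simp add: sum.distrib Eul_def sum_distrib_left fun_eq_iff)
    also have "(\<Sum>i\<in>UNIV. X i * Eul (D i f)) = Eul (Eul f) - Eul f"
    proof -
      have "Eul (Eul f) = (\<Sum>i\<in>UNIV. X i * (D i f + Eul (D i f)))"
        unfolding Eul_def[of "Eul f"] using f by (simp add: D_Eul)
      also have "\<dots> = Eul f + (\<Sum>i\<in>UNIV. X i * Eul (D i f))"
        by (simp add: Eul_def[of f] sum.distrib algebra_simps)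
      finally show ?thesis by simp
    qed
    finally show ?thesis by (simp only: add_diff_eq)
  qed
  finally have "Cas f = Eul f + 2 * rho * Lap f - (cst (of_nat CARD('n)) * Eul f + Eul (Eul f) - Eul f)
      - (cst (of_nat CARD('n)) * Eul f + Eul (Eul f) - Eul f) + (Eul f + 2 * rho * Lap f)" .
  then show ?thesis by (rule trans) (simp add: algebra_simps)
qed

end

section \<open>Linear algebra\<close>

text \<open>Linearity relative to a set: the differential operators are total functions, but their
  additivity is known only where the derivatives exist, so \<open>S\<close> is mostly
  \<open>nice\<close>.\<close>

definition lin_on :: "('a \<Rightarrow> complex) set \<Rightarrow> (('a \<Rightarrow> complex) \<Rightarrow> 'b \<Rightarrow> complex) \<Rightarrow> bool" where
  "lin_on S T \<longleftrightarrow> (\<forall>f\<in>S. \<forall>g\<in>S. T (f + g) = T f + T g) \<and> (\<forall>f\<in>S. \<forall>c. T (cscale c f) = cscale c (T f))"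

lemma lin_onI:
  assumes "\<And>f g. f \<in> S \<Longrightarrow> g \<in> S \<Longrightarrow> T (f + g) = T f + T g"
    and "\<And>f c. f \<in> S \<Longrightarrow> T (cscale c f) = cscale c (T f)"
  shows "lin_on S T"
  using assms by (auto simp: lin_on_def)

lemma lin_onD:
  assumes "lin_on S T"
  shows "f \<in> S \<Longrightarrow> g \<in> S \<Longrightarrow> T (f + g) = T f + T g"
    and "f \<in> S \<Longrightarrow> T (cscale c f) = cscale c (T f)"
  using assms by (auto simp: lin_on_def)

lemma lin_on_subset: "lin_on S T \<Longrightarrow> S' \<subseteq> S \<Longrightarrow> lin_on S' T"
  unfolding lin_on_def by blast

lemma lin_on_0:
  assumes "lin_on S T" "cfun.subspace S"
  shows "T 0 = 0"
  using lin_onD(2)[OF assms(1) cfun.subspace_0[OF assms(2)], of 0] by simp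

lemma lin_on_sum:
  assumes T: "lin_on S T" and S: "cfun.subspace S" and F: "\<And>i. i \<in> I \<Longrightarrow> F i \<in> S"
  shows "T (sum F I) = (\<Sum>i\<in>I. T (F i))"
  using F
proof (induction I rule: infinite_finite_induct)
  case (insert i I)
  have "sum F I \<in> S" using S insert.prems by (auto intro: cfun.subspace_sum)
  moreover have "T (sum F I) = (\<Sum>i\<in>I. T (F i))" by (rule insert.IH) (use insert.prems in simp)
  ultimately show "T (sum F (insert i I)) = (\<Sum>i\<in>insert i I. T (F i))"
    using insert.prems insert.hyps lin_onD(1)[OF T, of "F i" "sum F I"] by simp
next
  case (infinite I)
  show "T (sum F I) = (\<Sum>i\<in>I. T (F i))" using infinite by (simp add: lin_on_0[OF T S])
next
  case empty
  show "T (sum F {}) = (\<Sum>i\<in>{}. T (F i))" by (simp add: lin_on_0[OF T S])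
qed

lemma lin_on_image_span:
  assumes T: "lin_on S T" and S: "cfun.subspace S" and A: "A \<subseteq> S"
    and B: "\<And>a. a \<in> A \<Longrightarrow> T a \<in> B" and "cfun.subspace B" and f: "f \<in> cfun.span A"
  shows "T f \<in> B"
proof -
  have "f \<in> S \<and> T f \<in> B"
    using f
  proof (induction rule: cfun.span_induct_alt)
    case base
    show "0 \<in> S \<and> T 0 \<in> B"
      using lin_on_0[OF T S] cfun.subspace_0[OF S] cfun.subspace_0[OF assms(5)] by simp
  next
    case (step c x y)
    then have x: "x \<in> S" "T x \<in> B" using A B by auto
    have "cscale c x \<in> S" using x S by (simp add: cfun.subspace_scale)
    moreover have "T (cscale c x + y) = cscale c (T x) + T y"
      using step lin_onD(1)[OF T \<open>cscale c x \<in> S\<close>, of y] lin_onD(2)[OF T, of x c] x by simp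
    moreover have "cscale c x + y \<in> S" "cscale c (T x) + T y \<in> B"
      using step x assms(5) S \<open>cscale c x \<in> S\<close> by (auto intro: cfun.subspace_add cfun.subspace_scale)
    ultimately show "cscale c x + y \<in> S \<and> T (cscale c x + y) \<in> B" by simp
  qed
  then show ?thesis by simp
qed

text \<open>Eigenvectors for distinct eigenvalues are independent: subtracting c0 times the relation
  from its image under \<open>T\<close> removes the term of c0 and multiplies the others by the
  nonzero numbers c - c0.\<close>

lemma eigen_sum_zero:
  assumes S: "cfun.subspace S" and T: "lin_on S T" and C: "finite C"
    and "\<And>c. c \<in> C \<Longrightarrow> G c \<in> S" "\<And>c. c \<in> C \<Longrightarrow> T (G c) = cscale c (G c)"
    and "(\<Sum>c\<in>C. G c) = 0" and "c \<in> C"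
  shows "G c = 0"
  using C assms(4-7)
proof (induction C arbitrary: G c rule: finite_induct)
  case (insert c0 C)
  have GS: "G c \<in> S" if "c \<in> insert c0 C" for c using insert.prems that by auto
  have G0: "(\<Sum>c\<in>insert c0 C. G c) = 0" by (rule insert.prems(3))
  have "0 = T (\<Sum>c\<in>insert c0 C. G c)" unfolding G0 lin_on_0[OF T S] ..
  also have "\<dots> = (\<Sum>c\<in>insert c0 C. cscale c (G c))"
    by (rule trans[OF lin_on_sum[OF T S GS] sum.cong[OF refl insert.prems(2)]])
  finally have 1: "(\<Sum>c\<in>insert c0 C. cscale c (G c)) = 0" ..
  have 2: "(\<Sum>c\<in>insert c0 C. cscale c0 (G c)) = 0"
    unfolding cfun.scale_sum_right[symmetric] G0 by simp
  have "(\<Sum>c\<in>insert c0 C. cscale (c - c0) (G c)) = 0"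
    using 1 2 by (simp only: cfun.scale_left_diff_distrib sum_subtractf) simp
  then have sz: "(\<Sum>c\<in>C. cscale (c - c0) (G c)) = 0"
    using insert.hyps by simp
  have z: "cscale (c - c0) (G c) = 0" if "c \<in> C" for c
  proof (rule insert.IH[of "\<lambda>c. cscale (c - c0) (G c)", OF _ _ sz that])
    fix c assume c: "c \<in> C"
    show "cscale (c - c0) (G c) \<in> S" using GS c S by (simp add: cfun.subspace_scale)
    show "T (cscale (c - c0) (G c)) = cscale c (cscale (c - c0) (G c))"
      unfolding lin_onD(2)[OF T GS[OF insertI2[OF c]]] insert.prems(2)[OF insertI2[OF c]]
      by (simp add: mult.commute)
  qed
  have Gz: "G c = 0" if "c \<in> C" for c
    using z[OF that] insert.hyps that by (metis cfun.scale_eq_0_iff right_minus_eq)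
  then have "G c0 = 0" using G0 insert.hyps by simp
  then show "G c = 0" using Gz insert.prems(4) by auto
qed simp

text \<open>Here eigenvalues may repeat. A vanishing sum splits into vanishing partial sums, one for
  each eigenvalue, and these can be split again by a further operator.\<close>

lemma eigen_separate:
  assumes S: "cfun.subspace S" and T: "lin_on S T" and I: "finite I"
    and F: "\<And>i. i \<in> I \<Longrightarrow> F i \<in> S" "\<And>i. i \<in> I \<Longrightarrow> T (F i) = cscale (\<mu> i) (F i)"
    and "(\<Sum>i\<in>I. F i) = 0"
  shows "(\<Sum>i\<in>{i \<in> I. \<mu> i = c}. F i) = 0"
proof (cases "c \<in> \<mu> ` I")
  case True
  show ?thesis
  proof (rule eigen_sum_zero[OF S T, of "\<mu> ` I" "\<lambda>c. \<Sum>i\<in>{i \<in> I. \<mu> i = c}. F i"])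
    show "(\<Sum>c\<in>\<mu> ` I. \<Sum>i\<in>{i \<in> I. \<mu> i = c}. F i) = 0"
      using assms(6) sum.image_gen[OF I, of F \<mu>] by simp
    fix c
    show "(\<Sum>i\<in>{i \<in> I. \<mu> i = c}. F i) \<in> S" using F S by (auto intro: cfun.subspace_sum)
    show "T (\<Sum>i\<in>{i \<in> I. \<mu> i = c}. F i) = cscale c (\<Sum>i\<in>{i \<in> I. \<mu> i = c}. F i)"
      using F by (subst lin_on_sum[OF T S]) (auto simp: cfun.scale_sum_right intro!: sum.cong)
  qed (use I True in auto)
next
  case False
  then have "{i \<in> I. \<mu> i = c} = {}" by auto
  then show ?thesis by (simp only: sum.empty)
qed

text \<open>An indexed family may a priori repeat vectors; a repetition would give a relation with
  coefficients 1 and -1, so independence of the family includes injectivity.\<close>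

lemma dim_family:
  fixes F :: "'i \<Rightarrow> 'a \<Rightarrow> complex"
  assumes I: "finite I" and ind: "\<And>c. (\<Sum>i\<in>I. cscale (c i) (F i)) = 0 \<Longrightarrow> \<forall>i\<in>I. c i = 0"
  shows "cfun.dim (cfun.span (F ` I)) = card I"
proof -
  have inj: "inj_on F I"
  proof (rule inj_onI, rule ccontr)
    fix i j assume ij: "i \<in> I" "j \<in> I" "F i = F j" "i \<noteq> j"
    let ?c = "\<lambda>k. if k = i then 1 else if k = j then - 1 else (0::complex)"
    have "(\<Sum>k\<in>I. cscale (?c k) (F k)) = (\<Sum>k\<in>{i, j}. cscale (?c k) (F k))"
      using I ij by (intro sum.mono_neutral_right) auto
    also have "\<dots> = 0" using ij by simp
    finally have "\<forall>i\<in>I. ?c i = 0" by (rule ind)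
    then show False using ij(1) by (auto dest!: bspec[of _ _ i])
  qed
  have "cfun.independent (F ` I)"
  proof (rule cfun.independent_if_scalars_zero)
    fix c x assume s: "(\<Sum>x\<in>F ` I. cscale (c x) x) = 0" and x: "x \<in> F ` I"
    have "(\<Sum>i\<in>I. cscale (c (F i)) (F i)) = 0"
      using s sum.reindex[OF inj, of "\<lambda>x. cscale (c x) x"] by (simp add: o_def)
    from ind[of "\<lambda>i. c (F i)", OF this] x show "c x = 0" by auto
  qed (use I in simp)
  then show ?thesis unfolding card_image[OF inj, symmetric] by (rule cfun.dim_span_eq_card_independent)
qed

lemma independent_sum_zero:
  assumes "cfun.independent B" "finite B" "(\<Sum>b\<in>B. cscale (c b) b) = 0" "b \<in> B"
  shows "c b = 0"
  using cfun.independentD[OF assms(1,2) _ assms(3,4)] by auto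

lemma fin_basis:
  assumes "cfun.subspace V" "V \<subseteq> cfun.span A" "finite A"
  obtains B where "finite B" "cfun.independent B" "cfun.span B = V" "card B = cfun.dim V" "B \<subseteq> V"
proof -
  obtain B where B: "B \<subseteq> V" "cfun.independent B" "V \<subseteq> cfun.span B" "card B = cfun.dim V"
    by (rule cfun.basis_exists)
  have "finite B" using cfun.independent_span_bound[OF assms(3) B(2)] B(1) assms(2) by blast
  moreover have "cfun.span B = V" using B assms(1) by (simp add: cfun.span_minimal subset_antisym)
  ultimately show ?thesis using that B by blast
qed

text \<open>\<open>cfun.dim\<close> is 0 on infinite-dimensional spaces, so monotonicity is
  available only below a finitely spanned space.\<close>

lemma dim_mono_fin:
  assumes "cfun.subspace V" "cfun.subspace W" "V \<subseteq> W" "W \<subseteq> cfun.span A" "finite A"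
  shows "cfun.dim V \<le> cfun.dim W"
proof -
  obtain B where B: "finite B" "cfun.span B = W" "card B = cfun.dim W"
    using fin_basis[OF assms(2,4,5)] by metis
  show ?thesis using cfun.dim_le_card[of V B] assms(3) B by simp
qed

lemma span_finite_image:
  assumes "finite I" "f \<in> cfun.span (F ` I)"
  shows "\<exists>c. f = (\<Sum>i\<in>I. cscale (c i) (F i))"
proof -
  have "cfun.subspace {(\<Sum>i\<in>I. cscale (c i) (F i)) | c. True}"
    unfolding cfun.subspace_def
  proof (intro conjI ballI allI)
    show "0 \<in> {(\<Sum>i\<in>I. cscale (c i) (F i)) | c. True}"
      by (intro CollectI exI[of _ "\<lambda>_. 0"]) simp
  next
    fix x y assume "x \<in> {(\<Sum>i\<in>I. cscale (c i) (F i)) | c. True}" "y \<in> {(\<Sum>i\<in>I. cscale (c i) (F i)) | c. True}"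
    then obtain c d where "x = (\<Sum>i\<in>I. cscale (c i) (F i))" "y = (\<Sum>i\<in>I. cscale (d i) (F i))" by auto
    then have "x + y = (\<Sum>i\<in>I. cscale (c i + d i) (F i))"
      by (simp only: cfun.scale_left_distrib sum.distrib)
    then show "x + y \<in> {(\<Sum>i\<in>I. cscale (c i) (F i)) | c. True}"
      by (intro CollectI exI[of _ "\<lambda>i. c i + d i"]) simp
  next
    fix x a assume "x \<in> {(\<Sum>i\<in>I. cscale (c i) (F i)) | c. True}"
    then obtain c where "x = (\<Sum>i\<in>I. cscale (c i) (F i))" by auto
    then have "cscale a x = (\<Sum>i\<in>I. cscale (a * c i) (F i))"
      by (simp only: cfun.scale_sum_right cfun.scale_scale)
    then show "cscale a x \<in> {(\<Sum>i\<in>I. cscale (c i) (F i)) | c. True}"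
      by (intro CollectI exI[of _ "\<lambda>i. a * c i"]) simp
  qed
  moreover have "F ` I \<subseteq> {(\<Sum>i\<in>I. cscale (c i) (F i)) | c. True}"
  proof
    fix x assume "x \<in> F ` I"
    then obtain j where j: "j \<in> I" "x = F j" by auto
    have "(\<Sum>i\<in>I. cscale (if i = j then 1 else 0) (F i)) = (\<Sum>i\<in>I. if i = j then F j else 0)"
      by (intro sum.cong) auto
    also have "\<dots> = x" using j assms(1) by simp
    finally have "x = (\<Sum>i\<in>I. cscale (if i = j then 1 else 0) (F i))" ..
    then show "x \<in> {(\<Sum>i\<in>I. cscale (c i) (F i)) | c. True}"
      by (intro CollectI exI[of _ "\<lambda>i. if i = j then 1 else 0"]) simp
  qed
  ultimately have "cfun.span (F ` I) \<subseteq> {(\<Sum>i\<in>I. cscale (c i) (F i)) | c. True}"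
    by (rule cfun.span_minimal[rotated])
  then show ?thesis using assms(2) by blast
qed

text \<open>A basis of the kernel and chosen preimages of a basis of the image form a basis of
  \<open>V\<close>.\<close>

lemma rank_nullity_onto:
  assumes V: "cfun.subspace V" "V \<subseteq> cfun.span A" "finite A" and W: "cfun.subspace W"
    and L: "lin_on V L" and onto: "L ` V = W"
  shows "cfun.dim V = cfun.dim {v \<in> V. L v = 0} + cfun.dim W"
proof -
  let ?K = "{v \<in> V. L v = 0}"
  have K: "cfun.subspace ?K"
    using V(1) lin_onD[OF L] lin_on_0[OF L V(1)] by (auto simp: cfun.subspace_def)
  obtain BK where BK: "finite BK" "cfun.independent BK" "cfun.span BK = ?K" "card BK = cfun.dim ?K" "BK \<subseteq> ?K"
    using fin_basis[OF K _ V(3)] V(2) by blast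
  have "W \<subseteq> cfun.span (L ` V)" using onto cfun.span_superset by blast
  obtain C where C: "finite C" "cfun.span C = V" "C \<subseteq> V" using fin_basis[OF V] by metis
  have "W \<subseteq> cfun.span (L ` C)"
  proof
    fix w assume "w \<in> W"
    then obtain v where v: "v \<in> V" "w = L v" using onto by auto
    show "w \<in> cfun.span (L ` C)"
      unfolding v(2)
      by (rule lin_on_image_span[OF L V(1) C(3)]) (use v C in \<open>auto intro: cfun.span_base\<close>)
  qed
  then obtain BW where BW: "finite BW" "cfun.independent BW" "cfun.span BW = W" "card BW = cfun.dim W" "BW \<subseteq> W"
    using fin_basis[OF W] C(1) by (metis finite_imageI)
  have "\<forall>w\<in>BW. \<exists>v\<in>V. L v = w" using BW(5) onto by blast
  then obtain s where s: "\<And>w. w \<in> BW \<Longrightarrow> s w \<in> V \<and> L (s w) = w" by metis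
  \<comment> \<open>\<open>Inl\<close> indexes the basis of the kernel, \<open>Inr\<close> the basis
    of the image, represented by its preimages.\<close>
  define F where "F i = (case i of Inl b \<Rightarrow> b | Inr w \<Rightarrow> s w)" for i
  define I where "I = BK <+> BW"
  have I: "finite I" using BK BW by (simp add: I_def)
  have sumI: "(\<Sum>i\<in>I. cscale (c i) (F i)) = (\<Sum>b\<in>BK. cscale (c (Inl b)) b) + (\<Sum>w\<in>BW. cscale (c (Inr w)) (s w))" for c
    using BK(1) BW(1) by (simp add: I_def F_def sum.Plus)
  have Ls: "L (\<Sum>w\<in>BW. cscale (c w) (s w)) = (\<Sum>w\<in>BW. cscale (c w) w)" for c
  proof -
    have "L (\<Sum>w\<in>BW. cscale (c w) (s w)) = (\<Sum>w\<in>BW. L (cscale (c w) (s w)))"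
      by (rule lin_on_sum[OF L V(1)]) (use s V(1) in \<open>simp add: cfun.subspace_scale\<close>)
    also have "\<dots> = (\<Sum>w\<in>BW. cscale (c w) w)"
      by (rule sum.cong[OF refl]) (use s lin_onD(2)[OF L] in simp)
    finally show ?thesis .
  qed
  have sV: "(\<Sum>w\<in>BW. cscale (c w) (s w)) \<in> V" for c
    by (rule cfun.subspace_sum[OF V(1)], rule cfun.subspace_scale[OF V(1)]) (use s in auto)
  have bK: "(\<Sum>b\<in>BK. cscale (c b) b) \<in> ?K" for c
    by (rule cfun.subspace_sum[OF K], rule cfun.subspace_scale[OF K]) (use BK(5) in auto)
  have "cfun.dim (cfun.span (F ` I)) = card I"
  proof (rule dim_family[OF I])
    fix c assume 0: "(\<Sum>i\<in>I. cscale (c i) (F i)) = 0"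
    have "0 = L (\<Sum>i\<in>I. cscale (c i) (F i))" using 0 lin_on_0[OF L V(1)] by simp
    also have "\<dots> = (\<Sum>w\<in>BW. cscale (c (Inr w)) w)"
      unfolding sumI using lin_onD(1)[OF L _ sV[of "\<lambda>w. c (Inr w)"], of "\<Sum>b\<in>BK. cscale (c (Inl b)) b"]
        bK[of "\<lambda>b. c (Inl b)"] Ls[of "\<lambda>w. c (Inr w)"] by simp
    finally have c0: "c (Inr w) = 0" if "w \<in> BW" for w
      using independent_sum_zero[OF BW(2,1), of "\<lambda>w. c (Inr w)" w] that by simp
    then have "(\<Sum>b\<in>BK. cscale (c (Inl b)) b) = 0" using 0 unfolding sumI by simp
    then have "c (Inl b) = 0" if "b \<in> BK" for b
      using independent_sum_zero[OF BK(2,1), of "\<lambda>w. c (Inl w)" b] that by simp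
    then show "\<forall>i\<in>I. c i = 0" using c0 by (auto simp: I_def)
  qed
  moreover have "cfun.span (F ` I) = V"
  proof
    have "F ` I \<subseteq> V" using BK(5) s by (auto simp: I_def F_def)
    then show "cfun.span (F ` I) \<subseteq> V" using V(1) by (simp add: cfun.span_minimal)
    show "V \<subseteq> cfun.span (F ` I)"
    proof
      fix v assume v: "v \<in> V"
      then have "L v \<in> cfun.span ((\<lambda>w. w) ` BW)" using onto BW(3) by auto
      then obtain c where c: "L v = (\<Sum>w\<in>BW. cscale (c w) w)" using span_finite_image[OF BW(1)] by blast
      let ?u = "\<Sum>w\<in>BW. cscale (c w) (s w)"
      have vu: "v - ?u \<in> V" using v sV V(1) by (simp add: cfun.subspace_diff)
      have "L v = L (v - ?u) + L ?u" using lin_onD(1)[OF L vu sV[of c]] by simp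
      then have "L (v - ?u) = 0" using c Ls[of c] by simp
      then have "v - ?u \<in> cfun.span BK" using BK(3) vu by simp
      then have "v - ?u \<in> cfun.span (F ` I)"
        by (rule rev_subsetD[OF _ cfun.span_mono]) (force simp: I_def F_def)
      moreover have "?u \<in> cfun.span (F ` I)"
        by (rule cfun.span_sum, rule cfun.span_scale, rule cfun.span_base) (force simp: I_def F_def)
      ultimately have "(v - ?u) + ?u \<in> cfun.span (F ` I)" by (rule cfun.span_add)
      then show "v \<in> cfun.span (F ` I)" by simp
    qed
  qed
  moreover have "card I = card BK + card BW" using BK BW by (simp add: I_def card_Plus)
  ultimately show ?thesis using BK BW by simp
qed

lemma mult_cscale: "f * cscale c g = cscale c (f * g)" "cscale c g * f = cscale c (g * f)"
  by (simp_all add: cscale_def fun_eq_iff)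

section \<open>Homogeneous and harmonic polynomials\<close>

interpretation pl: coords "\<lambda>i::'n::finite. axis i (1::real)" "\<lambda>i x. x $ i"
  by (rule coords.intro) (auto simp: axis_def intro: bounded_linear_vec_nth)

definition monom_fun :: "('n::finite \<Rightarrow> nat) \<Rightarrow> real^'n \<Rightarrow> complex" where
  "monom_fun d = (\<lambda>x. \<Prod>i\<in>UNIV. complex_of_real (x $ i) ^ d i)"

lemma hp_eq: "homogeneous_polys k = cfun.span (monom_fun ` {d. (\<Sum>i\<in>UNIV. d i) = k})"
  unfolding homogeneous_polys_def monom_fun_def by (rule arg_cong[where f = cfun.span]) auto

lemma hp_subspace [simp, intro]: "cfun.subspace (homogeneous_polys k)"
  unfolding hp_eq by (rule cfun.subspace_span)

lemma X_monom_fun: "pl.X (i::'n::finite) * monom_fun d = monom_fun (d(i := Suc (d i)))"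
proof
  fix x :: "real^'n"
  have *: "monom_fun e x = complex_of_real (x $ i) ^ e i * (\<Prod>j\<in>UNIV - {i}. complex_of_real (x $ j) ^ e j)" for e
    unfolding monom_fun_def by (rule prod.remove) auto
  show "(pl.X i * monom_fun d) x = monom_fun (d(i := Suc (d i))) x"
    unfolding * times_fun_apply by (auto simp: pl.X_def intro!: prod.cong)
qed

lemma monom_fun_0: "monom_fun (\<lambda>_. 0) = 1"
  by (simp add: monom_fun_def fun_eq_iff)

lemma hp_X_mult:
  fixes f :: "real^'n::finite \<Rightarrow> complex"
  assumes "f \<in> homogeneous_polys k"
  shows "pl.X i * f \<in> homogeneous_polys (Suc k)"
proof -
  have "lin_on UNIV (\<lambda>f. pl.X i * f)"
    by (rule lin_onI) (simp_all add: algebra_simps cscale_eq)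
  from lin_on_image_span[OF this _ _ _ hp_subspace assms[unfolded hp_eq]]
  show ?thesis
  proof
    fix f :: "real^'n \<Rightarrow> complex"
    assume "f \<in> monom_fun ` {d. (\<Sum>i\<in>UNIV. d i) = k}"
    then obtain d where d: "f = monom_fun d" "(\<Sum>i\<in>UNIV. d i) = k" by auto
    have "(\<Sum>j\<in>UNIV. (d(i := Suc (d i))) j) = Suc k"
      using d(2) by (subst sum.remove[of _ i]) (auto simp: sum.remove[of UNIV i d])
    then show "pl.X i * f \<in> homogeneous_polys (Suc k)"
      unfolding d(1) X_monom_fun hp_eq by (intro cfun.span_base) auto
  qed auto
qed

text \<open>Every monomial arises from 1 by multiplication with coordinates, and monomials span. The
  degree is an argument of \<open>Q\<close> because properties such as Euler's relation mention
  it.\<close>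

lemma hp_induct [consumes 1, case_names const X_mult subspace]:
  assumes f: "f \<in> homogeneous_polys k"
    and 1: "Q 0 1"
    and X: "\<And>k g i. g \<in> homogeneous_polys k \<Longrightarrow> Q k g \<Longrightarrow> Q (Suc k) (pl.X i * g)"
    and S: "\<And>k. cfun.subspace {g \<in> homogeneous_polys k. Q k g}"
  shows "Q k f"
proof -
  have m: "Q (\<Sum>i\<in>UNIV. d i) (monom_fun d)" for d :: "'a \<Rightarrow> nat"
  proof (induction "\<Sum>i\<in>UNIV. d i" arbitrary: d)
    case 0
    then have "d = (\<lambda>_. 0)" by (auto simp: fun_eq_iff)
    then show ?case using 1 monom_fun_0 by (metis 0)
  next
    case (Suc n)
    have "\<exists>i. d i > 0"
    proof (rule ccontr)
      assume "\<not> (\<exists>i. d i > 0)"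
      then have "(\<Sum>i\<in>UNIV. d i) = 0" by simp
      then show False using Suc.hyps(2) by simp
    qed
    then obtain i where i: "d i > 0" by auto
    define d' where "d' = d(i := d i - 1)"
    have d: "d = d'(i := Suc (d' i))" using i by (auto simp: d'_def)
    have n: "(\<Sum>i\<in>UNIV. d' i) = n"
      using Suc.hyps(2) i by (simp add: d'_def sum.remove[of UNIV i])
    have "monom_fun d' \<in> homogeneous_polys n" unfolding hp_eq using n by (auto intro: cfun.span_base)
    then have "Q (Suc n) (pl.X i * monom_fun d')" using X Suc.hyps(1)[of d'] n by auto
    then show "Q (\<Sum>i\<in>UNIV. d i) (monom_fun d)" unfolding X_monom_fun d[symmetric] Suc.hyps(2) .
  qed
  have "homogeneous_polys k \<subseteq> {g \<in> homogeneous_polys k. Q k g}"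
    unfolding hp_eq[of k]
    by (rule cfun.span_minimal[OF _ S[unfolded hp_eq]]) (auto intro: cfun.span_base simp: m)
  then show ?thesis using f by auto
qed

lemma nice_hp [simp]: "f \<in> homogeneous_polys k \<Longrightarrow> f \<in> nice"
proof (induction rule: hp_induct)
  case (subspace k)
  show "cfun.subspace {g \<in> homogeneous_polys k. g \<in> nice}"
    using cfun.subspace_inter[OF hp_subspace[of k] nice_subspace] by (simp add: Int_def)
next
  case (X_mult k g i)
  then show "pl.X i * g \<in> nice" by (intro nice_mult) auto
qed (rule nice_1)

text \<open>Degree 0 is stated apart: with a truncated k - 1 the conclusion would only say that the
  derivative of a constant is constant.\<close>

lemma hp_D:
  assumes "f \<in> homogeneous_polys k"
  shows "(k = 0 \<longrightarrow> pl.D j f = 0) \<and> (\<forall>k'. k = Suc k' \<longrightarrow> pl.D j f \<in> homogeneous_polys k')"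
  using assms
proof (induction rule: hp_induct)
  case const
  show "(0 = (0::nat) \<longrightarrow> pl.D j 1 = 0) \<and> (\<forall>k'. 0 = Suc k' \<longrightarrow> pl.D j 1 \<in> homogeneous_polys k')"
    using pl.D_cst[of j 1] by (simp add: cst_1)
next
  case (X_mult k g i)
  have g: "g \<in> nice" using X_mult by simp
  have *: "pl.D j (pl.X i * g) = (if j = i then g else 0) + pl.X i * pl.D j g"
    using g by (simp add: pl.D_mult pl.D_X)
  have "pl.X i * pl.D j g \<in> homogeneous_polys k"
  proof (cases k)
    case 0
    then have "pl.D j g = 0" using X_mult by blast
    then show ?thesis using cfun.subspace_0[OF hp_subspace] by simp
  next
    case (Suc k')
    then show ?thesis using X_mult hp_X_mult by blast
  qed
  then have "pl.D j (pl.X i * g) \<in> homogeneous_polys k"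
    unfolding * using X_mult cfun.subspace_0[OF hp_subspace] by (intro cfun.subspace_add) auto
  then show "(Suc k = 0 \<longrightarrow> pl.D j (pl.X i * g) = 0) \<and>
      (\<forall>k'. Suc k = Suc k' \<longrightarrow> pl.D j (pl.X i * g) \<in> homogeneous_polys k')" by simp
next
  case (subspace k)
  have "pl.D j 0 = 0" by (rule pl.D_0)
  then show "cfun.subspace {g \<in> homogeneous_polys k. (k = 0 \<longrightarrow> pl.D j g = 0) \<and>
      (\<forall>k'. k = Suc k' \<longrightarrow> pl.D j g \<in> homogeneous_polys k')}"
    by (cases k) (auto simp: cfun.subspace_def pl.D_add pl.D_cscale
        intro: cfun.subspace_0[OF hp_subspace] cfun.subspace_add[OF hp_subspace]
          cfun.subspace_scale[OF hp_subspace])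
qed

lemma hp_D_0: "f \<in> homogeneous_polys 0 \<Longrightarrow> pl.D j f = 0"
  and hp_D_Suc: "f \<in> homogeneous_polys (Suc k) \<Longrightarrow> pl.D j f \<in> homogeneous_polys k"
  using hp_D by blast+

lemma subspace_eigenspace:
  "cfun.subspace {f \<in> V. T f = cst c * f}" if "cfun.subspace V" "lin_on V T"
  using that lin_on_0[OF that(2,1)] lin_onD[OF that(2)]
  by (auto simp: cfun.subspace_def algebra_simps cscale_eq)

lemma hp_Eul:
  assumes "f \<in> homogeneous_polys k"
  shows "pl.Eul f = cst (of_nat k) * f"
  using assms
proof (induction rule: hp_induct)
  case const
  show "pl.Eul 1 = cst (of_nat 0) * 1" using pl.Eul_cst[of 1] by (simp add: cst_1 cst_0)
next
  case (X_mult k g i)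
  have "pl.Eul g = cst (of_nat k) * g" by (rule X_mult)
  with X_mult(1) show "pl.Eul (pl.X i * g) = cst (of_nat (Suc k)) * (pl.X i * g)"
    by (simp add: pl.Eul_mult pl.Eul_X cst_simps(1)[symmetric] cst_1 algebra_simps)
next
  case (subspace k)
  show "cfun.subspace {g \<in> homogeneous_polys k. pl.Eul g = cst (of_nat k) * g}"
    by (rule subspace_eigenspace) (auto intro!: lin_onI simp: pl.Eul_add pl.Eul_cscale)
qed

lemma hp_scale:
  assumes "f \<in> homogeneous_polys k"
  shows "f (s *\<^sub>R x) = complex_of_real s ^ k * f x"
proof -
  have "\<forall>x. f (s *\<^sub>R x) = complex_of_real s ^ k * f x"
    using assms
  proof (induction rule: hp_induct)
    case (X_mult k g i)
    then show "\<forall>x. (pl.X i * g) (s *\<^sub>R x) = complex_of_real s ^ Suc k * (pl.X i * g) x"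
      by (simp add: pl.X_def)
  next
    case (subspace k)
    show "cfun.subspace {g \<in> homogeneous_polys k. \<forall>x. g (s *\<^sub>R x) = complex_of_real s ^ k * g x}"
      by (auto simp: cfun.subspace_def cscale_def algebra_simps
        intro: cfun.subspace_0[OF hp_subspace] cfun.subspace_add[OF hp_subspace]
          cfun.subspace_scale[OF hp_subspace, unfolded cscale_def])
  qed simp
  then show ?thesis by blast
qed

lemma hp_rho_mult: "f \<in> homogeneous_polys k \<Longrightarrow> pl.rho * f \<in> homogeneous_polys (Suc (Suc k))"
proof -
  assume f: "f \<in> homogeneous_polys k"
  have "pl.rho * f = cscale (1/2) (\<Sum>i\<in>UNIV. pl.X i * (pl.X i * f))"
    by (simp add: pl.rho_def cscale_eq sum_distrib_right sum_distrib_left mult.assoc)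
  also have "\<dots> \<in> homogeneous_polys (Suc (Suc k))"
    using f by (intro cfun.subspace_scale cfun.subspace_sum hp_subspace hp_X_mult)
  finally show ?thesis .
qed

lemma hp_Lap:
  assumes "f \<in> homogeneous_polys (Suc (Suc k))"
  shows "pl.Lap f \<in> homogeneous_polys k"
  unfolding pl.Lap_def using assms by (intro cfun.subspace_sum hp_subspace hp_D_Suc)

lemma hp_Lap_small:
  assumes "f \<in> homogeneous_polys k" "k < 2"
  shows "pl.Lap f = 0"
proof -
  have "pl.D i (pl.D i f) = 0" for i
  proof (cases k)
    case 0
    then show ?thesis using hp_D_0 assms by (metis pl.D_0)
  next
    case (Suc k')
    then have "pl.D i f \<in> homogeneous_polys 0" using assms hp_D_Suc by (metis One_nat_def less_2_cases_iff nat.distinct(1) nat.inject)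
    then show ?thesis by (rule hp_D_0)
  qed
  then show ?thesis by (simp add: pl.Lap_def)
qed

lemma finite_degs: "finite {d :: 'n::finite \<Rightarrow> nat. (\<Sum>i\<in>UNIV. d i) = k}"
proof (rule finite_subset)
  show "{d :: 'n \<Rightarrow> nat. (\<Sum>i\<in>UNIV. d i) = k} \<subseteq> PiE UNIV (\<lambda>_. {..k})"
    by (auto intro: member_le_sum[of _ UNIV, simplified])
qed (auto intro: finite_PiE)

text \<open>Stars and bars: an enumeration of the index type turns exponent functions into lists of
  length n with sum k.\<close>

lemma card_degs:
  "card {d :: 'n::finite \<Rightarrow> nat. (\<Sum>i\<in>UNIV. d i) = k} = (k + CARD('n) - 1) choose k"
proof -
  obtain b where b: "bij_betw b {..<CARD('n)} (UNIV :: 'n set)"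
    using ex_bij_betw_nat_finite[of "UNIV :: 'n set"] by (auto simp: atLeast0LessThan)
  have "bij_betw (\<lambda>d. map (d \<circ> b) [0..<CARD('n)]) {d :: 'n \<Rightarrow> nat. (\<Sum>i\<in>UNIV. d i) = k}
      {l. size l = CARD('n) \<and> sum_list l = k}"
  proof (rule bij_betw_byWitness[where f' = "\<lambda>l i. l ! (the_inv_into {..<CARD('n)} b i)"])
    have s: "(\<Sum>i\<in>UNIV. d i) = (\<Sum>j<CARD('n). d (b j))" for d :: "'n \<Rightarrow> nat"
      using sum.reindex_bij_betw[OF b, of d] by simp
    have inv: "the_inv_into {..<CARD('n)} b (b j) = j" if "j < CARD('n)" for j
      using b that by (simp add: bij_betw_def the_inv_into_f_f)
    have inv2: "b (the_inv_into {..<CARD('n)} b i) = i" "the_inv_into {..<CARD('n)} b i < CARD('n)" for i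
      using b f_the_inv_into_f_bij_betw[OF b] bij_betw_the_inv_into[OF b] by (auto simp: bij_betw_def)
    show "\<forall>a\<in>{d. (\<Sum>i\<in>UNIV. d i) = k}.
        (\<lambda>i. map (a \<circ> b) [0..<CARD('n)] ! the_inv_into {..<CARD('n)} b i) = a"
      using inv2 by (auto simp: fun_eq_iff)
    show "\<forall>a'\<in>{l. length l = CARD('n) \<and> sum_list l = k}.
        map ((\<lambda>i. a' ! the_inv_into {..<CARD('n)} b i) \<circ> b) [0..<CARD('n)] = a'"
      using inv by (auto intro!: nth_equalityI)
    show "(\<lambda>d. map (d \<circ> b) [0..<CARD('n)]) ` {d. (\<Sum>i\<in>UNIV. d i) = k}
        \<subseteq> {l. length l = CARD('n) \<and> sum_list l = k}"
      by (auto simp: s sum_list_sum_nth atLeast0LessThan)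
    show "(\<lambda>l i. l ! the_inv_into {..<CARD('n)} b i) ` {l. length l = CARD('n) \<and> sum_list l = k}
        \<subseteq> {d. (\<Sum>i\<in>UNIV. d i) = k}"
      using inv by (auto simp: s sum_list_sum_nth atLeast0LessThan)
  qed
  then show ?thesis by (simp add: bij_betw_same_card card_length_sum_list)
qed

lemma nice_monom_fun: "monom_fun d \<in> nice"
proof -
  have "monom_fun d \<in> homogeneous_polys (\<Sum>i\<in>UNIV. d i)" unfolding hp_eq by (auto intro: cfun.span_base)
  then show ?thesis by simp
qed

text \<open>Monomials are joint eigenfunctions of the operators x_i d/dx_i, with the exponents as
  eigenvalues; this is what makes them independent in \<open>dim_hp\<close>.\<close>

lemma X_D_monom_fun: "pl.X i * pl.D i (monom_fun d) = cscale (of_nat (d i)) (monom_fun d)"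
proof (induction "d i" arbitrary: d)
  case 0
  have "((\<lambda>t. monom_fun d (x + t *\<^sub>R axis i 1)) has_vector_derivative 0) (at 0)" for x :: "real^'a"
  proof -
    have "monom_fun d (x + t *\<^sub>R axis i 1) = monom_fun d x" for t
      unfolding monom_fun_def using 0 by (intro prod.cong) (auto simp: axis_def)
    then show ?thesis by simp
  qed
  then have "has_dd (axis i 1) (monom_fun d) 0" by (simp add: has_dd_def)
  then have "pl.D i (monom_fun d) = 0" unfolding pl.D_def by (rule has_dd_imp_dir_deriv)
  then show ?case using 0 by simp
next
  case (Suc n)
  define d' where "d' = d(i := n)"
  have d: "monom_fun d = pl.X i * monom_fun d'" unfolding X_monom_fun d'_def using Suc(2) by simp
  have "pl.X i * pl.D i (monom_fun d') = cscale (of_nat n) (monom_fun d')"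
    using Suc(1)[of d'] by (simp add: d'_def)
  then have "pl.X i * pl.D i (monom_fun d) = pl.X i * monom_fun d' + pl.X i * cscale (of_nat n) (monom_fun d')"
    unfolding d by (simp add: pl.D_mult nice_monom_fun pl.D_X algebra_simps)
  also have "\<dots> = cscale (of_nat (Suc n)) (monom_fun d)"
    unfolding d by (simp add: cscale_def fun_eq_iff algebra_simps)
  finally show ?case using Suc(2) by simp
qed

text \<open>Distinct exponent vectors are distinct joint eigenvalues. A vanishing combination is
  filtered by one coordinate after the other until a single monomial is left.\<close>

lemma dim_hp:
  "cfun.dim (homogeneous_polys k :: (real^'n::finite \<Rightarrow> complex) set) = (k + CARD('n) - 1) choose k"
  unfolding hp_eq card_degs[symmetric]
proof (rule dim_family[OF finite_degs])
  fix c :: "('n \<Rightarrow> nat) \<Rightarrow> complex"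
  let ?I = "{d :: 'n \<Rightarrow> nat. (\<Sum>i\<in>UNIV. d i) = k}"
  assume 0: "(\<Sum>d\<in>?I. cscale (c d) (monom_fun d)) = 0"
  have "(\<Sum>d\<in>{d \<in> ?I. \<forall>i\<in>A. d i = d0 i}. cscale (c d) (monom_fun d)) = 0" for A d0
    using finite[of A]
  proof (induction A rule: finite_induct)
    case empty
    show ?case using 0 by simp
  next
    case (insert i A)
    let ?J = "{d \<in> ?I. \<forall>i\<in>A. d i = d0 i}"
    have "(\<Sum>d\<in>{d \<in> ?J. complex_of_nat (d i) = of_nat (d0 i)}. cscale (c d) (monom_fun d)) = 0"
    proof (rule eigen_separate[where T = "\<lambda>f. pl.X i * pl.D i f", OF nice_subspace])
      show "lin_on nice (\<lambda>f. pl.X i * pl.D i f)"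
        by (rule lin_onI) (simp_all add: pl.D_add pl.D_cscale, simp_all add: cscale_eq algebra_simps)
      show "finite ?J" by (rule finite_subset[OF _ finite_degs[of k]]) auto
      show "(\<Sum>d\<in>?J. cscale (c d) (monom_fun d)) = 0" by (rule insert.IH)
      fix d
      show "cscale (c d) (monom_fun d) \<in> nice" by (simp add: nice_monom_fun)
      show "pl.X i * pl.D i (cscale (c d) (monom_fun d)) = cscale (of_nat (d i)) (cscale (c d) (monom_fun d))"
        by (simp add: pl.D_cscale nice_monom_fun mult_cscale X_D_monom_fun mult.commute)
    qed
    moreover have "{d \<in> ?J. complex_of_nat (d i) = of_nat (d0 i)} = {d \<in> ?I. \<forall>i\<in>insert i A. d i = d0 i}"
      by auto
    ultimately show "(\<Sum>d\<in>{d \<in> ?I. \<forall>i\<in>insert i A. d i = d0 i}. cscale (c d) (monom_fun d)) = 0" by simp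
  qed
  from this[of UNIV] have *: "(\<Sum>d\<in>{d \<in> ?I. \<forall>i\<in>UNIV. d i = d0 i}. cscale (c d) (monom_fun d)) = 0" for d0 .
  show "\<forall>d\<in>?I. c d = 0"
  proof
    fix d0 assume "d0 \<in> ?I"
    then have "{d \<in> ?I. \<forall>i\<in>UNIV. d i = d0 i} = {d0}" by (auto simp: fun_eq_iff)
    then have "cscale (c d0) (monom_fun d0) = 0" using *[of d0] by simp
    \<comment> \<open>Evaluation at the point with all coordinates 1, where every monomial is
      1.\<close>
    then have "cscale (c d0) (monom_fun d0) (\<chi> i. 1) = 0" by (simp only: zero_fun_apply)
    then show "c d0 = 0" by (simp add: cscale_def monom_fun_def)
  qed
qed

section \<open>Harmonic polynomials and the Fischer decomposition\<close>

lemma harmonic_iff: "h \<in> harmonic_polys k \<longleftrightarrow> h \<in> homogeneous_polys k \<and> pl.Lap h = 0"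
  by (simp add: harmonic_polys_def pl.Lap_def pl.D_def fun_eq_iff)

lemma harm_hp: "h \<in> harmonic_polys k \<Longrightarrow> h \<in> homogeneous_polys k"
  and harm_Lap: "h \<in> harmonic_polys k \<Longrightarrow> pl.Lap h = 0"
  by (simp_all add: harmonic_iff)

lemma nice_harm: "h \<in> harmonic_polys k \<Longrightarrow> h \<in> nice"
  using harm_hp nice_hp by blast

lemma lin_on_Lap: "lin_on nice pl.Lap"
  by (rule lin_onI) (simp_all add: pl.Lap_add pl.Lap_cscale)

lemma harm_eq_kernel: "harmonic_polys k = {h \<in> homogeneous_polys k. pl.Lap h = 0}"
  by (auto simp: harmonic_iff)

lemma lin_on_kernel:
  assumes V: "cfun.subspace V" and L: "lin_on V L"
  shows "cfun.subspace {v \<in> V. L v = 0}"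
proof (rule cfun.subspaceI)
  show "0 \<in> {v \<in> V. L v = 0}" using lin_on_0[OF L V] cfun.subspace_0[OF V] by simp
next
  fix x y assume "x \<in> {v \<in> V. L v = 0}" "y \<in> {v \<in> V. L v = 0}"
  then show "x + y \<in> {v \<in> V. L v = 0}"
    using lin_onD(1)[OF L, of x y] cfun.subspace_add[OF V] by simp
next
  fix c x assume "x \<in> {v \<in> V. L v = 0}"
  then show "cscale c x \<in> {v \<in> V. L v = 0}"
    using lin_onD(2)[OF L, of x c] cfun.subspace_scale[OF V] by simp
qed

lemma harm_subspace [simp, intro]: "cfun.subspace (harmonic_polys k)"
  unfolding harm_eq_kernel
  by (rule lin_on_kernel[OF hp_subspace lin_on_subset[OF lin_on_Lap]]) (auto intro: nice_hp)

lemma harm_D_0: "h \<in> harmonic_polys 0 \<Longrightarrow> pl.D i h = 0"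
  using hp_D_0 harm_hp by blast

lemma harm_D_Suc: "h \<in> harmonic_polys (Suc k) \<Longrightarrow> pl.D i h \<in> harmonic_polys k"
  using nice_harm[of h "Suc k"] by (simp add: harmonic_iff hp_D_Suc pl.D_Lap pl.D_0)

lemma harm_Rot:
  assumes h: "h \<in> harmonic_polys k"
  shows "pl.Rot i j h \<in> harmonic_polys k"
proof -
  have "pl.X i * pl.D j h \<in> homogeneous_polys k" for i j
  proof (cases k)
    case 0
    then have "pl.D j h = 0" using h hp_D_0 harm_hp by blast
    then show ?thesis using cfun.subspace_0[OF hp_subspace] by simp
  next
    case (Suc k')
    then show ?thesis using h hp_D_Suc hp_X_mult harm_hp by blast
  qed
  then have "pl.Rot i j h \<in> homogeneous_polys k"
    unfolding pl.Rot_def by (intro cfun.subspace_diff hp_subspace)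
  moreover have "pl.Lap (pl.Rot i j h) = 0"
    using nice_harm[OF h] harm_Lap[OF h] by (simp add: pl.Rot_Lap pl.Rot_0)
  ultimately show ?thesis by (simp add: harmonic_iff)
qed

text \<open>\<open>Euler + n/2\<close> acts by this scalar on harmonic polynomials of degree \<open>k\<close>.\<close>

definition kappa :: "'n::finite itself \<Rightarrow> nat \<Rightarrow> complex" where
  "kappa _ k = of_nat k + of_nat CARD('n) / 2"

lemma kappa_nz: "kappa TYPE('n::finite) k + of_nat a \<noteq> 0"
proof -
  have "kappa TYPE('n) k + of_nat a = complex_of_real (real k + real CARD('n) / 2 + real a)"
    by (simp add: kappa_def)
  moreover have "real k + real CARD('n) / 2 + real a > 0" by (simp add: add_pos_nonneg add_nonneg_pos)
  ultimately show ?thesis by (simp only: of_real_eq_0_iff)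
qed

text \<open>The harmonic component of \<open>x\<^sub>i h\<close> for \<open>h\<close> harmonic of degree \<open>k\<close>. For \<open>k = 0\<close> the denominator may vanish, but then
  the derivative of \<open>h\<close> is \<open>0\<close>.\<close>

definition harm_up :: "nat \<Rightarrow> 'n \<Rightarrow> (real^'n::finite \<Rightarrow> complex) \<Rightarrow> real^'n \<Rightarrow> complex" where
  "harm_up k i h = pl.X i * h - cscale (1 / (kappa TYPE('n) k - 1)) (pl.rho * pl.D i h)"

text \<open>\<Delta>(x_i h) = 2 D_i h and \<Delta>(\<open>rho\<close> D_i h) = 2 (\<kappa> - 1) D_i
  h, so the correction term cancels the Laplacian of x_i h.\<close>

lemma harm_up:
  fixes h :: "real^'n::finite \<Rightarrow> complex"
  assumes h: "h \<in> harmonic_polys k"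
  shows "harm_up k i h \<in> harmonic_polys (Suc k)"
proof (cases k)
  case 0
  then have "pl.D i h = 0" using h harm_D_0 by blast
  then have "harm_up k i h = pl.X i * h" by (simp add: harm_up_def)
  moreover have "pl.X i * h \<in> homogeneous_polys (Suc k)" using h hp_X_mult harm_hp by blast
  ultimately show ?thesis using 0 hp_Lap_small[of "pl.X i * h" "Suc k"] by (simp add: harmonic_iff)
next
  case (Suc k')
  then have D: "pl.D i h \<in> harmonic_polys k'" using h harm_D_Suc by blast
  then have Dn: "pl.D i h \<in> nice" "pl.rho * pl.D i h \<in> nice" using nice_harm by auto
  have hn: "h \<in> nice" using h nice_harm by blast
  have "harm_up k i h \<in> homogeneous_polys (Suc k)"
    unfolding harm_up_def using harm_hp[OF h] hp_rho_mult[OF harm_hp[OF D]] Suc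
    by (intro cfun.subspace_diff cfun.subspace_scale hp_subspace hp_X_mult) auto
  moreover have "pl.Lap (harm_up k i h) = 0"
  proof -
    have "pl.Lap (pl.rho * pl.D i h) = cst (of_nat CARD('n)) * pl.D i h + 2 * (cst (of_nat k') * pl.D i h)"
      using Dn hp_Eul[OF harm_hp[OF D]] harm_Lap[OF D] by (simp add: pl.Lap_rho_mult)
    also have "\<dots> = cscale (2 * (kappa TYPE('n) k - 1)) (pl.D i h)"
      using Suc by (simp add: fun_eq_iff cscale_def kappa_def algebra_simps)
    finally have 1: "pl.Lap (pl.rho * pl.D i h) = cscale (2 * (kappa TYPE('n) k - 1)) (pl.D i h)" .
    have nz: "kappa TYPE('n) k - 1 \<noteq> 0"
      using kappa_nz[of k' 0, where 'n = 'n] Suc by (simp add: kappa_def)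
    have 2: "pl.Lap (pl.X i * h) = 2 * pl.D i h" using hn harm_Lap[OF h] by (simp add: pl.Lap_X_mult)
    have "pl.Lap (harm_up k i h) = 2 * pl.D i h - cscale (1 / (kappa TYPE('n) k - 1)) (cscale (2 * (kappa TYPE('n) k - 1)) (pl.D i h))"
      unfolding harm_up_def using Dn hn by (simp only: pl.Lap_diff pl.Lap_cscale 1 2 nice_cscale nice_mult pl.nice_X)
    also have "\<dots> = 2 * pl.D i h - cscale 2 (pl.D i h)"
      using nz by (simp only: cfun.scale_scale) (simp add: divide_eq_eq)
    also have "\<dots> = 0" by (simp add: fun_eq_iff cscale_def)
    finally show ?thesis .
  qed
  ultimately show ?thesis by (simp add: harmonic_iff)
qed

text \<open>With \<Delta>h = 0 and Euler's relation, \<open>Cas_eq\<close> reduces to the eigenvalue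
  of spherical harmonics, doubled.\<close>

lemma harm_Cas:
  fixes h :: "real^'n::finite \<Rightarrow> complex"
  assumes h: "h \<in> harmonic_polys k"
  shows "pl.Cas h = cscale (- 2 * (of_nat k * (of_nat k + of_nat CARD('n) - 2))) h"
proof -
  have n: "h \<in> nice" using h nice_harm by blast
  have E: "pl.Eul h = cscale (of_nat k) h" using hp_Eul[OF harm_hp[OF h]] by (simp add: cscale_eq)
  show ?thesis
    unfolding pl.Cas_eq[OF n] E pl.Eul_cscale[OF n] harm_Lap[OF h]
    by (simp add: fun_eq_iff cscale_def algebra_simps)
qed

lemma Eul_rho_power:
  fixes h :: "real^'n::finite \<Rightarrow> complex"
  assumes "h \<in> homogeneous_polys j"
  shows "pl.rho ^ a * h \<in> homogeneous_polys (j + 2 * a)"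
proof (induction a)
  case 0
  show "pl.rho ^ 0 * h \<in> homogeneous_polys (j + 2 * 0)" using assms by simp
next
  case (Suc a)
  have "pl.rho ^ a * h \<in> homogeneous_polys (j + 2 * a)" by (rule Suc)
  from hp_rho_mult[OF this] show "pl.rho ^ Suc a * h \<in> homogeneous_polys (j + 2 * Suc a)"
    by (simp add: mult.assoc)
qed

text \<open>Repeated use of \<open>Lap_rho_mult\<close>. The scalar never vanishes because \<kappa>
  is positive, which makes the Laplacian surjective in \<open>fischer_Lap_onto\<close>.\<close>

lemma Lap_rho_power:
  fixes h :: "real^'n::finite \<Rightarrow> complex"
  assumes h: "h \<in> harmonic_polys j"
  shows "pl.Lap (pl.rho ^ Suc a * h) = cscale (2 * of_nat (Suc a) * (kappa TYPE('n) j + of_nat a)) (pl.rho ^ a * h)"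
proof -
  have n: "pl.rho ^ a * h \<in> nice" for a using h nice_harm by auto
  have s: "pl.Lap (pl.rho ^ Suc a * h) = cst (of_nat CARD('n)) * (pl.rho ^ a * h)
      + 2 * (cst (of_nat (j + 2 * a)) * (pl.rho ^ a * h)) + pl.rho * pl.Lap (pl.rho ^ a * h)" for a
    using pl.Lap_rho_mult[OF n] hp_Eul[OF Eul_rho_power[OF harm_hp[OF h]]] by (simp add: mult.assoc)
  show ?thesis
  proof (induction a)
    case 0
    show ?case unfolding s using harm_Lap[OF h] by (simp add: fun_eq_iff cscale_def kappa_def algebra_simps)
  next
    case (Suc a)
    show ?case unfolding s[of "Suc a"] Suc
      by (simp add: fun_eq_iff cscale_def kappa_def algebra_simps)
  qed
qed

definition fischer :: "nat \<Rightarrow> (real^'n::finite \<Rightarrow> complex) set" where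
  "fischer k = cfun.span {pl.rho ^ a * h | a j h. h \<in> harmonic_polys j \<and> j + 2 * a = k}"

lemma fischer_hp: "fischer k \<subseteq> homogeneous_polys k"
  unfolding fischer_def by (rule cfun.span_minimal) (auto intro!: Eul_rho_power dest: harm_hp)

text \<open>By \<open>Lap_rho_power\<close> a summand \<open>rho ^ a * h\<close> is the Laplacian of
  a multiple of \<open>rho ^ Suc a * h\<close>.\<close>

lemma fischer_Lap_onto:
  assumes "g \<in> fischer k"
  shows "\<exists>f \<in> fischer (Suc (Suc k)). pl.Lap f = g"
  using assms unfolding fischer_def
proof (induction rule: cfun.span_induct_alt)
  case base
  show "\<exists>f\<in>cfun.span {pl.rho ^ a * h | a j h. h \<in> harmonic_polys j \<and> j + 2 * a = Suc (Suc k)}. pl.Lap f = 0"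
    using cfun.span_zero pl.Lap_0 by blast
next
  case (step c x y)
  from step(1) obtain a j h where x: "x = pl.rho ^ a * h" "h \<in> harmonic_polys j" "j + 2 * a = k" by auto
  from step(2) obtain f where f: "f \<in> fischer (Suc (Suc k))" "pl.Lap f = y" unfolding fischer_def by blast
  let ?c = "c / (2 * of_nat (Suc a) * (kappa TYPE('a) j + of_nat a))"
  have nz: "2 * of_nat (Suc a) * (kappa TYPE('a) j + of_nat a) \<noteq> 0" using kappa_nz by (simp del: of_nat_Suc)
  have n: "pl.rho ^ Suc a * h \<in> nice" using x nice_harm by auto
  have fn: "f \<in> nice" using f(1) fischer_hp nice_hp by blast
  have "pl.Lap (cscale ?c (pl.rho ^ Suc a * h) + f) = cscale c x + y"
    using n fn f(2) nz by (simp only: pl.Lap_add pl.Lap_cscale nice_cscale Lap_rho_power[OF x(2)] x(1) cfun.scale_scale) simp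
  moreover have "cscale ?c (pl.rho ^ Suc a * h) + f \<in> fischer (Suc (Suc k))"
    using f(1) unfolding fischer_def
  proof (rule cfun.span_add[rotated], intro cfun.span_scale cfun.span_base CollectI)
    show "\<exists>a' j h'. pl.rho ^ Suc a * h = pl.rho ^ a' * h' \<and> h' \<in> harmonic_polys j \<and> j + 2 * a' = Suc (Suc k)"
      by (intro exI[of _ "Suc a"] exI[of _ j] exI[of _ h]) (use x in simp)
  qed
  ultimately show "\<exists>f\<in>cfun.span {pl.rho ^ a * h | a j h. h \<in> harmonic_polys j \<and> j + 2 * a = Suc (Suc k)}.
      pl.Lap f = cscale c x + y" unfolding fischer_def by blast
qed

text \<open>No inner product is involved: \<Delta>f is decomposable by induction and lifts to some g
  in \<open>fischer k\<close>; then f - g is harmonic.\<close>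

theorem hp_fischer: "homogeneous_polys k = (fischer k :: (real^'n::finite \<Rightarrow> complex) set)"
proof (induction k rule: less_induct)
  case (less k)
  have base: "harmonic_polys k \<subseteq> (fischer k :: (real^'n \<Rightarrow> complex) set)"
    unfolding fischer_def by (rule subsetI, rule cfun.span_base, rule CollectI, rule exI[of _ 0]) auto
  have "homogeneous_polys k \<subseteq> (fischer k :: (real^'n \<Rightarrow> complex) set)"
  proof
    fix f :: "real^'n \<Rightarrow> complex" assume f: "f \<in> homogeneous_polys k"
    show "f \<in> fischer k"
    proof (cases "k < 2")
      case True
      then show ?thesis using base hp_Lap_small[OF f] f by (auto simp: harmonic_iff)
    next
      case False
      define k' where "k' = k - 2"
      have k: "k = Suc (Suc k')" using False by (simp add: k'_def)
      have "pl.Lap f \<in> fischer k'" using hp_Lap f less[of k'] k by auto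
      then obtain g where g: "g \<in> fischer k" "pl.Lap g = pl.Lap f" using fischer_Lap_onto k by blast
      have "g \<in> homogeneous_polys k" using g fischer_hp by blast
      then have "f - g \<in> harmonic_polys k"
        using f g by (simp add: harmonic_iff cfun.subspace_diff pl.Lap_diff)
      then have "(f - g) + g \<in> fischer k"
        using base g(1) unfolding fischer_def by (intro cfun.span_add) auto
      then show ?thesis by simp
    qed
  qed
  then show ?case using fischer_hp by blast
qed

lemma hp_fin: "\<exists>A. finite A \<and> homogeneous_polys k = cfun.span A"
  unfolding hp_eq using finite_degs by blast

lemma harm_fin:
  "\<exists>A. finite A \<and> harmonic_polys k \<subseteq> cfun.span (A :: (real^'n::finite \<Rightarrow> complex) set)"
proof -
  obtain A :: "(real^'n \<Rightarrow> complex) set" where "finite A" "homogeneous_polys k = cfun.span A"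
    using hp_fin by blast
  then show ?thesis using harm_hp by (intro exI[of _ A]) blast
qed

lemma dim_harm_Suc_Suc:
  "cfun.dim (homogeneous_polys (Suc (Suc k)) :: (real^'n::finite \<Rightarrow> complex) set)
    = cfun.dim (harmonic_polys (Suc (Suc k)) :: (real^'n \<Rightarrow> complex) set)
      + cfun.dim (homogeneous_polys k :: (real^'n \<Rightarrow> complex) set)"
proof -
  obtain A :: "(real^'n \<Rightarrow> complex) set" where A: "finite A" "homogeneous_polys (Suc (Suc k)) = cfun.span A"
    using hp_fin by blast
  have "pl.Lap ` homogeneous_polys (Suc (Suc k)) = (homogeneous_polys k :: (real^'n \<Rightarrow> complex) set)"
    using hp_Lap fischer_Lap_onto unfolding hp_fischer by blast
  moreover have "homogeneous_polys (Suc (Suc k)) \<subseteq> (nice :: (real^'n \<Rightarrow> complex) set)" using nice_hp by blast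
  ultimately show ?thesis
    unfolding harm_eq_kernel
    using rank_nullity_onto[OF hp_subspace _ A(1) hp_subspace lin_on_subset[OF lin_on_Lap]] A(2) by blast
qed

text \<open>The difference of the dimensions of homogeneous polynomials in degrees k and k - 2,
  written by Pascal's rule as a sum of two binomials with lower index n - 2, so that the growth 2
  k^(n-2) / (n-2)! is visible. For k = 0 and n = 2 truncated subtraction would give 2 instead of
  1.\<close>

lemma dim_harm:
  assumes n: "CARD('n::finite) \<ge> 2" and k: "k \<ge> 1"
  shows "cfun.dim (harmonic_polys k :: (real^'n \<Rightarrow> complex) set)
    = ((k + CARD('n) - 2) choose (CARD('n) - 2)) + ((k + CARD('n) - 3) choose (CARD('n) - 2))"
proof -
  define n' where "n' = CARD('n) - 2"
  have n': "CARD('n) = Suc (Suc n')" using n by (simp add: n'_def)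
  have ch: "(j + CARD('n) - 1) choose j = (j + Suc n') choose Suc n'" for j
    unfolding n' by (simp add: binomial_symmetric[of j])
  show ?thesis
  proof (cases "k < 2")
    case True
    then have k1: "k = 1" using k by simp
    have "harmonic_polys k = (homogeneous_polys k :: (real^'n \<Rightarrow> complex) set)"
      using hp_Lap_small True by (auto simp: harmonic_iff)
    then show ?thesis using k1 by (simp add: dim_hp n')
  next
    case False
    define k' where "k' = k - 2"
    have k': "k = Suc (Suc k')" using False by (simp add: k'_def)
    show ?thesis
      using dim_harm_Suc_Suc[of k', where 'n = 'n] unfolding dim_hp ch k'[symmetric]
      unfolding k' n' by simp
  qed
qed

lemma harm_basis:
  obtains B :: "(real^'n::finite \<Rightarrow> complex) set"
  where "finite B" "cfun.independent B" "cfun.span B = harmonic_polys k"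
    "card B = cfun.dim (harmonic_polys k :: (real^'n \<Rightarrow> complex) set)" "B \<subseteq> harmonic_polys k"
proof -
  obtain A :: "(real^'n \<Rightarrow> complex) set" where A: "finite A" "harmonic_polys k \<subseteq> cfun.span A"
    using harm_fin by blast
  show ?thesis by (rule fin_basis[OF harm_subspace A(2,1)]) (rule that)
qed

text \<open>By homogeneity a combination vanishing on one sphere vanishes everywhere. This separates
  the angular from the radial dependence.\<close>

lemma hp_sphere_independent:
  fixes B :: "(real^'n::finite \<Rightarrow> complex) set"
  assumes B: "finite B" "cfun.independent B" "B \<subseteq> homogeneous_polys k" and r: "r > 0"
    and z: "\<And>x. norm x = r \<Longrightarrow> (\<Sum>h\<in>B. c h * h x) = 0" and h: "h \<in> B"
  shows "c h = 0"
proof -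
  let ?f = "\<Sum>h\<in>B. cscale (c h) h"
  have f: "?f \<in> homogeneous_polys k"
    using B(3) by (intro cfun.subspace_sum cfun.subspace_scale hp_subspace) auto
  have fz: "?f x = 0" if "norm x = r" for x using z[OF that] by (simp add: cscale_def)
  have f1: "?f x = 0" if x: "x \<noteq> 0" for x
  proof -
    have "?f ((r / norm x) *\<^sub>R x) = complex_of_real (r / norm x) ^ k * ?f x" by (rule hp_scale[OF f])
    moreover have "?f ((r / norm x) *\<^sub>R x) = 0" by (rule fz) (use x r in simp)
    ultimately have "complex_of_real (r / norm x) ^ k * ?f x = 0" by simp
    then show ?thesis using x r by (simp only: mult_eq_0_iff) simp
  qed
  have "axis i 1 \<noteq> (0 :: real^'n)" for i by simp
  \<comment> \<open>The origin is 0 times a unit vector at which the combination vanishes; this also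
    covers degree 0, where 0^0 = 1.\<close>
  then have "?f (0 *\<^sub>R axis undefined 1) = 0" unfolding hp_scale[OF f] using f1 by simp
  then have "?f 0 = 0" by simp
  have "?f x = 0" for x using f1[of x] \<open>?f 0 = 0\<close> by (cases "x = 0") auto
  then have "?f = 0" by (intro ext) (simp del: sum_fun_apply)
  then show ?thesis by (rule independent_sum_zero[OF B(2,1) _ h])
qed

section \<open>Radial functions\<close>

abbreviation entire :: "complex fps \<Rightarrow> bool" where
  "entire g \<equiv> fps_conv_radius g = \<infinity>"

lemma entire_add [simp, intro]: "entire f \<Longrightarrow> entire g \<Longrightarrow> entire (f + g)"
  using fps_conv_radius_add[of f g] by auto

lemma entire_mult [simp, intro]: "entire f \<Longrightarrow> entire g \<Longrightarrow> entire (f * g)"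
  using fps_conv_radius_mult[of f g] by auto

lemma entire_deriv [simp, intro]: "entire f \<Longrightarrow> entire (fps_deriv f)"
  by (rule fps_conv_radius_deriv_inf)

lemma entire_sum [simp, intro]: "(\<And>i. i \<in> I \<Longrightarrow> entire (f i)) \<Longrightarrow> entire (sum f I)"
  by (induction I rule: infinite_finite_induct) auto

text \<open>After division by the lowest power of the variable the series has a nonzero constant
  term, yet by continuity its value at 0 is a limit of zeros.\<close>

lemma eval_entire_0_imp_0:
  assumes g: "entire g" and z: "\<And>t::real. t > 0 \<Longrightarrow> eval_fps g (of_real t) = 0"
  shows "g = 0"
proof (rule ccontr)
  assume "g \<noteq> 0"
  define h where "h = fps_shift (subdegree g) g"
  have h: "entire h" "fps_nth h 0 \<noteq> 0" using g \<open>g \<noteq> 0\<close> by (simp_all add: h_def)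
  have gh: "g = fps_X ^ subdegree g * h"
    unfolding h_def by (simp add: subdegree_decompose mult.commute flip: fps_shift_times_fps_X_power)
  have hz: "eval_fps h (of_real t) = 0" if "t > 0" for t :: real
  proof -
    have "0 = eval_fps (fps_X ^ subdegree g * h) (of_real t)" using z[OF that] gh by simp
    also have "\<dots> = of_real t ^ subdegree g * eval_fps h (of_real t)"
      using h by (subst eval_fps_mult) (auto simp: eval_fps_power)
    finally show ?thesis using that by simp
  qed
  have "isCont (eval_fps h) (of_real 0)"
    using h by (intro continuous_eval_fps) auto
  then have "((\<lambda>t. eval_fps h (of_real t)) \<longlongrightarrow> eval_fps h (of_real 0)) (at_right (0::real))"
    by (intro isCont_tendsto_compose[of _ "eval_fps h"] tendsto_intros) auto
  moreover have "((\<lambda>t. eval_fps h (of_real t)) \<longlongrightarrow> 0) (at_right (0::real))"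
    by (rule tendsto_eventually) (use hz in \<open>auto simp: eventually_at_right_field intro: exI[of _ 1]\<close>)
  ultimately have "eval_fps h (of_real 0) = 0"
    by (rule tendsto_unique[OF trivial_limit_at_right_real])
  then show False using h by (simp add: eval_fps_at_0)
qed

definition PsiF :: "complex \<Rightarrow> complex fps" where
  "PsiF \<alpha> = Abs_fps (\<lambda>n. (- 1) ^ n / (fact n * pochhammer \<alpha> n))"

lemma Psi_eq: "Psi \<alpha> u = eval_fps (PsiF \<alpha>) u"
  by (simp add: Psi_def eval_fps_def PsiF_def)

lemma pochhammer_nz: "\<alpha> \<notin> \<int>\<^sub>\<le>\<^sub>0 \<Longrightarrow> pochhammer \<alpha> n \<noteq> (0::complex)"
  by (auto simp: pochhammer_eq_0_iff)

lemma add_nat_nz: "\<alpha> \<notin> \<int>\<^sub>\<le>\<^sub>0 \<Longrightarrow> \<alpha> + of_nat n \<noteq> (0::complex)"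
  using pochhammer_nz[of \<alpha> "Suc n"] by (auto simp: pochhammer_Suc)

text \<open>Ratio test: consecutive coefficients have a quotient of norm (n + 1) |\<alpha> + n|,
  which tends to infinity.\<close>

lemma entire_PsiF:
  assumes "\<alpha> \<notin> \<int>\<^sub>\<le>\<^sub>0"
  shows "entire (PsiF \<alpha>)"
  unfolding fps_conv_radius_def
proof (rule conv_radius_ratio_limit_ereal_nonzero)
  let ?f = "fps_nth (PsiF \<alpha>)"
  have "norm (?f n) / norm (?f (Suc n)) = norm (of_nat (Suc n) * (\<alpha> + of_nat n))" for n
  proof -
    have "?f n / ?f (Suc n) = - (of_nat (Suc n) * (\<alpha> + of_nat n))"
      using pochhammer_nz[OF assms, of n] add_nat_nz[OF assms, of n]
      by (simp add: PsiF_def pochhammer_rec' field_simps del: of_nat_Suc)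
    then show ?thesis by (metis norm_divide norm_minus_cancel)
  qed
  moreover have "filterlim (\<lambda>n. norm (of_nat (Suc n) * (\<alpha> + of_nat n))) at_top sequentially"
  proof (rule filterlim_at_top_mono)
    show "filterlim (\<lambda>n. - norm \<alpha> + real n) at_top sequentially"
      by (rule filterlim_tendsto_add_at_top[OF tendsto_const filterlim_real_sequentially])
    have "- norm \<alpha> + real n \<le> norm (of_nat (Suc n) * (\<alpha> + of_nat n))" for n
    proof -
      have "- norm \<alpha> + real n \<le> norm (\<alpha> + of_nat n)"
        using norm_triangle_ineq2[of "of_nat n" "- \<alpha>"] by (simp add: add.commute)
      also have "\<dots> \<le> norm (of_nat (Suc n) :: complex) * norm (\<alpha> + of_nat n)"
        using mult_right_mono[of 1 "norm (of_nat (Suc n) :: complex)" "norm (\<alpha> + of_nat n)"]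
        by (simp only: norm_of_nat) simp
      finally show ?thesis by (simp only: norm_mult)
    qed
    then show "\<forall>\<^sub>F n in sequentially. - norm \<alpha> + real n \<le> norm (of_nat (Suc n) * (\<alpha> + of_nat n))" by simp
  qed
  ultimately show "(\<lambda>n. ereal (norm (?f n) / norm (?f (Suc n)))) \<longlonglongrightarrow> \<infinity>"
    by (simp only: tendsto_PInfty_eq_at_top)
qed simp

text \<open>The operator \<open>w\<^sup>-\<^sup>a (w d/dw) w\<^sup>a\<close> on power series in \<open>w = \<rho>\<^sub>x \<rho>\<^sub>y\<close>.\<close>

definition theta :: "nat \<Rightarrow> complex fps \<Rightarrow> complex fps" where
  "theta a g = fps_const (of_nat a) * g + fps_X * fps_deriv g"

lemma theta_nth [simp]: "fps_nth (theta a g) n = (of_nat a + of_nat n) * fps_nth g n"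
  by (cases n) (simp_all add: theta_def algebra_simps)

lemma entire_theta [simp, intro]: "entire g \<Longrightarrow> entire (theta a g)"
  by (simp add: theta_def)

lemma theta_0: "theta 0 g = fps_X * fps_deriv g"
  by (simp add: theta_def)

text \<open>Bessel's equation in the form satisfied by 0F1(; \<alpha>; -w); on coefficients it is (n
  + 1)(\<alpha> + n) c_(n+1) = - c_n.\<close>

lemma PsiF_ode:
  assumes "\<alpha> \<notin> \<int>\<^sub>\<le>\<^sub>0"
  shows "fps_const \<alpha> * fps_deriv (PsiF \<alpha>) + fps_X * fps_deriv (fps_deriv (PsiF \<alpha>)) + PsiF \<alpha> = 0"
proof (rule fps_ext)
  fix n
  have *: "fps_nth (PsiF \<alpha>) (Suc n) = - fps_nth (PsiF \<alpha>) n / (of_nat (Suc n) * (\<alpha> + of_nat n))" for n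
    by (simp add: PsiF_def pochhammer_rec' del: of_nat_Suc)
  show "fps_nth (fps_const \<alpha> * fps_deriv (PsiF \<alpha>) + fps_X * fps_deriv (fps_deriv (PsiF \<alpha>)) + PsiF \<alpha>) n = fps_nth 0 n"
  proof -
    have "fps_nth (fps_const \<alpha> * fps_deriv (PsiF \<alpha>) + fps_X * fps_deriv (fps_deriv (PsiF \<alpha>)) + PsiF \<alpha>) n
      = of_nat (Suc n) * (\<alpha> + of_nat n) * fps_nth (PsiF \<alpha>) (Suc n) + fps_nth (PsiF \<alpha>) n"
      by (cases n) (simp_all add: algebra_simps)
    also have "\<dots> = 0" unfolding * using add_nat_nz[OF assms, of n] by (simp del: of_nat_Suc)
    finally show ?thesis by simp
  qed
qed

lemma PsiF_deriv:
  assumes "\<alpha> \<notin> \<int>\<^sub>\<le>\<^sub>0"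
  shows "fps_deriv (PsiF \<alpha>) = fps_const (- 1 / \<alpha>) * PsiF (\<alpha> + 1)"
  by (rule fps_ext) (simp add: PsiF_def pochhammer_rec fact_reduce field_simps del: of_nat_Suc)

text \<open>A contiguity relation of 0F1; on coefficients it is \<alpha> (\<alpha> + 1)_n =
  (\<alpha>)_n (\<alpha> + n). Together with \<open>PsiF_deriv\<close> it lets the noncompact root
  vectors shift \<kappa> by one in either direction.\<close>

lemma PsiF_shift:
  assumes "\<alpha> \<notin> \<int>\<^sub>\<le>\<^sub>0"
  shows "PsiF \<alpha> = PsiF (\<alpha> + 1) + fps_const (1 / \<alpha>) * (fps_X * fps_deriv (PsiF (\<alpha> + 1)))"
proof (rule fps_ext)
  fix n
  have nz: "\<alpha> \<noteq> 0" "pochhammer (\<alpha> + 1) n \<noteq> 0" "\<alpha> + of_nat n \<noteq> 0" "pochhammer \<alpha> n \<noteq> 0"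
    using assms add_nat_nz[OF assms, of n] pochhammer_nz[OF assms, of "Suc n"] pochhammer_nz[OF assms, of n]
    by (auto simp: pochhammer_rec)
  have p: "\<alpha> * pochhammer (\<alpha> + 1) n = pochhammer \<alpha> n * (\<alpha> + of_nat n)"
    by (metis pochhammer_Suc pochhammer_rec)
  have "fps_nth (PsiF (\<alpha> + 1) + fps_const (1 / \<alpha>) * (fps_X * fps_deriv (PsiF (\<alpha> + 1)))) n
      = (1 + of_nat n / \<alpha>) * fps_nth (PsiF (\<alpha> + 1)) n"
    by (cases n) (simp_all add: algebra_simps add_divide_distrib)
  also have "\<dots> = (\<alpha> + of_nat n) * ((- 1) ^ n / (fact n * (\<alpha> * pochhammer (\<alpha> + 1) n)))"
    using nz by (simp add: PsiF_def field_simps)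
  also have "\<dots> = fps_nth (PsiF \<alpha>) n" unfolding p using nz by (simp add: PsiF_def)
  finally show "fps_nth (PsiF \<alpha>) n
      = fps_nth (PsiF (\<alpha> + 1) + fps_const (1 / \<alpha>) * (fps_X * fps_deriv (PsiF (\<alpha> + 1)))) n" ..
qed

context coords
begin

lemma D_rho_power: "D i (rho ^ Suc a) = cst (of_nat (Suc a)) * rho ^ a * X i"
proof (induction a)
  case 0
  show "D i (rho ^ Suc 0) = cst (of_nat (Suc 0)) * rho ^ 0 * X i" by (simp add: D_rho cst_1)
next
  case (Suc a)
  have IH: "D i (rho ^ Suc a) = cst (of_nat (Suc a)) * rho ^ a * X i" by (rule Suc)
  have "D i (rho ^ Suc (Suc a)) = X i * rho ^ Suc a + rho * D i (rho ^ Suc a)"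
    by (simp only: power_Suc[of rho "Suc a"] D_mult nice_rho nice_power D_rho)
  also have "\<dots> = cst (of_nat (Suc (Suc a))) * rho ^ Suc a * X i"
    unfolding IH by (simp add: fun_eq_iff power_fun_apply algebra_simps)
  finally show "D i (rho ^ Suc (Suc a)) = cst (of_nat (Suc (Suc a))) * rho ^ Suc a * X i" .
qed

end

section \<open>Functions on the product of the two coordinate spaces\<close>

interpretation xx: coords "\<lambda>i::'p::finite. (axis i (1::real), 0 :: real^'q::finite)" "\<lambda>i z. fst z $ i"
  by (rule coords.intro)
    (auto simp: axis_def intro: bounded_linear_compose[OF bounded_linear_vec_nth bounded_linear_fst])

interpretation yy: coords "\<lambda>j::'q::finite. (0 :: real^'p::finite, axis j (1::real))" "\<lambda>j z. snd z $ j"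
  by (rule coords.intro)
    (auto simp: axis_def intro: bounded_linear_compose[OF bounded_linear_vec_nth bounded_linear_snd])

definition lx :: "(real^'p::finite \<Rightarrow> complex) \<Rightarrow> ('p, 'q::finite) funs" where "lx h = (\<lambda>z. h (fst z))"
definition ly :: "(real^'q::finite \<Rightarrow> complex) \<Rightarrow> ('p::finite, 'q) funs" where "ly h = (\<lambda>z. h (snd z))"

lemma nice_compose_linear:
  assumes "f \<in> nice" and L: "bounded_linear L"
  shows "(\<lambda>z. f (L z)) \<in> nice"
  using assms(1)
proof (induction rule: nice_induct)
  case (cst c)
  show "(\<lambda>z. cst c (L z)) \<in> nice" using nice_cst[of c] by (simp add: cst_def)
next
  case (lin l)
  show "(\<lambda>z. complex_of_real (l (L z))) \<in> nice"
    by (rule nice_lin[OF bounded_linear_compose[OF lin L]])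
next
  case (add f g)
  show "(\<lambda>z. (f + g) (L z)) \<in> nice"
    using nice_add[OF add.IH] by (simp only: plus_fun_def)
next
  case (mult f g)
  show "(\<lambda>z. (f * g) (L z)) \<in> nice"
    using nice_mult[OF mult.IH] by (simp only: times_fun_def)
next
  case (comp f g)
  show "(\<lambda>z. eval_fps g (f (L z))) \<in> nice" by (rule nice_comp[OF comp.IH comp.hyps(2)])
qed

lemma nice_lx [simp, intro]: "h \<in> nice \<Longrightarrow> lx h \<in> nice"
  and nice_ly [simp, intro]: "h' \<in> nice \<Longrightarrow> ly h' \<in> nice"
  unfolding lx_def ly_def
  by (auto intro: nice_compose_linear bounded_linear_fst bounded_linear_snd)

lemma l_hom:
  "lx (f + g) = lx f + lx g" "lx (f * g) = lx f * lx g" "lx (f - g) = lx f - lx g"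
  "lx (cst c) = cst c" "lx (cscale c f) = cscale c (lx f)" "lx 0 = 0" "lx (sum F I) = (\<Sum>i\<in>I. lx (F i))"
  "ly (f' + g') = ly f' + ly g'" "ly (f' * g') = ly f' * ly g'" "ly (f' - g') = ly f' - ly g'"
  "ly (cst c) = cst c" "ly (cscale c f') = cscale c (ly f')" "ly 0 = 0" "ly (sum F' I) = (\<Sum>i\<in>I. ly (F' i))"
  by (simp_all add: lx_def ly_def fun_eq_iff cscale_def)

lemma D_lx: "xx.D i (lx h) = lx (pl.D i h)" "yy.D j (lx h) = 0"
  by (simp_all add: xx.D_def yy.D_def pl.D_def dir_deriv_def lx_def fun_eq_iff)

lemma D_ly: "yy.D j (ly h) = ly (pl.D j h)" "xx.D i (ly h) = 0"
  by (simp_all add: xx.D_def yy.D_def pl.D_def dir_deriv_def ly_def fun_eq_iff)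

lemma X_lx: "lx (pl.X i) = xx.X i" "ly (pl.X j) = yy.X j"
  by (simp_all add: lx_def ly_def pl.X_def xx.X_def yy.X_def)

lemma rho_lx: "lx pl.rho = xx.rho" "ly pl.rho = yy.rho"
  by (simp_all add: pl.rho_def xx.rho_def yy.rho_def l_hom X_lx)

lemma Rot_l: "xx.Rot i i' (lx h) = lx (pl.Rot i i' h)" "yy.Rot j j' (ly h') = ly (pl.Rot j j' h')"
  "yy.Rot j j' (lx h) = 0" "xx.Rot i i' (ly h') = 0"
  by (simp_all add: xx.Rot_def pl.Rot_def l_hom D_lx D_ly X_lx[symmetric] yy.Rot_def)

lemma Eul_l: "xx.Eul (lx h) = lx (pl.Eul h)" "yy.Eul (ly h') = ly (pl.Eul h')"
  "yy.Eul (lx h) = 0" "xx.Eul (ly h') = 0"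
  by (simp_all add: xx.Eul_def pl.Eul_def l_hom D_lx D_ly X_lx[symmetric] yy.Eul_def)

lemma Cas_l: "xx.Cas (lx h) = lx (pl.Cas h)" "yy.Cas (ly h') = ly (pl.Cas h')"
  by (simp_all add: xx.Cas_def yy.Cas_def pl.Cas_def l_hom Rot_l)

lemma Lap_l: "xx.Lap (lx h) = lx (pl.Lap h)" "yy.Lap (ly h') = ly (pl.Lap h')"
  by (simp_all add: xx.Lap_def yy.Lap_def pl.Lap_def l_hom D_lx D_ly)

lemma cross_X: "yy.D j (xx.X i) = 0" "xx.D i (yy.X j) = 0" "yy.D j xx.rho = 0" "xx.D i yy.rho = 0"
  by (simp_all add: X_lx[symmetric] rho_lx[symmetric] D_lx D_ly)

definition ev :: "complex fps \<Rightarrow> ('p::finite, 'q::finite) funs" where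
  "ev g = (\<lambda>z. eval_fps g ((xx.rho * yy.rho) z))"

lemma nice_ev [simp, intro]: "entire g \<Longrightarrow> ev g \<in> nice"
  unfolding ev_def by (rule nice_comp[OF nice_mult[OF xx.nice_rho yy.nice_rho]])

lemma ev_hom:
  "entire f \<Longrightarrow> entire g \<Longrightarrow> ev (f + g) = ev f + ev g"
  "entire f \<Longrightarrow> entire g \<Longrightarrow> ev (f * g) = ev f * ev g"
  "ev fps_X = xx.rho * yy.rho" "ev (fps_const c) = cst c" "ev 0 = 0"
  by (auto simp: ev_def fun_eq_iff eval_fps_add eval_fps_mult)

lemma D_ev:
  assumes "entire g"
  shows "xx.D i (ev g) = xx.X i * yy.rho * ev (fps_deriv g)" "yy.D j (ev g) = yy.X j * xx.rho * ev (fps_deriv g)"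
proof -
  have "xx.D i (ev g) = xx.D i (xx.rho * yy.rho) * ev (fps_deriv g)"
    unfolding ev_def xx.D_def using assms by (subst dir_deriv_comp) auto
  then show "xx.D i (ev g) = xx.X i * yy.rho * ev (fps_deriv g)"
    by (simp add: xx.D_mult xx.D_rho cross_X)
  have "yy.D j (ev g) = yy.D j (xx.rho * yy.rho) * ev (fps_deriv g)"
    unfolding ev_def yy.D_def using assms by (subst dir_deriv_comp) auto
  then show "yy.D j (ev g) = yy.X j * xx.rho * ev (fps_deriv g)"
    by (simp add: yy.D_mult yy.D_rho cross_X mult_ac)
qed

definition rad :: "nat \<Rightarrow> nat \<Rightarrow> complex fps \<Rightarrow> ('p::finite, 'q::finite) funs" where
  "rad a b g = xx.rho ^ a * yy.rho ^ b * ev g"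

lemma nice_rad [simp, intro]: "entire g \<Longrightarrow> rad a b g \<in> nice"
  by (simp add: rad_def)

lemma rad_add: "entire f \<Longrightarrow> entire g \<Longrightarrow> rad a b (f + g) = rad a b f + rad a b g"
  and rad_cmult: "entire f \<Longrightarrow> rad a b (fps_const c * f) = cscale c (rad a b f)"
  and rad_0: "rad a b 0 = 0"
  and rad_X_mult: "entire f \<Longrightarrow> rad a b (fps_X * f) = rad (Suc a) (Suc b) f"
  by (simp_all add: rad_def ev_hom cscale_eq algebra_simps)

lemma rad_X_power: "entire f \<Longrightarrow> rad a b (fps_X ^ c * f) = rad (c + a) (c + b) f"
proof (induction c arbitrary: a b)
  case (Suc c)
  have "entire (fps_X ^ c * f)" using Suc.prems by simp
  then show ?case using Suc.IH[of "Suc a" "Suc b"] Suc.prems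
    by (simp add: mult.assoc rad_X_mult)
qed simp

lemma rho_rad: "xx.rho * rad a b g = rad (Suc a) b g" "yy.rho * rad a b g = rad a (Suc b) g"
  by (simp_all add: rad_def algebra_simps)

lemma l_power: "lx (f ^ n) = lx f ^ n" "ly (g ^ n) = ly g ^ n"
  by (simp_all add: lx_def ly_def fun_eq_iff power_fun_apply)

lemma D_power: "yy.D j (xx.rho ^ a) = 0" "xx.D i (yy.rho ^ a) = 0"
  by (simp_all add: rho_lx[symmetric] l_power[symmetric] D_lx D_ly)

text \<open>The gradient is the position vector times a radial function of the same shape. For a
  positive exponent one \<open>rho\<close> is given up and the series becomes \<open>theta\<close>;
  for exponent 0 only the inner derivative of w survives, which leaves the other
  \<open>rho\<close>.\<close>

lemma D_rad:
  assumes g: "entire g"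
  shows "xx.D i (rad 0 b g) = xx.X i * rad 0 (Suc b) (fps_deriv g)"
    and "xx.D i (rad (Suc a) b g) = xx.X i * rad a b (theta (Suc a) g)"
    and "yy.D j (rad a 0 g) = yy.X j * rad (Suc a) 0 (fps_deriv g)"
    and "yy.D j (rad a (Suc b) g) = yy.X j * rad a b (theta (Suc b) g)"
proof -
  note [simp del] = power_Suc of_nat_Suc
  have th: "ev (theta a g) = cst (of_nat a) * ev g + xx.rho * yy.rho * ev (fps_deriv g)" for a
    using g by (simp add: theta_def ev_hom)
  have 0: "xx.D i (xx.rho ^ 0) = 0" "yy.D j (yy.rho ^ 0) = 0"
    using xx.D_cst[of i 1] yy.D_cst[of j 1] by (simp_all add: cst_1)
  show "xx.D i (rad 0 b g) = xx.X i * rad 0 (Suc b) (fps_deriv g)"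
    unfolding rad_def using g by (simp only: xx.D_mult nice_power nice_mult nice_ev xx.nice_rho yy.nice_rho 0 D_power xx.D_rho_power yy.D_rho_power D_ev)
      (simp add: power_Suc algebra_simps)
  show "xx.D i (rad (Suc a) b g) = xx.X i * rad a b (theta (Suc a) g)"
    unfolding rad_def th using g by (simp only: xx.D_mult nice_power nice_mult nice_ev xx.nice_rho yy.nice_rho D_power xx.D_rho_power yy.D_rho_power D_ev)
      (simp add: power_Suc algebra_simps)
  show "yy.D j (rad a 0 g) = yy.X j * rad (Suc a) 0 (fps_deriv g)"
    unfolding rad_def using g by (simp only: yy.D_mult nice_power nice_mult nice_ev xx.nice_rho yy.nice_rho 0 D_power xx.D_rho_power yy.D_rho_power D_ev)
      (simp add: power_Suc algebra_simps)
  show "yy.D j (rad a (Suc b) g) = yy.X j * rad a b (theta (Suc b) g)"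
    unfolding rad_def th using g by (simp only: yy.D_mult nice_power nice_mult nice_ev xx.nice_rho yy.nice_rho D_power xx.D_rho_power yy.D_rho_power D_ev)
      (simp add: power_Suc algebra_simps)
qed

lemma Rot_rad: "entire g \<Longrightarrow> xx.Rot i i' (rad a b g) = 0" "entire g \<Longrightarrow> yy.Rot j j' (rad a b g) = 0"
proof -
  assume g: "entire g"
  show "xx.Rot i i' (rad a b g) = 0" using g by (cases a) (auto intro!: xx.Rot_radial D_rad)
  show "yy.Rot j j' (rad a b g) = 0" using g by (cases b) (auto intro!: yy.Rot_radial D_rad)
qed

lemma sum_X_X: "(\<Sum>i\<in>UNIV. xx.X i * xx.X i) = 2 * xx.rho" "(\<Sum>j\<in>UNIV. yy.X j * yy.X j) = 2 * yy.rho"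
  by (simp_all add: xx.rho_def yy.rho_def fun_eq_iff)

lemma Eul_rad:
  assumes g: "entire g"
  shows "xx.Eul (rad a b g) = cscale 2 (rad a b (theta a g))"
    and "yy.Eul (rad a b g) = cscale 2 (rad a b (theta b g))"
proof -
  have 1: "xx.Eul f = cscale 2 (xx.rho * F)" if "\<And>i. xx.D i f = xx.X i * F" for f F
    unfolding xx.Eul_def that
    by (simp add: mult.assoc[symmetric] sum_distrib_right[symmetric] sum_X_X cscale_eq numeral_eq_cst)
  have 2: "yy.Eul f = cscale 2 (yy.rho * F)" if "\<And>i. yy.D i f = yy.X i * F" for f F
    unfolding yy.Eul_def that
    by (simp add: mult.assoc[symmetric] sum_distrib_right[symmetric] sum_X_X cscale_eq numeral_eq_cst)
  show "xx.Eul (rad a b g) = cscale 2 (rad a b (theta a g))"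
    using g by (cases a) (auto simp: 1[OF D_rad(1)] 1[OF D_rad(2)] rho_rad theta_0 rad_X_mult)
  show "yy.Eul (rad a b g) = cscale 2 (rad a b (theta b g))"
    using g by (cases b) (auto simp: 2[OF D_rad(3)] 2[OF D_rad(4)] rho_rad theta_0 rad_X_mult)
qed

lemma rho_real: "xx.rho z = complex_of_real ((norm (fst z))\<^sup>2 / 2)" "yy.rho z = complex_of_real ((norm (snd z))\<^sup>2 / 2)"
  by (simp_all add: xx.rho_def yy.rho_def xx.X_def yy.X_def norm_vec_def L2_set_def power2_eq_square
      real_sqrt_pow2[unfolded power2_eq_square] sum_nonneg)

section \<open>The sl2 triple and its commutation with rotations\<close>

lemma defs_xy:
  "cx i = xx.X i" "cy j = yy.X j" "dx i = xx.D i" "dy j = yy.D j"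
  "Euler_x f = xx.Eul f" "Euler_y f = yy.Eul f" "Lap_x f = xx.Lap f" "Lap_y f = yy.Lap f"
  "rho_x = xx.rho" "rho_y = yy.rho"
proof -
  show 1: "cx i = xx.X i" "cy j = yy.X j" for i j
    by (simp_all add: fun_eq_iff cx_def cy_def xx.X_def yy.X_def)
  show 2: "dx i = xx.D i" "dy j = yy.D j" for i j
    by (simp_all add: fun_eq_iff dx_def dy_def xx.D_def yy.D_def)
  show "Euler_x f = xx.Eul f" "Euler_y f = yy.Eul f" "Lap_x f = xx.Lap f" "Lap_y f = yy.Lap f"
    by (simp_all add: fun_eq_iff Euler_x_def Euler_y_def Lap_x_def Lap_y_def 1 2
        xx.Eul_def yy.Eul_def xx.Lap_def yy.Lap_def)
  show "rho_x = xx.rho" "rho_y = yy.rho"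
    by (simp_all add: fun_eq_iff rho_x_def rho_y_def r2_x_def r2_y_def 1 xx.rho_def yy.rho_def power2_eq_square)
qed

lemma sl2_eq:
  fixes f :: "('p::finite, 'q::finite) funs"
  shows "sl2_H f = cscale (of_nat CARD('q) / 2 - of_nat CARD('p) / 2) f + yy.Eul f - xx.Eul f"
    and "sl2_Xp f = cscale (- (1/2)) (xx.Lap f + 2 * yy.rho * f)"
    and "sl2_Xm f = cscale (1/2) (2 * xx.rho * f + yy.Lap f)"
proof -
  show "sl2_H f = cscale (of_nat CARD('q) / 2 - of_nat CARD('p) / 2) f + yy.Eul f - xx.Eul f"
    by (simp add: fun_eq_iff sl2_H_def defs_xy cscale_def algebra_simps)
  have "r2_x = (2 * xx.rho :: ('p, 'q) funs)" "r2_y = (2 * yy.rho :: ('p, 'q) funs)"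
    by (simp_all add: fun_eq_iff defs_xy[symmetric] rho_x_def rho_y_def)
  then show "sl2_Xp f = cscale (- (1/2)) (xx.Lap f + 2 * yy.rho * f)"
    "sl2_Xm f = cscale (1/2) (2 * xx.rho * f + yy.Lap f)"
    by (simp_all add: fun_eq_iff sl2_Xp_def sl2_Xm_def defs_xy cscale_def algebra_simps)
qed

lemma nice_sl2 [simp, intro]:
  "f \<in> nice \<Longrightarrow> sl2_H f \<in> nice" "f \<in> nice \<Longrightarrow> sl2_Xp f \<in> nice" "f \<in> nice \<Longrightarrow> sl2_Xm f \<in> nice"
  by (simp_all add: sl2_eq)

lemma cscale_add_right: "cscale c (f + g) = cscale c f + cscale c g"
  by (rule cfun.scale_right_distrib)

lemma lin_on_sl2: "lin_on nice sl2_H" "lin_on nice sl2_Xp" "lin_on nice sl2_Xm"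
  by (rule lin_onI; simp add: sl2_eq xx.Eul_add yy.Eul_add xx.Lap_add yy.Lap_add
      xx.Eul_cscale yy.Eul_cscale xx.Lap_cscale yy.Lap_cscale;
      simp add: fun_eq_iff cscale_def field_simps)+

lemma D_cross: "f \<in> nice \<Longrightarrow> xx.D i (yy.D j f) = yy.D j (xx.D i f)"
  unfolding xx.D_def yy.D_def by (rule dir_deriv_commute)

lemma D_cross_X: "f \<in> nice \<Longrightarrow> yy.D j (xx.X i * f) = xx.X i * yy.D j f"
  "f \<in> nice \<Longrightarrow> xx.D i (yy.X j * f) = yy.X j * xx.D i f"
  by (simp_all add: yy.D_mult xx.D_mult cross_X)

lemma D_cross_rho: "f \<in> nice \<Longrightarrow> yy.D j (xx.rho * f) = xx.rho * yy.D j f"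
  "f \<in> nice \<Longrightarrow> xx.D i (yy.rho * f) = yy.rho * xx.D i f"
  by (simp_all add: yy.D_mult xx.D_mult cross_X)

lemma rho_cross:
  assumes "f \<in> nice"
  shows "yy.Eul (xx.rho * f) = xx.rho * yy.Eul f" "xx.Eul (yy.rho * f) = yy.rho * xx.Eul f"
    "yy.Lap (xx.rho * f) = xx.rho * yy.Lap f" "xx.Lap (yy.rho * f) = yy.rho * xx.Lap f"
  using assms
  by (simp_all add: yy.Eul_def xx.Eul_def yy.Lap_def xx.Lap_def D_cross_rho sum_distrib_left mult.left_commute)

lemma yyD_ops:
  assumes f: "f \<in> nice"
  shows "yy.D j (xx.Eul f) = xx.Eul (yy.D j f)" "yy.D j (xx.Lap f) = xx.Lap (yy.D j f)"
    "yy.D j (xx.Rot i i' f) = xx.Rot i i' (yy.D j f)"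
  using f by (simp_all add: xx.Eul_def xx.Lap_def xx.Rot_def yy.D_sum yy.D_diff D_cross_X D_cross)

lemma xxD_ops:
  assumes f: "f \<in> nice"
  shows "xx.D j (yy.Eul f) = yy.Eul (xx.D j f)" "xx.D j (yy.Lap f) = yy.Lap (xx.D j f)"
    "xx.D j (yy.Rot i i' f) = yy.Rot i i' (xx.D j f)"
  using f by (simp_all add: yy.Eul_def yy.Lap_def yy.Rot_def xx.D_sum xx.D_diff D_cross_X D_cross[symmetric])

lemma ops_cross:
  assumes f: "f \<in> nice"
  shows "yy.Eul (xx.Lap f) = xx.Lap (yy.Eul f)" "xx.Eul (yy.Lap f) = yy.Lap (xx.Eul f)"
    "xx.Lap (yy.Lap f) = yy.Lap (xx.Lap f)" "xx.Eul (yy.Eul f) = yy.Eul (xx.Eul f)"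
proof -
  show "yy.Eul (xx.Lap f) = xx.Lap (yy.Eul f)"
    using f by (simp add: yy.Eul_def yyD_ops xx.Lap_sum) (simp add: xx.Lap_def D_cross_X sum_distrib_left)
  show "xx.Eul (yy.Lap f) = yy.Lap (xx.Eul f)"
    using f by (simp add: xx.Eul_def xxD_ops yy.Lap_sum) (simp add: yy.Lap_def D_cross_X sum_distrib_left)
  show "xx.Lap (yy.Lap f) = yy.Lap (xx.Lap f)"
    using f by (simp add: yy.Lap_def yyD_ops xx.Lap_sum)
  show "xx.Eul (yy.Eul f) = yy.Eul (xx.Eul f)"
    using f by (simp add: yy.Eul_def yyD_ops xx.Eul_sum)
      (simp add: xx.Eul_def D_cross_X sum_distrib_left mult.left_commute)
qed

lemma Rot_cross:
  assumes f: "f \<in> nice"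
  shows "xx.Rot i i' (yy.Lap f) = yy.Lap (xx.Rot i i' f)" "xx.Rot i i' (yy.Eul f) = yy.Eul (xx.Rot i i' f)"
    "yy.Rot j j' (xx.Lap f) = xx.Lap (yy.Rot j j' f)" "yy.Rot j j' (xx.Eul f) = xx.Eul (yy.Rot j j' f)"
    "xx.Rot i i' (yy.rho * f) = yy.rho * xx.Rot i i' f" "yy.Rot j j' (xx.rho * f) = xx.rho * yy.Rot j j' f"
proof -
  have X: "yy.Lap (xx.X i * g) = xx.X i * yy.Lap g" "yy.Eul (xx.X i * g) = xx.X i * yy.Eul g"
    "xx.Lap (yy.X j * g) = yy.X j * xx.Lap g" "xx.Eul (yy.X j * g) = yy.X j * xx.Eul g"
    if "g \<in> nice" for g i j
    using that by (simp_all add: yy.Lap_def yy.Eul_def xx.Lap_def xx.Eul_def D_cross_X sum_distrib_left mult.left_commute)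
  show "xx.Rot i i' (yy.Lap f) = yy.Lap (xx.Rot i i' f)" "xx.Rot i i' (yy.Eul f) = yy.Eul (xx.Rot i i' f)"
    using f by (simp_all add: xx.Rot_def yy.Lap_diff yy.Eul_diff X xxD_ops)
  show "yy.Rot j j' (xx.Lap f) = xx.Lap (yy.Rot j j' f)" "yy.Rot j j' (xx.Eul f) = xx.Eul (yy.Rot j j' f)"
    using f by (simp_all add: yy.Rot_def xx.Lap_diff xx.Eul_diff X yyD_ops)
  show "xx.Rot i i' (yy.rho * f) = yy.rho * xx.Rot i i' f" "yy.Rot j j' (xx.rho * f) = xx.rho * yy.Rot j j' f"
    using f by (simp_all add: xx.Rot_def yy.Rot_def D_cross_rho right_diff_distrib mult.left_commute)
qed

lemma Cas_cross:
  assumes f: "f \<in> nice"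
  shows "xx.Cas (yy.Lap f) = yy.Lap (xx.Cas f)" "yy.Cas (xx.Lap f) = xx.Lap (yy.Cas f)"
    "xx.Cas (yy.rho * f) = yy.rho * xx.Cas f" "yy.Cas (xx.rho * f) = xx.rho * yy.Cas f"
  using f by (simp_all add: xx.Cas_def yy.Cas_def Rot_cross yy.Lap_sum xx.Lap_sum sum_distrib_left)

text \<open>The Casimir operators are built from rotations, under which the squared radii and the
  Laplacians are invariant. So X^+ and X^- respect the angular types.\<close>

lemma Cas_sl2:
  assumes f: "f \<in> nice"
  shows "xx.Cas (sl2_Xp f) = sl2_Xp (xx.Cas f)" "xx.Cas (sl2_Xm f) = sl2_Xm (xx.Cas f)"
    "yy.Cas (sl2_Xp f) = sl2_Xp (yy.Cas f)" "yy.Cas (sl2_Xm f) = sl2_Xm (yy.Cas f)"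
proof -
  have 2: "2 * xx.rho * f = xx.rho * f + xx.rho * f" "2 * yy.rho * f = yy.rho * f + yy.rho * f"
    for f :: "('a, 'b) funs"
    by (simp_all add: algebra_simps)
  show "xx.Cas (sl2_Xp f) = sl2_Xp (xx.Cas f)" "xx.Cas (sl2_Xm f) = sl2_Xm (xx.Cas f)"
    "yy.Cas (sl2_Xp f) = sl2_Xp (yy.Cas f)" "yy.Cas (sl2_Xm f) = sl2_Xm (yy.Cas f)"
    unfolding sl2_eq 2 using f
    by (simp_all only: xx.Cas_cscale xx.Cas_add yy.Cas_cscale yy.Cas_add Cas_cross xx.Cas_Lap yy.Cas_Lap
        xx.Cas_rho yy.Cas_rho nice_add nice_mult xx.nice_rho yy.nice_rho xx.nice_Lap yy.nice_Lap xx.nice_Cas yy.nice_Cas)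
qed

lemma H_Xp:
  assumes f: "f \<in> nice"
  shows "sl2_H (sl2_Xp f) = sl2_Xp (sl2_H f) + cscale 2 (sl2_Xp f)"
    and "sl2_H (sl2_Xm f) = sl2_Xm (sl2_H f) - cscale 2 (sl2_Xm f)"
    and "sl2_Xp (sl2_Xm f) = sl2_Xm (sl2_Xp f) + sl2_H f"
proof -
  have 2: "2 * xx.rho * f = xx.rho * f + xx.rho * f" "2 * yy.rho * f = yy.rho * f + yy.rho * f"
    for f :: "('a, 'b) funs"
    by (simp_all add: algebra_simps)
  note ops = xx.Eul_add yy.Eul_add xx.Lap_add yy.Lap_add xx.Eul_diff yy.Eul_diff xx.Lap_diff yy.Lap_diff
    xx.Eul_cscale yy.Eul_cscale xx.Lap_cscale yy.Lap_cscale
    rho_cross ops_cross xx.Lap_Eul yy.Lap_Eul xx.Eul_mult[OF xx.nice_rho] yy.Eul_mult[OF yy.nice_rho]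
    xx.Eul_rho yy.Eul_rho xx.Lap_rho_mult yy.Lap_rho_mult
    nice_add nice_diff nice_mult nice_cscale xx.nice_rho yy.nice_rho xx.nice_Lap yy.nice_Lap xx.nice_Eul yy.nice_Eul f
  show "sl2_H (sl2_Xp f) = sl2_Xp (sl2_H f) + cscale 2 (sl2_Xp f)"
    unfolding sl2_eq 2 by (simp only: ops) (simp add: fun_eq_iff cscale_def field_simps)
  show "sl2_H (sl2_Xm f) = sl2_Xm (sl2_H f) - cscale 2 (sl2_Xm f)"
    unfolding sl2_eq 2 by (simp only: ops) (simp add: fun_eq_iff cscale_def field_simps)
  show "sl2_Xp (sl2_Xm f) = sl2_Xm (sl2_Xp f) + sl2_H f"
    unfolding sl2_eq 2 by (simp only: ops) (simp add: fun_eq_iff cscale_def field_simps)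
qed

lemma nice_Xm_power [simp, intro]: "f \<in> nice \<Longrightarrow> (sl2_Xm ^^ j) f \<in> nice"
  by (induction j) auto

lemma lin_on_Xm_power: "lin_on nice (sl2_Xm ^^ j :: ('p::finite, 'q::finite) funs \<Rightarrow> _)"
proof (induction j)
  case 0
  show ?case by (simp add: lin_on_def)
next
  case (Suc j)
  show "lin_on nice (sl2_Xm ^^ Suc j :: ('p, 'q) funs \<Rightarrow> _)"
  proof (rule lin_onI)
    fix f g :: "('p, 'q) funs" assume fg: "f \<in> nice" "g \<in> nice"
    show "(sl2_Xm ^^ Suc j) (f + g) = (sl2_Xm ^^ Suc j) f + (sl2_Xm ^^ Suc j) g"
      unfolding funpow.simps o_apply lin_onD(1)[OF Suc fg]
      by (rule lin_onD(1)[OF lin_on_sl2(3)]) (use fg in auto)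
  next
    fix f :: "('p, 'q) funs" and c assume f: "f \<in> nice"
    show "(sl2_Xm ^^ Suc j) (cscale c f) = cscale c ((sl2_Xm ^^ Suc j) f)"
      unfolding funpow.simps o_apply lin_onD(2)[OF Suc f]
      by (rule lin_onD(2)[OF lin_on_sl2(3)]) (use f in auto)
  qed
qed

text \<open>Induction with [X^+, X^-] = H. For \<mu> = m and j = m the factor is 0, so the first
  power of X^- beyond m yields again a vector killed by X^+.\<close>

lemma sl2_string:
  assumes f: "f \<in> nice" and H: "sl2_H f = cscale \<mu> f" and Xp: "sl2_Xp f = 0"
  shows "sl2_H ((sl2_Xm ^^ j) f) = cscale (\<mu> - 2 * of_nat j) ((sl2_Xm ^^ j) f)"
    and "sl2_Xp ((sl2_Xm ^^ Suc j) f) = cscale (of_nat (Suc j) * (\<mu> - of_nat j)) ((sl2_Xm ^^ j) f)"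
proof -
  have 1: "sl2_H ((sl2_Xm ^^ j) f) = cscale (\<mu> - 2 * of_nat j) ((sl2_Xm ^^ j) f)" for j
  proof (induction j)
    case (Suc j)
    have n: "(sl2_Xm ^^ j) f \<in> nice" using f by simp
    have "sl2_H ((sl2_Xm ^^ Suc j) f) = sl2_Xm (sl2_H ((sl2_Xm ^^ j) f)) - cscale 2 (sl2_Xm ((sl2_Xm ^^ j) f))"
      using H_Xp(2)[OF n] by simp
    also have "\<dots> = cscale (\<mu> - 2 * of_nat j) (sl2_Xm ((sl2_Xm ^^ j) f)) - cscale 2 (sl2_Xm ((sl2_Xm ^^ j) f))"
      unfolding Suc lin_onD(2)[OF lin_on_sl2(3) n] ..
    also have "\<dots> = cscale (\<mu> - 2 * of_nat (Suc j)) ((sl2_Xm ^^ Suc j) f)"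
      by (simp add: fun_eq_iff cscale_def algebra_simps)
    finally show ?case .
  qed (simp add: H)
  then show "sl2_H ((sl2_Xm ^^ j) f) = cscale (\<mu> - 2 * of_nat j) ((sl2_Xm ^^ j) f)" .
  show "sl2_Xp ((sl2_Xm ^^ Suc j) f) = cscale (of_nat (Suc j) * (\<mu> - of_nat j)) ((sl2_Xm ^^ j) f)"
  proof (induction j)
    case 0
    have "sl2_Xp (sl2_Xm f) = sl2_Xm 0 + cscale \<mu> f" using H_Xp(3)[OF f] H Xp by simp
    also have "sl2_Xm 0 = (0 :: ('a, 'b) funs)" by (rule lin_on_0[OF lin_on_sl2(3) nice_subspace])
    finally show ?case by simp
  next
    case (Suc j)
    have n: "(sl2_Xm ^^ Suc j) f \<in> nice" "(sl2_Xm ^^ j) f \<in> nice" using f by blast+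
    have "sl2_Xp ((sl2_Xm ^^ Suc (Suc j)) f)
        = sl2_Xm (sl2_Xp ((sl2_Xm ^^ Suc j) f)) + sl2_H ((sl2_Xm ^^ Suc j) f)"
      using H_Xp(3)[OF n(1)] by simp
    also have "\<dots> = cscale (of_nat (Suc j) * (\<mu> - of_nat j)) ((sl2_Xm ^^ Suc j) f)
        + cscale (\<mu> - 2 * of_nat (Suc j)) ((sl2_Xm ^^ Suc j) f)"
      unfolding Suc 1 lin_onD(2)[OF lin_on_sl2(3) n(2)] by simp
    also have "\<dots> = cscale (of_nat (Suc (Suc j)) * (\<mu> - of_nat (Suc j))) ((sl2_Xm ^^ Suc j) f)"
      unfolding cfun.scale_left_distrib[symmetric] by (rule arg_cong2[where f = cscale]) (simp_all add: algebra_simps)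
    finally show ?case .
  qed
qed

text \<open>This is \<open>M_plus\<close>: the powers \<open>(X\<^sup>-)\<^sup>j f\<close> with \<open>j \<le> m\<close> cannot vanish, as \<open>X\<^sup>+ (X\<^sup>-)\<^sup>j\<^sup>+\<^sup>1 f = (j + 1)(m - j) (X\<^sup>-)\<^sup>j f\<close>.\<close>

definition hw_space :: "nat \<Rightarrow> ('p::finite, 'q::finite) funs set" where
  "hw_space m = {f \<in> space_E. sl2_H f = cscale (of_nat m) f \<and> sl2_Xp f = 0 \<and> (sl2_Xm ^^ Suc m) f = 0}"

section \<open>Products of harmonic polynomials and radial functions\<close>

lemma psi_ev: "psi \<alpha> = ev (PsiF \<alpha>)"
  by (simp add: fun_eq_iff psi_def ev_def Psi_eq defs_xy)

text \<open>Spanning functions of \<open>space_E\<close> with \<open>PsiF \<alpha>\<close> replaced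
  by an arbitrary series: the operators change the series but preserve this shape.\<close>

definition kterm :: "(real^'p::finite \<Rightarrow> complex) \<Rightarrow> (real^'q::finite \<Rightarrow> complex) \<Rightarrow> nat \<Rightarrow> nat \<Rightarrow> complex fps \<Rightarrow>
    ('p, 'q) funs" where
  "kterm h1 h2 a b g = lx h1 * ly h2 * rad a b g"

lemma space_E_eq: "space_E = cfun.span {kterm h1 h2 a b (PsiF \<alpha>) | h1 h2 k l a b \<alpha>.
    h1 \<in> harmonic_polys k \<and> h2 \<in> harmonic_polys l \<and> \<alpha> \<notin> \<int>\<^sub>\<le>\<^sub>0}"
proof -
  have *: "(\<lambda>z. h1 (fst z) * h2 (snd z) * rho_x z ^ a * rho_y z ^ b * psi \<alpha> z) = kterm h1 h2 a b (PsiF \<alpha>)"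
    for h1 :: "real^'p::finite \<Rightarrow> complex" and h2 :: "real^'q::finite \<Rightarrow> complex" and a b \<alpha>
    by (simp add: fun_eq_iff psi_ev kterm_def rad_def lx_def ly_def defs_xy power_fun_apply)
  show ?thesis unfolding space_E_def *[symmetric] ..
qed

lemma nice_kterm: "h1 \<in> harmonic_polys k \<Longrightarrow> h2 \<in> harmonic_polys l \<Longrightarrow> entire g \<Longrightarrow> kterm h1 h2 a b g \<in> nice"
  unfolding kterm_def using nice_harm[of h1 k] nice_harm[of h2 l] by (intro nice_mult nice_lx nice_ly nice_rad) auto

lemma space_E_nice: "space_E \<subseteq> nice"
  unfolding space_E_eq by (rule cfun.span_minimal[OF _ nice_subspace]) (auto intro: nice_kterm entire_PsiF)

lemma kterm_add: "entire f \<Longrightarrow> entire g \<Longrightarrow> kterm h1 h2 a b (f + g) = kterm h1 h2 a b f + kterm h1 h2 a b g"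
  and kterm_cmult: "entire f \<Longrightarrow> kterm h1 h2 a b (fps_const c * f) = cscale c (kterm h1 h2 a b f)"
  and kterm_0: "kterm h1 h2 a b 0 = 0"
  by (simp_all add: kterm_def rad_add rad_cmult rad_0 distrib_left mult_cscale)

lemma M_plus_eq: "M_plus m = hw_space m"
proof (intro set_eqI iffI)
  fix f :: "('a, 'b) funs" assume f: "f \<in> M_plus m"
  show "f \<in> hw_space m"
  proof (cases "f = 0")
    case True
    have "sl2_H 0 = (0 :: ('a, 'b) funs)" "sl2_Xp 0 = (0 :: ('a, 'b) funs)" "(sl2_Xm ^^ Suc m) 0 = (0 :: ('a, 'b) funs)"
      using lin_on_0[OF _ nice_subspace] lin_on_sl2 lin_on_Xm_power by blast+
    then show ?thesis unfolding True hw_space_def space_E_def by (simp add: cfun.span_zero del: funpow.simps)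
  next
    case False
    then show ?thesis using f by (simp add: M_plus_def hw_space_def del: funpow.simps)
  qed
next
  fix f :: "('a, 'b) funs" assume f: "f \<in> hw_space m"
  then have fn: "f \<in> nice" using space_E_nice by (auto simp: hw_space_def)
  have H: "sl2_H f = cscale (of_nat m) f" and Xp: "sl2_Xp f = 0" using f by (auto simp: hw_space_def)
  have nz: "(sl2_Xm ^^ j) f \<noteq> 0" if "f \<noteq> 0" "j \<le> m" for j
    using that(2)
  proof (induction j)
    case (Suc j)
    have "(sl2_Xm ^^ j) f \<noteq> 0" by (rule Suc.IH) (use Suc.prems in simp)
    moreover have "of_nat (Suc j) * (of_nat m - of_nat j) \<noteq> (0::complex)"
      using Suc.prems by (simp del: of_nat_Suc)
    ultimately have "sl2_Xp ((sl2_Xm ^^ Suc j) f) \<noteq> 0"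
      unfolding sl2_string(2)[OF fn H Xp] by (simp del: of_nat_Suc)
    then show ?case using lin_on_0[OF lin_on_sl2(2) nice_subspace] by metis
  qed (use that in simp)
  show "f \<in> M_plus m"
    using f nz by (cases "f = 0") (simp_all add: M_plus_def hw_space_def del: funpow.simps)
qed

lemma hw_space_subspace: "cfun.subspace (hw_space m)"
proof (rule cfun.subspaceI)
  have E: "cfun.subspace space_E" unfolding space_E_def by (rule cfun.subspace_span)
  note l = lin_onD[OF lin_on_sl2(1)] lin_onD[OF lin_on_sl2(2)] lin_onD[OF lin_on_Xm_power]
  show "0 \<in> hw_space m"
    using lin_on_0[OF lin_on_sl2(1) nice_subspace] lin_on_0[OF lin_on_sl2(2) nice_subspace]
      lin_on_0[OF lin_on_Xm_power nice_subspace, of "Suc m"] cfun.subspace_0[OF E]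
    by (simp add: hw_space_def del: funpow.simps)
  fix x y :: "('a, 'b) funs" and c
  assume x: "x \<in> hw_space m"
  then have xn: "x \<in> nice" using space_E_nice by (auto simp: hw_space_def)
  show "cscale c x \<in> hw_space m"
    using x xn by (simp add: hw_space_def l cfun.subspace_scale[OF E] mult.commute del: funpow.simps)
  assume y: "y \<in> hw_space m"
  then have yn: "y \<in> nice" using space_E_nice by (auto simp: hw_space_def)
  show "x + y \<in> hw_space m"
    using x xn y yn by (simp add: hw_space_def l cfun.subspace_add[OF E] cscale_add_right del: funpow.simps)
qed

definition cas_val :: "'n::finite itself \<Rightarrow> nat \<Rightarrow> complex" where
  "cas_val _ k = - 2 * (of_nat k * (of_nat k + of_nat CARD('n) - 2))"

text \<open>The Bessel operator induced by \<open>X\<^sup>+\<close> on the radial factor; \<open>PsiF c\<close> spans its kernel for \<open>a = 0\<close>.\<close>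

definition Lop :: "nat \<Rightarrow> complex \<Rightarrow> complex fps \<Rightarrow> complex fps" where
  "Lop a c g = theta a (theta a g + fps_const (c - 1) * g) + fps_X * g"

lemma entire_Lop: "entire g \<Longrightarrow> entire (Lop a c g)"
  by (simp add: Lop_def)

lemma Lop_nth:
  "fps_nth (Lop a c g) n = (of_nat a + of_nat n) * (of_nat a + of_nat n + c - 1) * fps_nth g n
    + (if n = 0 then 0 else fps_nth g (n - 1))"
  by (cases n) (simp_all add: Lop_def algebra_simps)

lemma kterm_ops:
  fixes h1 :: "real^'p::finite \<Rightarrow> complex" and h2 :: "real^'q::finite \<Rightarrow> complex"
  assumes h: "h1 \<in> harmonic_polys k" "h2 \<in> harmonic_polys l" and g: "entire g"
  shows "xx.Eul (kterm h1 h2 a b g) = kterm h1 h2 a b (fps_const (of_nat k) * g + fps_const 2 * theta a g)"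
    and "yy.Eul (kterm h1 h2 a b g) = kterm h1 h2 a b (fps_const (of_nat l) * g + fps_const 2 * theta b g)"
    and "xx.Cas (kterm h1 h2 a b g) = cscale (cas_val TYPE('p) k) (kterm h1 h2 a b g)"
    and "yy.Cas (kterm h1 h2 a b g) = cscale (cas_val TYPE('q) l) (kterm h1 h2 a b g)"
proof -
  have n: "h1 \<in> nice" "h2 \<in> nice" "lx h1 * ly h2 \<in> nice" "rad a b g \<in> nice"
    using nice_harm[OF h(1)] nice_harm[OF h(2)] g by auto
  have E: "pl.Eul h1 = cst (of_nat k) * h1" "pl.Eul h2 = cst (of_nat l) * h2"
    using hp_Eul harm_hp h by blast+
  show "xx.Eul (kterm h1 h2 a b g) = kterm h1 h2 a b (fps_const (of_nat k) * g + fps_const 2 * theta a g)"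
    unfolding kterm_def using n g
    by (simp add: xx.Eul_mult Eul_l E l_hom rad_add rad_cmult Eul_rad)
      (simp add: fun_eq_iff cscale_def algebra_simps)
  show "yy.Eul (kterm h1 h2 a b g) = kterm h1 h2 a b (fps_const (of_nat l) * g + fps_const 2 * theta b g)"
    unfolding kterm_def using n g
    by (simp add: yy.Eul_mult Eul_l E l_hom rad_add rad_cmult Eul_rad)
      (simp add: fun_eq_iff cscale_def algebra_simps)
  \<comment> \<open>Everything except \<open>lx h1\<close> is invariant under rotations of x, so the
    Casimir operator acts on \<open>h1\<close> alone; likewise for y below.\<close>
  have c1: "xx.Rot i j (ly h2 * rad a b g) = 0" for i j
    using n g by (simp add: xx.Rot_mult Rot_l Rot_rad)
  have c2: "yy.Rot i j (lx h1 * rad a b g) = 0" for i j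
    using n g by (simp add: yy.Rot_mult Rot_l Rot_rad)
  have "xx.Cas ((ly h2 * rad a b g) * lx h1) = (ly h2 * rad a b g) * lx (pl.Cas h1)"
    using n by (subst xx.Cas_mult_radial) (auto simp: c1 Cas_l)
  then show "xx.Cas (kterm h1 h2 a b g) = cscale (cas_val TYPE('p) k) (kterm h1 h2 a b g)"
    unfolding harm_Cas[OF h(1)] kterm_def cas_val_def l_hom mult_cscale by (simp only: mult_ac)
  have "yy.Cas ((lx h1 * rad a b g) * ly h2) = (lx h1 * rad a b g) * ly (pl.Cas h2)"
    using n by (subst yy.Cas_mult_radial) (auto simp: c2 Cas_l)
  then show "yy.Cas (kterm h1 h2 a b g) = cscale (cas_val TYPE('q) l) (kterm h1 h2 a b g)"
    unfolding harm_Cas[OF h(2)] kterm_def cas_val_def l_hom mult_cscale by (simp only: mult_ac)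
qed

text \<open>The eigenvalue of \<open>H\<close>.\<close>

definition wt :: "'p::finite itself \<Rightarrow> 'q::finite itself \<Rightarrow> nat \<Rightarrow> nat \<Rightarrow> nat \<Rightarrow> nat \<Rightarrow> complex" where
  "wt _ _ k l a b = 2 * of_nat b - 2 * of_nat a + kappa TYPE('q) l - kappa TYPE('p) k"

lemma kterm_H:
  fixes h1 :: "real^'p::finite \<Rightarrow> complex" and h2 :: "real^'q::finite \<Rightarrow> complex"
  assumes h: "h1 \<in> harmonic_polys k" "h2 \<in> harmonic_polys l" and g: "entire g"
  shows "sl2_H (kterm h1 h2 a b g) = cscale (wt TYPE('p) TYPE('q) k l a b) (kterm h1 h2 a b g)"
  unfolding sl2_eq kterm_ops[OF h g]
proof -
  have *: "cscale (of_nat CARD('q) / 2 - of_nat CARD('p) / 2) T + (cscale (of_nat l) T + cscale 2 (cscale (of_nat b) T + U))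
      - (cscale (of_nat k) T + cscale 2 (cscale (of_nat a) T + U)) = cscale (wt TYPE('p) TYPE('q) k l a b) T"
    for T U :: "('p, 'q) funs"
    by (simp add: fun_eq_iff cscale_def wt_def kappa_def field_simps)
  show "cscale (of_nat CARD('q) / 2 - of_nat CARD('p) / 2) (kterm h1 h2 a b g)
      + kterm h1 h2 a b (fps_const (of_nat l) * g + fps_const 2 * theta b g)
      - kterm h1 h2 a b (fps_const (of_nat k) * g + fps_const 2 * theta a g)
      = cscale (wt TYPE('p) TYPE('q) k l a b) (kterm h1 h2 a b g)"
    unfolding *[symmetric, of _ "kterm h1 h2 a b (fps_X * fps_deriv g)"]
    using g by (simp add: theta_def kterm_add kterm_cmult)
qed

text \<open>After multiplication by \<open>rho_x\<close> the Laplacian is given by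
  \<open>Cas_eq\<close> through Euler and Casimir operators, which act on the series alone and
  uniformly in \<open>a\<close>. The extra factor is harmless where only the vanishing of X^+ f
  matters.\<close>

lemma kterm_rho_Xp:
  fixes h1 :: "real^'p::finite \<Rightarrow> complex" and h2 :: "real^'q::finite \<Rightarrow> complex"
  assumes h: "h1 \<in> harmonic_polys k" "h2 \<in> harmonic_polys l" and g: "entire g"
  shows "xx.rho * sl2_Xp (kterm h1 h2 a b g) = cscale (- 1) (kterm h1 h2 a b (Lop a (kappa TYPE('p) k) g))"
proof -
  let ?t = "kterm h1 h2 a b"
  have n: "?t g \<in> nice" using nice_kterm[OF h g] .
  let ?E = "\<lambda>g. fps_const (of_nat k) * g + fps_const 2 * theta a g"
  have 4: "xx.rho * xx.Lap (?t g) = cscale (1/4) (xx.Cas (?t g))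
      + cscale (1/2) (xx.Eul (xx.Eul (?t g))) + cscale ((of_nat CARD('p) - 2) / 2) (xx.Eul (?t g))"
    unfolding xx.Cas_eq[OF n] by (simp add: fun_eq_iff cscale_def field_simps)
  have "xx.rho * xx.Lap (?t g) = ?t (fps_const (1/4) * (fps_const (cas_val TYPE('p) k) * g) + fps_const (1/2) * ?E (?E g)
      + fps_const ((of_nat CARD('p) - 2) / 2) * ?E g)"
    unfolding 4 using g h by (simp add: kterm_ops kterm_cmult[symmetric] kterm_add[symmetric] del: fps_const_mult)
  also have "fps_const (1/4) * (fps_const (cas_val TYPE('p) k) * g) + fps_const (1/2) * ?E (?E g)
      + fps_const ((of_nat CARD('p) - 2) / 2) * ?E g
      = fps_const 2 * theta a (theta a g + fps_const (kappa TYPE('p) k - 1) * g)"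
    by (rule fps_ext) (simp add: cas_val_def kappa_def field_simps)
  also have "?t \<dots> = cscale 2 (?t (theta a (theta a g + fps_const (kappa TYPE('p) k - 1) * g)))"
    using g by (simp add: kterm_cmult)
  finally have L: "xx.rho * xx.Lap (?t g) = cscale 2 (?t (theta a (theta a g + fps_const (kappa TYPE('p) k - 1) * g)))" .
  have "xx.rho * yy.rho * ?t g = ?t (fps_X * g)"
    using g by (simp add: kterm_def rad_X_mult rho_rad[symmetric] mult_ac)
  then have "xx.rho * sl2_Xp (?t g) = cscale (- (1/2)) (cscale 2 (?t (theta a (theta a g + fps_const (kappa TYPE('p) k - 1) * g)))
     + cscale 2 (?t (fps_X * g)))"
    unfolding sl2_eq L[symmetric] by (simp add: fun_eq_iff cscale_def algebra_simps)
  also have "\<dots> = cscale (- 1) (?t (Lop a (kappa TYPE('p) k) g))"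
    unfolding Lop_def using g by (simp add: kterm_add) (simp add: fun_eq_iff cscale_def algebra_simps)
  finally show ?thesis .
qed

context coords
begin

text \<open>Since the gradient of \<open>F\<close> is x times \<open>F1\<close>, the mixed term of
  the product rule is twice E(h) \<open>F1\<close>, and the Laplacian of \<open>F\<close> is n
  \<open>F1\<close> + E(\<open>F1\<close>).\<close>

lemma Lap_mult_radial:
  assumes n: "h \<in> nice" "F \<in> nice" "F1 \<in> nice" and F: "\<And>i. D i F = X i * F1"
    and h: "Lap h = 0" "Eul h = cst c * h"
  shows "Lap (h * F) = h * (cst (2 * c + of_nat CARD('n)) * F1 + Eul F1)"
proof -
  have LF: "Lap F = cst (of_nat CARD('n)) * F1 + Eul F1"
  proof -
    have "Lap F = (\<Sum>i\<in>UNIV. F1 + X i * D i F1)"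
      unfolding Lap_def F using n by (intro sum.cong refl) (simp add: D_mult D_X delta_mult)
    also have "\<dots> = cst (of_nat CARD('n)) * F1 + Eul F1"
      by (simp add: sum.distrib Eul_def) (simp add: fun_eq_iff)
    finally show ?thesis .
  qed
  have "(\<Sum>i\<in>UNIV. D i h * D i F) = Eul h * F1"
    unfolding F Eul_def by (simp add: sum_distrib_left sum_distrib_right mult_ac)
  then show ?thesis
    using n by (simp add: Lap_mult LF h) (simp add: fun_eq_iff algebra_simps)
qed

end

lemma kterm_Lap:
  fixes h1 :: "real^'p::finite \<Rightarrow> complex" and h2 :: "real^'q::finite \<Rightarrow> complex"
  assumes h: "h1 \<in> harmonic_polys k" "h2 \<in> harmonic_polys l" and g: "entire g"
  shows "xx.Lap (kterm h1 h2 0 b g) = cscale 2 (kterm h1 h2 0 (Suc b) (fps_const (kappa TYPE('p) k) * fps_deriv g + theta 0 (fps_deriv g)))"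
    and "yy.Lap (kterm h1 h2 a 0 g) = cscale 2 (kterm h1 h2 (Suc a) 0 (fps_const (kappa TYPE('q) l) * fps_deriv g + theta 0 (fps_deriv g)))"
    and "yy.Lap (kterm h1 h2 a (Suc b) g) = cscale 2 (kterm h1 h2 a b (fps_const (kappa TYPE('q) l) * theta (Suc b) g + theta b (theta (Suc b) g)))"
proof -
  have n: "h1 \<in> nice" "h2 \<in> nice" "lx h1 \<in> nice" "ly h2 \<in> nice" "lx h1 * ly h2 \<in> nice"
    using nice_harm[OF h(1)] nice_harm[OF h(2)] by auto
  have E: "pl.Eul h1 = cst (of_nat k) * h1" "pl.Eul h2 = cst (of_nat l) * h2"
    using hp_Eul harm_hp h by blast+
  have x: "xx.Lap (lx h1 * ly h2) = 0" "xx.Eul (lx h1 * ly h2) = cst (of_nat k) * (lx h1 * ly h2)"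
    using n harm_Lap[OF h(1)] by (simp_all add: xx.Lap_mult xx.Eul_mult Lap_l Eul_l E l_hom D_ly xx.Lap_def[of "ly h2"] xx.D_0 mult_ac)
  have y: "yy.Lap (lx h1 * ly h2) = 0" "yy.Eul (lx h1 * ly h2) = cst (of_nat l) * (lx h1 * ly h2)"
    using n harm_Lap[OF h(2)] by (simp_all add: yy.Lap_mult yy.Eul_mult Lap_l Eul_l E l_hom D_lx yy.Lap_def[of "lx h1"] yy.D_0 mult_ac)
  show "xx.Lap (kterm h1 h2 0 b g) = cscale 2 (kterm h1 h2 0 (Suc b) (fps_const (kappa TYPE('p) k) * fps_deriv g + theta 0 (fps_deriv g)))"
    unfolding kterm_def xx.Lap_mult_radial[OF n(5) nice_rad[OF g] nice_rad[OF entire_deriv[OF g]] D_rad(1)[OF g] x]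
    using g by (simp add: Eul_rad rad_add rad_cmult) (simp add: fun_eq_iff cscale_def kappa_def algebra_simps)
  show "yy.Lap (kterm h1 h2 a 0 g) = cscale 2 (kterm h1 h2 (Suc a) 0 (fps_const (kappa TYPE('q) l) * fps_deriv g + theta 0 (fps_deriv g)))"
    unfolding kterm_def yy.Lap_mult_radial[OF n(5) nice_rad[OF g] nice_rad[OF entire_deriv[OF g]] D_rad(3)[OF g] y]
    using g by (simp add: Eul_rad rad_add rad_cmult) (simp add: fun_eq_iff cscale_def kappa_def algebra_simps)
  show "yy.Lap (kterm h1 h2 a (Suc b) g) = cscale 2 (kterm h1 h2 a b (fps_const (kappa TYPE('q) l) * theta (Suc b) g + theta b (theta (Suc b) g)))"
    unfolding kterm_def yy.Lap_mult_radial[OF n(5) nice_rad[OF g] nice_rad[OF entire_theta[OF g]] D_rad(4)[OF g] y]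
    using g by (simp add: Eul_rad rad_add rad_cmult) (simp add: fun_eq_iff cscale_def kappa_def algebra_simps)
qed

lemma kterm_rho: "xx.rho * kterm h1 h2 a b g = kterm h1 h2 (Suc a) b g" "yy.rho * kterm h1 h2 a b g = kterm h1 h2 a (Suc b) g"
  by (simp_all add: kterm_def rho_rad[symmetric] mult_ac)

lemma kterm_X_mult: "entire g \<Longrightarrow> kterm h1 h2 a b (fps_X * g) = kterm h1 h2 (Suc a) (Suc b) g"
  by (simp add: kterm_def rad_X_mult)

lemma kappa_nonpos: "kappa TYPE('n::finite) k \<notin> \<int>\<^sub>\<le>\<^sub>0"
proof
  assume "kappa TYPE('n) k \<in> \<int>\<^sub>\<le>\<^sub>0"
  then obtain a where "kappa TYPE('n) k = - of_nat a" by (auto elim!: nonpos_Ints_cases')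
  then show False using kappa_nz[of k a, where 'n = 'n] by simp
qed

lemma entire_Psi_kappa [simp]: "entire (PsiF (kappa TYPE('n::finite) k))"
  by (rule entire_PsiF[OF kappa_nonpos])

text \<open>The Laplacian in x contributes \<kappa> g' + w g'' and the factor \<open>rho_y\<close>
  contributes g: together the left side of \<open>PsiF_ode\<close> for \<alpha> = \<kappa>.\<close>

lemma kterm_Psi_Xp:
  fixes h1 :: "real^'p::finite \<Rightarrow> complex" and h2 :: "real^'q::finite \<Rightarrow> complex"
  assumes h: "h1 \<in> harmonic_polys k" "h2 \<in> harmonic_polys l"
  shows "sl2_Xp (kterm h1 h2 0 b (PsiF (kappa TYPE('p) k))) = 0"
proof -
  let ?g = "PsiF (kappa TYPE('p) k)"
  have "sl2_Xp (kterm h1 h2 0 b ?g) = cscale (- 1) (kterm h1 h2 0 (Suc b)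
      (fps_const (kappa TYPE('p) k) * fps_deriv ?g + theta 0 (fps_deriv ?g)) + kterm h1 h2 0 (Suc b) ?g)"
    unfolding sl2_eq kterm_Lap[OF h entire_Psi_kappa] mult.assoc kterm_rho
    by (simp add: fun_eq_iff cscale_def algebra_simps)
  also have "kterm h1 h2 0 (Suc b) (fps_const (kappa TYPE('p) k) * fps_deriv ?g + theta 0 (fps_deriv ?g)) + kterm h1 h2 0 (Suc b) ?g
      = kterm h1 h2 0 (Suc b) (fps_const (kappa TYPE('p) k) * fps_deriv ?g + fps_X * fps_deriv (fps_deriv ?g) + ?g)"
    by (simp add: kterm_add[symmetric] theta_0)
  also have "cscale (- 1) \<dots> = 0" unfolding PsiF_ode[OF kappa_nonpos] kterm_0 by simp
  finally show ?thesis .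
qed

text \<open>X^- lowers \<open>b\<close> as long as it is positive and afterwards raises
  \<open>a\<close>; its powers are followed along this path.\<close>

lemma kterm_Xm:
  fixes h1 :: "real^'p::finite \<Rightarrow> complex" and h2 :: "real^'q::finite \<Rightarrow> complex"
  assumes h: "h1 \<in> harmonic_polys k" "h2 \<in> harmonic_polys l" and g: "entire g"
  shows "sl2_Xm (kterm h1 h2 a 0 g) = kterm h1 h2 (Suc a) 0 (g + (fps_const (kappa TYPE('q) l) * fps_deriv g + theta 0 (fps_deriv g)))"
    and "sl2_Xm (kterm h1 h2 a (Suc b) g) = kterm h1 h2 a b (fps_X * g
      + (fps_const (kappa TYPE('q) l) * theta (Suc b) g + theta b (theta (Suc b) g)))"
proof -
  show "sl2_Xm (kterm h1 h2 a 0 g) = kterm h1 h2 (Suc a) 0 (g + (fps_const (kappa TYPE('q) l) * fps_deriv g + theta 0 (fps_deriv g)))"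
    unfolding sl2_eq mult.assoc kterm_rho kterm_Lap[OF h g] using g
    by (subst kterm_add) (auto simp: fun_eq_iff cscale_def algebra_simps)
  show "sl2_Xm (kterm h1 h2 a (Suc b) g) = kterm h1 h2 a b (fps_X * g
      + (fps_const (kappa TYPE('q) l) * theta (Suc b) g + theta b (theta (Suc b) g)))"
    unfolding sl2_eq mult.assoc kterm_rho kterm_Lap[OF h g] using g
    by (subst kterm_add) (auto simp: kterm_X_mult fun_eq_iff cscale_def algebra_simps)
qed

text \<open>The radii make \<open>rho_y\<close> = 1 and \<open>rho_x\<close> = t, so the argument w
  of the series is t.\<close>

lemma kterm_sphere:
  assumes t: "t > 0" and z: "norm (fst z) = sqrt (2 * t)" "norm (snd z) = sqrt 2"
  shows "kterm h1 h2 a b g z = h1 (fst z) * h2 (snd z) * (complex_of_real t ^ a * eval_fps g (complex_of_real t))"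
proof -
  have "xx.rho z = complex_of_real t" "yy.rho z = 1" unfolding rho_real z using t by simp_all
  then show ?thesis by (simp add: kterm_def lx_def ly_def rad_def ev_def power_fun_apply)
qed

text \<open>For each t, independence on a sphere in x and then on a sphere in y isolates the value
  of the series at t; an entire series vanishing on the positive reals is 0.\<close>

lemma kterm_independent:
  fixes B1 :: "(real^'p::finite \<Rightarrow> complex) set" and B2 :: "(real^'q::finite \<Rightarrow> complex) set"
  assumes B1: "finite B1" "cfun.independent B1" "B1 \<subseteq> homogeneous_polys k"
    and B2: "finite B2" "cfun.independent B2" "B2 \<subseteq> homogeneous_polys l"
    and G: "entire (G h1 h2)"
    and z: "(\<Sum>h1\<in>B1. \<Sum>h2\<in>B2. kterm h1 h2 a b (G h1 h2)) = 0" and h: "h1 \<in> B1" "h2 \<in> B2"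
  shows "G h1 h2 = 0"
proof (rule eval_entire_0_imp_0[OF G])
  fix t :: real assume t: "t > 0"
  define c where "c h1 h2 = complex_of_real t ^ a * eval_fps (G h1 h2) (complex_of_real t)" for h1 h2
  have s: "(\<Sum>h1\<in>B1. (\<Sum>h2\<in>B2. c h1 h2 * h2 y) * h1 x) = 0"
    if "norm x = sqrt (2 * t)" "norm y = sqrt 2" for x y
  proof -
    have "(\<Sum>h1\<in>B1. (\<Sum>h2\<in>B2. c h1 h2 * h2 y) * h1 x) = (\<Sum>h1\<in>B1. \<Sum>h2\<in>B2. kterm h1 h2 a b (G h1 h2) (x, y))"
      using that by (simp add: kterm_sphere[OF t] c_def sum_distrib_left sum_distrib_right mult_ac)
    also have "\<dots> = (\<Sum>h1\<in>B1. \<Sum>h2\<in>B2. kterm h1 h2 a b (G h1 h2)) (x, y)" by simp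
    also have "\<dots> = 0" unfolding z by simp
    finally show ?thesis .
  qed
  have s2: "(\<Sum>h2\<in>B2. c h1 h2 * h2 y) = 0" if "norm y = sqrt 2" for y
    by (rule hp_sphere_independent[OF B1, of "sqrt (2 * t)" "\<lambda>h1. \<Sum>h2\<in>B2. c h1 h2 * h2 y"])
      (use t s that h in auto)
  have "c h1 h2 = 0"
    by (rule hp_sphere_independent[OF B2, of "sqrt 2" "c h1"]) (use s2 h in auto)
  then show "eval_fps (G h1 h2) (complex_of_real t) = 0" using t by (simp add: c_def)
qed

section \<open>Decomposition into joint eigenspaces\<close>

text \<open>One basis is fixed per degree, so that decompositions and dimension counts use the same
  index sets.\<close>

definition hbasis :: "nat \<Rightarrow> (real^'n::finite \<Rightarrow> complex) set" where
  "hbasis k = (SOME B. finite B \<and> cfun.independent B \<and> cfun.span B = harmonic_polys k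
    \<and> card B = cfun.dim (harmonic_polys k :: (real^'n \<Rightarrow> complex) set) \<and> B \<subseteq> harmonic_polys k)"

lemma hbasis:
  "finite (hbasis k :: (real^'n::finite \<Rightarrow> complex) set)"
  "cfun.independent (hbasis k :: (real^'n::finite \<Rightarrow> complex) set)"
  "cfun.span (hbasis k) = (harmonic_polys k :: (real^'n::finite \<Rightarrow> complex) set)"
  "card (hbasis k :: (real^'n::finite \<Rightarrow> complex) set) = cfun.dim (harmonic_polys k :: (real^'n \<Rightarrow> complex) set)"
  "hbasis k \<subseteq> (harmonic_polys k :: (real^'n::finite \<Rightarrow> complex) set)"
proof -
  obtain B :: "(real^'n \<Rightarrow> complex) set" where "finite B" "cfun.independent B" "cfun.span B = harmonic_polys k"
    "card B = cfun.dim (harmonic_polys k :: (real^'n \<Rightarrow> complex) set)" "B \<subseteq> harmonic_polys k"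
    by (rule harm_basis)
  then have "\<exists>B :: (real^'n \<Rightarrow> complex) set. finite B \<and> cfun.independent B \<and> cfun.span B = harmonic_polys k
    \<and> card B = cfun.dim (harmonic_polys k :: (real^'n \<Rightarrow> complex) set) \<and> B \<subseteq> harmonic_polys k"
    by (intro exI[of _ B] conjI)
  from someI_ex[OF this]
  have *: "finite (hbasis k :: (real^'n \<Rightarrow> complex) set) \<and> cfun.independent (hbasis k :: (real^'n \<Rightarrow> complex) set)
    \<and> cfun.span (hbasis k) = (harmonic_polys k :: (real^'n \<Rightarrow> complex) set)
    \<and> card (hbasis k :: (real^'n \<Rightarrow> complex) set) = cfun.dim (harmonic_polys k :: (real^'n \<Rightarrow> complex) set)
    \<and> hbasis k \<subseteq> (harmonic_polys k :: (real^'n \<Rightarrow> complex) set)"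
    unfolding hbasis_def .
  note 1 = conjunct2[OF *] note 2 = conjunct2[OF 1] note 3 = conjunct2[OF 2]
  show "finite (hbasis k :: (real^'n \<Rightarrow> complex) set)" by (rule conjunct1[OF *])
  show "cfun.independent (hbasis k :: (real^'n \<Rightarrow> complex) set)" by (rule conjunct1[OF 1])
  show "cfun.span (hbasis k) = (harmonic_polys k :: (real^'n \<Rightarrow> complex) set)" by (rule conjunct1[OF 2])
  show "card (hbasis k :: (real^'n \<Rightarrow> complex) set) = cfun.dim (harmonic_polys k :: (real^'n \<Rightarrow> complex) set)"
    by (rule conjunct1[OF 3])
  show "hbasis k \<subseteq> (harmonic_polys k :: (real^'n \<Rightarrow> complex) set)" by (rule conjunct2[OF 3])
qed

lemma hbasis_hp: "hbasis k \<subseteq> homogeneous_polys k"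
  using hbasis(5) harm_hp by blast

lemma hbasis_harm: "h \<in> hbasis k \<Longrightarrow> h \<in> harmonic_polys k"
  using hbasis(5) by blast

definition block_sum :: "nat \<Rightarrow> nat \<Rightarrow> nat \<Rightarrow> nat \<Rightarrow> ((real^'p::finite \<Rightarrow> complex) \<Rightarrow> (real^'q::finite \<Rightarrow> complex) \<Rightarrow> complex fps)
    \<Rightarrow> ('p, 'q) funs" where
  "block_sum k l a b G = (\<Sum>h1\<in>hbasis k. \<Sum>h2\<in>hbasis l. kterm h1 h2 a b (G h1 h2))"

text \<open>The coefficients are series rather than scalars: a block gathers all parameters \<alpha>
  at once, and its coordinates \<open>G\<close> on the bases are unique by
  \<open>block_sum_eq_0\<close>.\<close>

definition block :: "nat \<Rightarrow> nat \<Rightarrow> nat \<Rightarrow> nat \<Rightarrow> ('p::finite, 'q::finite) funs set" where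
  "block k l a b = {block_sum k l a b G | G. \<forall>h1 h2. entire (G h1 h2)}"

lemma block_sum_eq_0:
  assumes "\<And>h1 h2. entire (G h1 h2)" "block_sum k l a b G = 0" "h1 \<in> hbasis k" "h2 \<in> hbasis l"
  shows "G h1 h2 = 0"
  by (rule kterm_independent[OF hbasis(1,2) hbasis_hp hbasis(1,2) hbasis_hp assms(1) assms(2)[unfolded block_sum_def] assms(3,4)])

lemma block_sum_add:
  assumes "\<And>h1 h2. entire (F h1 h2)" "\<And>h1 h2. entire (G h1 h2)"
  shows "block_sum k l a b (\<lambda>h1 h2. F h1 h2 + G h1 h2) = block_sum k l a b F + block_sum k l a b G"
  using assms by (simp add: block_sum_def kterm_add sum.distrib)

lemma block_sum_cmult:
  assumes "\<And>h1 h2. entire (F h1 h2)"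
  shows "block_sum k l a b (\<lambda>h1 h2. fps_const c * F h1 h2) = cscale c (block_sum k l a b F)"
  using assms by (simp add: block_sum_def kterm_cmult cfun.scale_sum_right)

lemma block_subspace: "cfun.subspace (block k l a b)"
proof (rule cfun.subspaceI)
  have "block_sum k l a b (\<lambda>_ _. 0) = (0 :: ('a, 'b) funs)" by (simp add: block_sum_def kterm_0)
  then show "0 \<in> (block k l a b :: ('a, 'b) funs set)"
    unfolding block_def by (intro CollectI exI[of _ "\<lambda>_ _. 0"]) simp
next
  fix x y :: "('a, 'b) funs" assume "x \<in> block k l a b" "y \<in> block k l a b"
  then obtain F G where "x = block_sum k l a b F" "y = block_sum k l a b G"
    "\<And>h1 h2. entire (F h1 h2)" "\<And>h1 h2. entire (G h1 h2)" by (auto simp: block_def)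
  then show "x + y \<in> block k l a b" unfolding block_def
    by (intro CollectI exI[of _ "\<lambda>h1 h2. F h1 h2 + G h1 h2"]) (simp add: block_sum_add block_sum_cmult)
next
  fix x :: "('a, 'b) funs" and c assume "x \<in> block k l a b"
  then obtain F where "x = block_sum k l a b F" "\<And>h1 h2. entire (F h1 h2)" by (auto simp: block_def)
  then show "cscale c x \<in> block k l a b" unfolding block_def
    by (intro CollectI exI[of _ "\<lambda>h1 h2. fps_const c * F h1 h2"]) (simp add: block_sum_add block_sum_cmult)
qed

lemma kterm_lin:
  "kterm (f + g) h2 a b G = kterm f h2 a b G + kterm g h2 a b G" "kterm (cscale c f) h2 a b G = cscale c (kterm f h2 a b G)"
  "kterm 0 h2 a b G = 0"
  "kterm h1 (f' + g') a b G = kterm h1 f' a b G + kterm h1 g' a b G" "kterm h1 (cscale c f') a b G = cscale c (kterm h1 f' a b G)"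
  "kterm h1 0 a b G = 0"
  by (simp_all add: kterm_def l_hom distrib_left distrib_right mult_cscale)

lemma kterm_in_block:
  fixes h1 :: "real^'p::finite \<Rightarrow> complex" and h2 :: "real^'q::finite \<Rightarrow> complex"
  assumes h: "h1 \<in> harmonic_polys k" "h2 \<in> harmonic_polys l" and g: "entire g"
  shows "kterm h1 h2 a b g \<in> block k l a b"
proof -
  have 1: "kterm b1 b2 a b g \<in> block k l a b" if b: "b1 \<in> hbasis k" "b2 \<in> hbasis l"
    for b1 :: "real^'p \<Rightarrow> complex" and b2 :: "real^'q \<Rightarrow> complex"
  proof -
    have "block_sum k l a b (\<lambda>h1 h2. if h1 = b1 \<and> h2 = b2 then g else 0)
        = (\<Sum>h1\<in>hbasis k. \<Sum>h2\<in>hbasis l. if h1 = b1 \<and> h2 = b2 then kterm h1 h2 a b g else 0)"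
      unfolding block_sum_def by (intro sum.cong refl) (auto simp: kterm_0)
    also have "\<dots> = (\<Sum>h1\<in>hbasis k. if h1 = b1 then kterm h1 b2 a b g else 0)"
    proof (intro sum.cong refl)
      fix h1 :: "real^'p \<Rightarrow> complex"
      show "(\<Sum>h2\<in>hbasis l. if h1 = b1 \<and> h2 = b2 then kterm h1 h2 a b g else 0) = (if h1 = b1 then kterm h1 b2 a b g else 0)"
        using b by (cases "h1 = b1") (simp_all add: hbasis(1))
    qed
    also have "\<dots> = kterm b1 b2 a b g" using b by (simp add: hbasis(1))
    finally show ?thesis unfolding block_def
      by (intro CollectI exI[of _ "\<lambda>h1 h2. if h1 = b1 \<and> h2 = b2 then g else 0"]) (use g in auto)
  qed
  have 2: "kterm b1 h2 a b g \<in> block k l a b" if b: "b1 \<in> hbasis k" for b1 :: "real^'p \<Rightarrow> complex"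
    by (rule lin_on_image_span[of UNIV "\<lambda>h2. kterm b1 h2 a b g" "hbasis l"])
      (use 1 b h hbasis(3) block_subspace in \<open>auto intro!: lin_onI simp: kterm_lin\<close>)
  show ?thesis
    by (rule lin_on_image_span[of UNIV "\<lambda>h1. kterm h1 h2 a b g" "hbasis k"])
      (use 2 h hbasis(3) block_subspace in \<open>auto intro!: lin_onI simp: kterm_lin\<close>)
qed

lemma kterm_normal_form:
  assumes "entire g"
  shows "kterm h1 h2 a b g = kterm h1 h2 (a - min a b) (b - min a b) (fps_X ^ min a b * g)"
  unfolding kterm_def rad_X_power[OF assms] by simp

definition joint_eigen :: "complex \<Rightarrow> complex \<Rightarrow> complex \<Rightarrow> ('p::finite, 'q::finite) funs set" where
  "joint_eigen c d \<mu> = {f \<in> nice. xx.Cas f = cscale c f \<and> yy.Cas f = cscale d f \<and> sl2_H f = cscale \<mu> f}"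

lemma joint_eigenI: "f \<in> nice \<Longrightarrow> xx.Cas f = cscale c f \<Longrightarrow> yy.Cas f = cscale d f \<Longrightarrow> sl2_H f = cscale \<mu> f \<Longrightarrow> f \<in> joint_eigen c d \<mu>"
  by (simp add: joint_eigen_def)

lemma joint_eigenD: "f \<in> joint_eigen c d \<mu> \<Longrightarrow> f \<in> nice" "f \<in> joint_eigen c d \<mu> \<Longrightarrow> xx.Cas f = cscale c f"
  "f \<in> joint_eigen c d \<mu> \<Longrightarrow> yy.Cas f = cscale d f" "f \<in> joint_eigen c d \<mu> \<Longrightarrow> sl2_H f = cscale \<mu> f"
  by (simp_all add: joint_eigen_def)

lemma lin_on_Cas: "lin_on nice xx.Cas" "lin_on nice yy.Cas"
  by (rule lin_onI; simp add: xx.Cas_add yy.Cas_add xx.Cas_cscale yy.Cas_cscale)+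

lemma joint_eigen_subspace: "cfun.subspace (joint_eigen c d \<mu>)"
proof (rule cfun.subspaceI)
  note l = lin_onD[OF lin_on_Cas(1)] lin_onD[OF lin_on_Cas(2)] lin_onD[OF lin_on_sl2(1)]
  show "0 \<in> joint_eigen c d \<mu>"
    using lin_on_0[OF lin_on_Cas(1) nice_subspace] lin_on_0[OF lin_on_Cas(2) nice_subspace]
      lin_on_0[OF lin_on_sl2(1) nice_subspace]
    by (intro joint_eigenI) simp_all
  fix x y :: "('a, 'b) funs" and b assume x: "x \<in> joint_eigen c d \<mu>"
  show "cscale b x \<in> joint_eigen c d \<mu>"
    using joint_eigenD[OF x] by (intro joint_eigenI) (simp_all add: l mult.commute)
  assume y: "y \<in> joint_eigen c d \<mu>"
  show "x + y \<in> joint_eigen c d \<mu>"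
    using joint_eigenD[OF x] joint_eigenD[OF y] by (intro joint_eigenI) (simp_all add: l cscale_add_right)
qed

lemma joint_eigen_Xp: "f \<in> joint_eigen c d \<mu> \<Longrightarrow> sl2_Xp f \<in> joint_eigen c d (\<mu> + 2)"
  and joint_eigen_Xm: "f \<in> joint_eigen c d \<mu> \<Longrightarrow> sl2_Xm f \<in> joint_eigen c d (\<mu> - 2)"
proof -
  assume f: "f \<in> joint_eigen c d \<mu>"
  note n = joint_eigenD(1)[OF f]
  show "sl2_Xp f \<in> joint_eigen c d (\<mu> + 2)"
    using n by (intro joint_eigenI) (simp_all add: Cas_sl2 H_Xp joint_eigenD(2-4)[OF f] lin_onD(2)[OF lin_on_sl2(2)] cfun.scale_left_distrib)
  show "sl2_Xm f \<in> joint_eigen c d (\<mu> - 2)"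
    using n by (intro joint_eigenI) (simp_all add: Cas_sl2 H_Xp joint_eigenD(2-4)[OF f] lin_onD(2)[OF lin_on_sl2(3)] cfun.scale_left_diff_distrib)
qed

lemma joint_eigen_Xm_power: "f \<in> joint_eigen c d \<mu> \<Longrightarrow> (sl2_Xm ^^ j) f \<in> joint_eigen c d (\<mu> - 2 * of_nat j)"
proof (induction j)
  case (Suc j)
  then have "(sl2_Xm ^^ j) f \<in> joint_eigen c d (\<mu> - 2 * of_nat j)" by blast
  from joint_eigen_Xm[OF this] show ?case by (simp add: algebra_simps)
qed simp

text \<open>Separation by the two Casimir operators and H in turn; injectivity of the eigenvalue
  triple leaves a single summand.\<close>

lemma joint_eigen_separate:
  assumes I: "finite I" and F: "\<And>i. i \<in> I \<Longrightarrow> F i \<in> joint_eigen (c i) (d i) (\<mu> i)"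
    and z: "(\<Sum>i\<in>I. F i) = 0" and inj: "inj_on (\<lambda>i. (c i, d i, \<mu> i)) I" and i: "i \<in> I"
  shows "F i = 0"
proof -
  have 1: "(\<Sum>j\<in>{j \<in> I. c j = c i}. F j) = 0"
    by (rule eigen_separate[OF nice_subspace lin_on_Cas(1) I _ _ z]) (use joint_eigenD[OF F] in auto)
  have 2: "(\<Sum>j\<in>{j \<in> {j \<in> I. c j = c i}. d j = d i}. F j) = 0"
    by (rule eigen_separate[OF nice_subspace lin_on_Cas(2) _ _ _ 1]) (use I joint_eigenD[OF F] in auto)
  have 3: "(\<Sum>j\<in>{j \<in> {j \<in> {j \<in> I. c j = c i}. d j = d i}. \<mu> j = \<mu> i}. F j) = 0"
    by (rule eigen_separate[OF nice_subspace lin_on_sl2(1) _ _ _ 2]) (use I joint_eigenD[OF F] in auto)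
  have "{j \<in> {j \<in> {j \<in> I. c j = c i}. d j = d i}. \<mu> j = \<mu> i} = {i}"
    using inj i by (auto simp: inj_on_def)
  then show ?thesis using 3 by simp
qed

lemma block_joint_eigen:
  assumes "f \<in> (block k l a b :: ('p::finite, 'q::finite) funs set)"
  shows "f \<in> joint_eigen (cas_val TYPE('p) k) (cas_val TYPE('q) l) (wt TYPE('p) TYPE('q) k l a b)"
proof -
  obtain G where f: "f = block_sum k l a b G" "\<And>h1 h2. entire (G h1 h2)" using assms by (auto simp: block_def)
  show ?thesis
    unfolding f(1) block_sum_def
    by (intro cfun.subspace_sum joint_eigen_subspace joint_eigenI nice_kterm kterm_ops kterm_H f(2) hbasis_harm)
qed

text \<open>k (k + n - 2) is strictly increasing for n \<ge> 2; for n = 1 the degrees 0 and 1 would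
  have the same value.\<close>

lemma cas_val_inj:
  assumes "CARD('n::finite) \<ge> 2" "cas_val TYPE('n) k = cas_val TYPE('n) k'"
  shows "k = k'"
proof -
  define n where "n = CARD('n) - 2"
  have n: "CARD('n) = n + 2" using assms(1) by (simp add: n_def)
  have "of_nat k * (of_nat k + of_nat n) = (of_nat k' * (of_nat k' + of_nat n) :: complex)"
    using assms(2) by (simp add: cas_val_def n)
  then have "complex_of_nat (k * (k + n)) = of_nat (k' * (k' + n))" by simp
  then have *: "k * (k + n) = k' * (k' + n)" by (simp only: of_nat_eq_iff)
  have mono: "i * (i + n) < j * (j + n)" if "i < j" for i j :: nat
    using that by (intro mult_strict_mono') auto
  show ?thesis
    using mono[of k k'] mono[of k' k] * by (cases k k' rule: linorder_cases) auto
qed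

text \<open>\<open>\<rho>\<^sub>x \<rho>\<^sub>y\<close> can be absorbed into the power series, so one of the two exponents may be taken to be \<open>0\<close>; this makes
  the key of a block determined by its eigenvalues.\<close>

definition keys :: "(nat \<times> nat \<times> nat \<times> nat) set" where
  "keys = {(k, l, a, b). a = 0 \<or> b = 0}"

text \<open>The Casimir values give k and l, the weight then gives b - a, and one of a and b is
  0.\<close>

lemma key_inj:
  assumes "CARD('p::finite) \<ge> 2" "CARD('q::finite) \<ge> 2"
    and "a = 0 \<or> b = 0" "a' = 0 \<or> b' = 0"
    and "cas_val TYPE('p) k = cas_val TYPE('p) k'" "cas_val TYPE('q) l = cas_val TYPE('q) l'"
    and "wt TYPE('p) TYPE('q) k l a b = wt TYPE('p) TYPE('q) k' l' a' b'"
  shows "(k, l, a, b) = (k', l', a', b')"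
proof -
  have kl: "k = k'" "l = l'" using cas_val_inj assms by blast+
  have "2 * complex_of_nat b - 2 * of_nat a = 2 * of_nat b' - 2 * of_nat a'"
    using assms(7) kl by (simp add: wt_def)
  then have "complex_of_nat (2 * b + 2 * a') = of_nat (2 * b' + 2 * a)" by (simp add: algebra_simps)
  then have "2 * b + 2 * a' = 2 * b' + 2 * a" by (simp only: of_nat_eq_iff)
  then show ?thesis using kl assms(3,4) by auto
qed

definition block_at :: "nat \<times> nat \<times> nat \<times> nat \<Rightarrow> ('p::finite, 'q::finite) funs set" where
  "block_at i = (case i of (k, l, a, b) \<Rightarrow> block k l a b)"

definition block_decomp :: "('p::finite, 'q::finite) funs \<Rightarrow> (nat \<times> nat \<times> nat \<times> nat) set \<Rightarrow>
    (nat \<times> nat \<times> nat \<times> nat \<Rightarrow> ('p, 'q) funs) \<Rightarrow> bool" where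
  "block_decomp f I F \<longleftrightarrow> finite I \<and> I \<subseteq> keys \<and> (\<forall>i\<in>I. F i \<in> block_at i) \<and> f = (\<Sum>i\<in>I. F i)"

lemma block_decompD:
  assumes "block_decomp f I F"
  shows "finite I" "I \<subseteq> keys" "i \<in> I \<Longrightarrow> F i \<in> block_at i" "f = (\<Sum>i\<in>I. F i)"
  using assms unfolding block_decomp_def by blast+

lemma block_at_subspace: "cfun.subspace (block_at i)"
  by (cases i) (simp add: block_at_def block_subspace)

lemma block_decomp_add:
  assumes "block_decomp x I F" "block_decomp y J G"
  shows "\<exists>K H. block_decomp (x + y) K H"
proof -
  note I = block_decompD[OF assms(1)] and J = block_decompD[OF assms(2)]
  define F' where "F' i = (if i \<in> I then F i else 0)" for i
  define G' where "G' i = (if i \<in> J then G i else 0)" for i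
  have b: "F' i \<in> block_at i" "G' i \<in> block_at i" for i
    unfolding F'_def G'_def using I(3) J(3) by (auto intro: cfun.subspace_0[OF block_at_subspace])
  have "(\<Sum>i\<in>I. F i) = (\<Sum>i\<in>I \<union> J. F' i)"
    unfolding F'_def using I(1) J(1) by (intro sum.mono_neutral_cong_left) auto
  moreover have "(\<Sum>i\<in>J. G i) = (\<Sum>i\<in>I \<union> J. G' i)"
    unfolding G'_def using I(1) J(1) by (intro sum.mono_neutral_cong_left) auto
  ultimately have xy: "x + y = (\<Sum>i\<in>I \<union> J. F' i + G' i)" unfolding I(4) J(4) by (simp only: sum.distrib)
  have "block_decomp (x + y) (I \<union> J) (\<lambda>i. F' i + G' i)"
    unfolding block_decomp_def
    by (intro conjI ballI xy cfun.subspace_add[OF block_at_subspace] b) (use I(1,2) J(1,2) in auto)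
  then show ?thesis by blast
qed

lemma block_decomp_scale:
  assumes "block_decomp x I F"
  shows "block_decomp (cscale c x) I (\<lambda>i. cscale c (F i))"
proof -
  note I = block_decompD[OF assms]
  show ?thesis
    unfolding block_decomp_def
    by (intro conjI ballI cfun.subspace_scale[OF block_at_subspace] I(1-3))
      (simp_all add: I(4) cfun.scale_sum_right)
qed

text \<open>The common power of \<open>rho_x\<close> and \<open>rho_y\<close> moves into the series,
  so the term lies in a block whose key belongs to \<open>keys\<close>.\<close>

lemma kterm_block_decomp:
  assumes h: "h1 \<in> harmonic_polys k" "h2 \<in> harmonic_polys l" and g: "entire g"
  shows "\<exists>I F. block_decomp (kterm h1 h2 a b g) I F"
proof -
  let ?i = "(k, l, a - min a b, b - min a b)"
  have "kterm h1 h2 a b g \<in> block_at ?i"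
    unfolding kterm_normal_form[OF g] block_at_def prod.case
    by (rule kterm_in_block) (use h g in auto)
  then have "block_decomp (kterm h1 h2 a b g) {?i} (\<lambda>_. kterm h1 h2 a b g)"
    by (auto simp: block_decomp_def keys_def)
  then show ?thesis by blast
qed

lemma space_E_decomp:
  assumes "f \<in> space_E"
  shows "\<exists>I F. block_decomp f I F"
  using assms unfolding space_E_eq
proof (induction rule: cfun.span_induct_alt)
  case base
  have "block_decomp (0 :: ('a, 'b) funs) {} (\<lambda>_. 0)" by (simp add: block_decomp_def)
  then show "\<exists>I F. block_decomp (0 :: ('a, 'b) funs) I F" by blast
next
  case (step c x y)
  from step(1) obtain I F where "block_decomp x I F"
    using kterm_block_decomp entire_PsiF by blast
  from block_decomp_scale[OF this] step(2) show "\<exists>I F. block_decomp (cscale c x + y) I F"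
    using block_decomp_add by blast
qed

text \<open>With a positive exponent both indicial factors are positive for every n, so the
  recursion has only the zero solution.\<close>

lemma Lop_0_pos:
  assumes "Lop (Suc a) (kappa TYPE('n::finite) k) g = 0"
  shows "g = 0"
proof -
  have "fps_nth g n = 0" for n
  proof (induction n)
    case (Suc n)
    have "fps_nth (Lop (Suc a) (kappa TYPE('n) k) g) (Suc n) = 0" unfolding assms by simp
    then have "of_nat (Suc a + Suc n) * (kappa TYPE('n) k + of_nat (a + Suc n)) * fps_nth g (Suc n) = 0"
      using Suc unfolding Lop_nth by (simp add: algebra_simps)
    then show ?case using kappa_nz[of k "a + Suc n", where 'n = 'n] by (simp del: of_nat_add of_nat_Suc add_Suc_right)
  next
    case 0
    have "fps_nth (Lop (Suc a) (kappa TYPE('n) k) g) 0 = 0" unfolding assms by simp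
    then have "of_nat (Suc a) * (kappa TYPE('n) k + of_nat a) * fps_nth g 0 = 0"
      unfolding Lop_nth by (simp add: algebra_simps)
    then show ?case using kappa_nz[of k a, where 'n = 'n] by (simp del: of_nat_Suc)
  qed
  then show ?thesis by (simp add: fps_eq_iff)
qed

text \<open>With exponent 0 the equation for n = 0 reads 0 = 0 and leaves the constant term free;
  all further coefficients follow the recursion of \<open>PsiF\<close>.\<close>

lemma Lop_0_zero:
  assumes "Lop 0 (kappa TYPE('n::finite) k) g = 0"
  shows "g = fps_const (fps_nth g 0) * PsiF (kappa TYPE('n) k)"
proof -
  have *: "fps_nth g n = fps_nth g 0 * fps_nth (PsiF (kappa TYPE('n) k)) n" for n
  proof (induction n)
    case 0
    show ?case by (simp add: PsiF_def)
  next
    case (Suc n)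
    have nz: "kappa TYPE('n) k + of_nat n \<noteq> 0" by (rule kappa_nz)
    have "fps_nth (Lop 0 (kappa TYPE('n) k) g) (Suc n) = 0" unfolding assms by simp
    then have eq: "of_nat (Suc n) * (kappa TYPE('n) k + of_nat n) * fps_nth g (Suc n) = - fps_nth g n"
      unfolding Lop_nth by (simp add: algebra_simps eq_neg_iff_add_eq_0)
    have nz2: "of_nat (Suc n) * (kappa TYPE('n) k + of_nat n) \<noteq> 0" using nz by (simp del: of_nat_Suc)
    have "fps_nth g (Suc n) = - fps_nth g n / (of_nat (Suc n) * (kappa TYPE('n) k + of_nat n))"
      unfolding nonzero_eq_divide_eq[OF nz2] eq[symmetric] by (rule mult.commute)
    also have "\<dots> = fps_nth g 0 * fps_nth (PsiF (kappa TYPE('n) k)) (Suc n)"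
      unfolding Suc by (simp add: PsiF_def pochhammer_rec' del: of_nat_Suc)
    finally show ?case .
  qed
  show ?thesis by (rule fps_ext, unfold fps_mult_left_const_nth, rule *)
qed

text \<open>Multiplied by \<open>rho_x\<close>, the image under X^+ is a block sum with the same
  exponents, where coordinates can be compared.\<close>

lemma block_Xp_0:
  fixes G :: "(real^'p::finite \<Rightarrow> complex) \<Rightarrow> (real^'q::finite \<Rightarrow> complex) \<Rightarrow> complex fps"
  assumes G: "\<And>h1 h2. entire (G h1 h2)" and z: "sl2_Xp (block_sum k l a b G) = 0"
    and h: "h1 \<in> hbasis k" "h2 \<in> hbasis l"
  shows "Lop a (kappa TYPE('p) k) (G h1 h2) = 0"
proof (rule block_sum_eq_0[where a = a and b = b and G = "\<lambda>h1 h2. Lop a (kappa TYPE('p) k) (G h1 h2)", OF _ _ h])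
  show "entire (Lop a (kappa TYPE('p) k) (G h1 h2))" for h1 h2 using G by (simp add: entire_Lop)
  have n: "kterm h1 h2 a b (G h1 h2) \<in> nice" if "h1 \<in> hbasis k" "h2 \<in> hbasis l" for h1 h2
    by (rule nice_kterm[OF hbasis_harm[OF that(1)] hbasis_harm[OF that(2)] G])
  have "0 = xx.rho * sl2_Xp (block_sum k l a b G)" unfolding z by simp
  also have "sl2_Xp (block_sum k l a b G) = (\<Sum>h1\<in>hbasis k. \<Sum>h2\<in>hbasis l. sl2_Xp (kterm h1 h2 a b (G h1 h2)))"
    unfolding block_sum_def using n
    by (simp add: lin_on_sum[OF lin_on_sl2(2) nice_subspace])
  also have "xx.rho * \<dots> = (\<Sum>h1\<in>hbasis k. \<Sum>h2\<in>hbasis l. cscale (- 1) (kterm h1 h2 a b (Lop a (kappa TYPE('p) k) (G h1 h2))))"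
    unfolding sum_distrib_left by (intro sum.cong refl kterm_rho_Xp hbasis_harm G)
  also have "\<dots> = cscale (- 1) (block_sum k l a b (\<lambda>h1 h2. Lop a (kappa TYPE('p) k) (G h1 h2)))"
    unfolding block_sum_def by (simp only: cfun.scale_sum_right)
  finally show "block_sum k l a b (\<lambda>h1 h2. Lop a (kappa TYPE('p) k) (G h1 h2)) = 0"
    by (simp only: cfun.scale_eq_0_iff eq_commute[of 0]) simp
qed

lemma block_Xp_0_pos:
  assumes f: "f \<in> block k l (Suc a) b" and z: "sl2_Xp f = 0"
  shows "f = 0"
proof -
  obtain G where G: "f = block_sum k l (Suc a) b G" "\<And>h1 h2. entire (G h1 h2)" using f by (auto simp: block_def)
  have "G h1 h2 = 0" if "h1 \<in> hbasis k" "h2 \<in> hbasis l" for h1 h2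
    by (rule Lop_0_pos[OF block_Xp_0[OF G(2) z[unfolded G(1)] that]])
  then show ?thesis unfolding G(1) block_sum_def by (simp add: kterm_0)
qed

lemma block_Xp_0_zero:
  fixes f :: "('p::finite, 'q::finite) funs"
  assumes f: "f \<in> block k l 0 b" and z: "sl2_Xp f = 0"
  shows "\<exists>c. f = block_sum k l 0 b (\<lambda>h1 h2. fps_const (c h1 h2) * PsiF (kappa TYPE('p) k))"
proof -
  obtain G where G: "f = block_sum k l 0 b G" "\<And>h1 h2. entire (G h1 h2)" using f by (auto simp: block_def)
  have "G h1 h2 = fps_const (fps_nth (G h1 h2) 0) * PsiF (kappa TYPE('p) k)" if "h1 \<in> hbasis k" "h2 \<in> hbasis l" for h1 h2
    by (rule Lop_0_zero[OF block_Xp_0[OF G(2) z[unfolded G(1)] that]])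
  then have "f = block_sum k l 0 b (\<lambda>h1 h2. fps_const (fps_nth (G h1 h2) 0) * PsiF (kappa TYPE('p) k))"
    unfolding G(1) block_sum_def by (intro sum.cong refl) metis
  then show ?thesis by (rule exI[of _ "\<lambda>h1 h2. fps_nth (G h1 h2) 0"])
qed

text \<open>Only the constant term is tracked: a step from b + 1 to b multiplies it by (b +
  1)(\<kappa> + b), with \<kappa> belonging to the degree l, and this is nonzero.\<close>

lemma kterm_Xm_power_low:
  fixes h1 :: "real^'p::finite \<Rightarrow> complex" and h2 :: "real^'q::finite \<Rightarrow> complex"
  assumes h: "h1 \<in> harmonic_polys k" "h2 \<in> harmonic_polys l" and g: "entire g"
  shows "\<exists>g'. entire g' \<and> (sl2_Xm ^^ j) (kterm h1 h2 0 (b + j) g) = kterm h1 h2 0 b g'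
    \<and> (fps_nth g' 0 = 0 \<longrightarrow> fps_nth g 0 = 0)"
proof (induction j arbitrary: b)
  case 0
  show "\<exists>g'. entire g' \<and> (sl2_Xm ^^ 0) (kterm h1 h2 0 (b + 0) g) = kterm h1 h2 0 b g'
    \<and> (fps_nth g' 0 = 0 \<longrightarrow> fps_nth g 0 = 0)" using g by auto
next
  case (Suc j)
  obtain g' where g': "entire g'" "(sl2_Xm ^^ j) (kterm h1 h2 0 (Suc b + j) g) = kterm h1 h2 0 (Suc b) g'"
    "fps_nth g' 0 = 0 \<longrightarrow> fps_nth g 0 = 0" using Suc by blast
  let ?g = "fps_X * g' + (fps_const (kappa TYPE('q) l) * theta (Suc b) g' + theta b (theta (Suc b) g'))"
  have "(sl2_Xm ^^ Suc j) (kterm h1 h2 0 (b + Suc j) g) = kterm h1 h2 0 b ?g"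
    using g'(2) kterm_Xm(2)[OF h g'(1)] by simp
  moreover have "entire ?g" using g'(1) by simp
  moreover have "fps_nth ?g 0 = of_nat (Suc b) * (kappa TYPE('q) l + of_nat b) * fps_nth g' 0"
    by (simp add: algebra_simps)
  then have "fps_nth ?g 0 = 0 \<longrightarrow> fps_nth g 0 = 0"
    using g'(3) kappa_nz[of l b, where 'n = 'q] by (simp del: of_nat_Suc)
  ultimately show "\<exists>g'. entire g' \<and> (sl2_Xm ^^ Suc j) (kterm h1 h2 0 (b + Suc j) g) = kterm h1 h2 0 b g'
    \<and> (fps_nth g' 0 = 0 \<longrightarrow> fps_nth g 0 = 0)" by blast
qed

text \<open>The first b applications use up the power of \<open>rho_y\<close>; each further one adds
  a factor \<open>rho_x\<close>.\<close>

lemma kterm_Xm_power_high: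
  fixes h1 :: "real^'p::finite \<Rightarrow> complex" and h2 :: "real^'q::finite \<Rightarrow> complex"
  assumes h: "h1 \<in> harmonic_polys k" "h2 \<in> harmonic_polys l" and g: "entire g"
  shows "\<exists>g'. entire g' \<and> (sl2_Xm ^^ (j + b)) (kterm h1 h2 0 b g) = kterm h1 h2 j 0 g'"
proof (induction j)
  case 0
  show "\<exists>g'. entire g' \<and> (sl2_Xm ^^ (0 + b)) (kterm h1 h2 0 b g) = kterm h1 h2 0 0 g'"
    using kterm_Xm_power_low[OF h g, of b 0] by auto
next
  case (Suc j)
  then obtain g' where g': "entire g'" "(sl2_Xm ^^ (j + b)) (kterm h1 h2 0 b g) = kterm h1 h2 j 0 g'" by blast
  have "(sl2_Xm ^^ (Suc j + b)) (kterm h1 h2 0 b g) = kterm h1 h2 (Suc j) 0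
     (g' + (fps_const (kappa TYPE('q) l) * fps_deriv g' + theta 0 (fps_deriv g')))"
    using g'(2) kterm_Xm(1)[OF h g'(1)] by simp
  then show "\<exists>g'. entire g' \<and> (sl2_Xm ^^ (Suc j + b)) (kterm h1 h2 0 b g) = kterm h1 h2 (Suc j) 0 g'"
    using g'(1) by (intro exI conjI) auto
qed

text \<open>Injectivity of the powers of X^- that at most exhaust \<open>rho_y\<close>; for j = m +
  1 it excludes b > m in the module.\<close>

lemma block_Xm_power_0:
  fixes c :: "(real^'p::finite \<Rightarrow> complex) \<Rightarrow> (real^'q::finite \<Rightarrow> complex) \<Rightarrow> complex"
  assumes b: "b \<ge> j"
    and z: "(sl2_Xm ^^ j) (block_sum k l 0 b (\<lambda>h1 h2. fps_const (c h1 h2) * PsiF (kappa TYPE('p) k))) = 0"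
  shows "block_sum k l 0 b (\<lambda>h1 h2. fps_const (c h1 h2) * PsiF (kappa TYPE('p) k)) = 0"
proof -
  let ?P = "PsiF (kappa TYPE('p) k)"
  obtain b' where b': "b = b' + j" using b by (metis add.commute le_Suc_ex)
  have "\<forall>h1 h2. \<exists>g. entire g \<and> (h1 \<in> hbasis k \<longrightarrow> h2 \<in> hbasis l \<longrightarrow>
      (sl2_Xm ^^ j) (kterm h1 h2 0 b (fps_const (c h1 h2) * ?P)) = kterm h1 h2 0 b' g
    \<and> (fps_nth g 0 = 0 \<longrightarrow> c h1 h2 = 0))"
  proof (intro allI)
    fix h1 :: "real^'p \<Rightarrow> complex" and h2 :: "real^'q \<Rightarrow> complex"
    show "\<exists>g. entire g \<and> (h1 \<in> hbasis k \<longrightarrow> h2 \<in> hbasis l \<longrightarrow>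
      (sl2_Xm ^^ j) (kterm h1 h2 0 b (fps_const (c h1 h2) * ?P)) = kterm h1 h2 0 b' g
      \<and> (fps_nth g 0 = 0 \<longrightarrow> c h1 h2 = 0))"
    proof (cases "h1 \<in> hbasis k \<and> h2 \<in> hbasis l")
      case True
      have e: "entire (fps_const (c h1 h2) * ?P)" by simp
      have "fps_nth (fps_const (c h1 h2) * ?P) 0 = c h1 h2" by (simp add: PsiF_def)
      then show ?thesis
        using kterm_Xm_power_low[OF hbasis_harm[OF conjunct1[OF True]] hbasis_harm[OF conjunct2[OF True]] e, of j b']
        unfolding b' by metis
    qed (auto intro: exI[of _ 0])
  qed
  then obtain G where G: "\<And>h1 h2. entire (G h1 h2)"
    "\<And>h1 h2. h1 \<in> hbasis k \<Longrightarrow> h2 \<in> hbasis l \<Longrightarrow>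
      (sl2_Xm ^^ j) (kterm h1 h2 0 b (fps_const (c h1 h2) * ?P)) = kterm h1 h2 0 b' (G h1 h2)"
    "\<And>h1 h2. h1 \<in> hbasis k \<Longrightarrow> h2 \<in> hbasis l \<Longrightarrow> fps_nth (G h1 h2) 0 = 0 \<Longrightarrow> c h1 h2 = 0"
    by metis
  have n: "kterm h1 h2 0 b (fps_const (c h1 h2) * ?P) \<in> nice" if "h1 \<in> hbasis k" "h2 \<in> hbasis l" for h1 h2
    by (rule nice_kterm[OF hbasis_harm[OF that(1)] hbasis_harm[OF that(2)]]) simp
  have "(sl2_Xm ^^ j) (block_sum k l 0 b (\<lambda>h1 h2. fps_const (c h1 h2) * ?P))
      = (\<Sum>h1\<in>hbasis k. \<Sum>h2\<in>hbasis l. (sl2_Xm ^^ j) (kterm h1 h2 0 b (fps_const (c h1 h2) * ?P)))"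
    unfolding block_sum_def using n
    by (simp add: lin_on_sum[OF lin_on_Xm_power nice_subspace])
  also have "\<dots> = block_sum k l 0 b' G" unfolding block_sum_def by (intro sum.cong refl G(2))
  finally have "block_sum k l 0 b' G = 0" unfolding z ..
  from block_sum_eq_0[OF G(1) this] have "c h1 h2 = 0" if "h1 \<in> hbasis k" "h2 \<in> hbasis l" for h1 h2
    using G(3)[OF that] that by simp
  then show ?thesis unfolding block_sum_def by (intro sum.neutral ballI) (simp add: kterm_0)
qed

section \<open>The spanning set of the module\<close>

text \<open>The equation between \<open>k\<close>, \<open>l\<close> and \<open>b\<close> says that \<open>H\<close> has eigenvalue \<open>m\<close>.\<close>

definition gens :: "nat \<Rightarrow> nat \<Rightarrow> ('p::finite, 'q::finite) funs set" where
  "gens m K = {kterm h1 h2 0 b (PsiF (kappa TYPE('p) k)) | h1 h2 k l b. k \<le> K \<and> b \<le> m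
    \<and> h1 \<in> harmonic_polys k \<and> h2 \<in> harmonic_polys l \<and> 2 * l + 4 * b + CARD('q) = 2 * k + CARD('p) + 2 * m}"

definition MK :: "nat \<Rightarrow> nat \<Rightarrow> ('p::finite, 'q::finite) funs set" where
  "MK m K = cfun.span (gens m K)"

lemma MK_subspace [simp, intro]: "cfun.subspace (MK m K)"
  by (simp add: MK_def)

lemma MK_mono: "K \<le> K' \<Longrightarrow> MK m K \<subseteq> MK m K'"
  unfolding MK_def by (rule cfun.span_mono) (force simp: gens_def)

lemma kterm_in_MK:
  fixes h1 :: "real^'p::finite \<Rightarrow> complex" and h2 :: "real^'q::finite \<Rightarrow> complex"
  assumes "k \<le> K" "b \<le> m" "h1 \<in> harmonic_polys k" "h2 \<in> harmonic_polys l"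
    and "2 * l + 4 * b + CARD('q) = 2 * k + CARD('p) + 2 * m"
  shows "kterm h1 h2 0 b (PsiF (kappa TYPE('p) k)) \<in> MK m K"
  unfolding MK_def gens_def using assms by (intro cfun.span_base) blast

lemma gens_nice: "gens m K \<subseteq> nice"
  unfolding gens_def using nice_kterm entire_Psi_kappa by blast

lemma MK_nice: "MK m K \<subseteq> nice"
  unfolding MK_def by (rule cfun.span_minimal[OF gens_nice nice_subspace])

lemma eq_iff_half_diff: "x - y = (a - b) / 2 \<Longrightarrow> x = y \<longleftrightarrow> a = b" for x y a b :: complex
  by auto

lemma wt_iff:
  "wt TYPE('p::finite) TYPE('q::finite) k l 0 b = of_nat m \<longleftrightarrow> 2 * l + 4 * b + CARD('q) = 2 * k + CARD('p) + 2 * m"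
proof -
  have "wt TYPE('p) TYPE('q) k l 0 b - of_nat m
      = (complex_of_nat (2 * l + 4 * b + CARD('q)) - of_nat (2 * k + CARD('p) + 2 * m)) / 2"
    by (simp add: wt_def kappa_def field_simps)
  then have "wt TYPE('p) TYPE('q) k l 0 b = of_nat m \<longleftrightarrow>
      complex_of_nat (2 * l + 4 * b + CARD('q)) = of_nat (2 * k + CARD('p) + 2 * m)"
    by (rule eq_iff_half_diff)
  then show ?thesis by (simp only: of_nat_eq_iff)
qed

text \<open>By \<open>sl2_string\<close> the vector (X^-)^(m+1) f is killed by X^+, but it carries a
  positive power of \<open>rho_x\<close>, and on such blocks X^+ is injective.\<close>

lemma kterm_hw:
  fixes h1 :: "real^'p::finite \<Rightarrow> complex" and h2 :: "real^'q::finite \<Rightarrow> complex"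
  assumes b: "b \<le> m" and h: "h1 \<in> harmonic_polys k" "h2 \<in> harmonic_polys l"
    and w: "2 * l + 4 * b + CARD('q) = 2 * k + CARD('p) + 2 * m"
  shows "kterm h1 h2 0 b (PsiF (kappa TYPE('p) k)) \<in> hw_space m"
proof -
  let ?f = "kterm h1 h2 0 b (PsiF (kappa TYPE('p) k))"
  have n: "?f \<in> nice" by (rule nice_kterm[OF h]) simp
  have E: "?f \<in> space_E"
    unfolding space_E_eq using h kappa_nonpos by (intro cfun.span_base) blast
  have H: "sl2_H ?f = cscale (of_nat m) ?f"
    unfolding kterm_H[OF h entire_Psi_kappa] using w by (simp only: wt_iff[symmetric])
  have Xp: "sl2_Xp ?f = 0" by (rule kterm_Psi_Xp[OF h])
  \<comment> \<open>b steps bring the exponent of \<open>rho_y\<close> to 0; the remaining m + 1 - b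
    steps, at least one, raise that of \<open>rho_x\<close>.\<close>
  have s: "Suc m = Suc (m - b) + b" using b by simp
  obtain g' where g': "entire g'" "(sl2_Xm ^^ Suc m) ?f = kterm h1 h2 (Suc (m - b)) 0 g'"
    using kterm_Xm_power_high[OF h entire_Psi_kappa, of "Suc (m - b)" b k] unfolding s[symmetric] by blast
  have "sl2_Xp ((sl2_Xm ^^ Suc m) ?f) = 0"
    unfolding sl2_string(2)[OF n H Xp] by simp
  then have "(sl2_Xm ^^ Suc m) ?f = 0"
    unfolding g'(2) by (rule block_Xp_0_pos[OF kterm_in_block[OF h g'(1)]])
  then show ?thesis using E H Xp unfolding hw_space_def by blast
qed

lemma MK_hw: "MK m K \<subseteq> hw_space m"
  unfolding MK_def
proof (rule cfun.span_minimal[OF _ hw_space_subspace])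
  show "(gens m K :: ('a, 'b) funs set) \<subseteq> hw_space m"
    unfolding gens_def using kterm_hw by blast
qed

text \<open>X^+ and (X^-)^(m+1) shift all weights by a constant, so the images of different
  components stay separated and each component satisfies the conditions on its own. Then X^+ forces
  a = 0 and determines the series, the weight relates k, l and b, and (X^-)^(m+1) bounds b.\<close>

lemma hw_MK:
  fixes f :: "('p::finite, 'q::finite) funs"
  assumes pq: "CARD('p) \<ge> 2" "CARD('q) \<ge> 2" and f: "f \<in> hw_space m"
  shows "\<exists>K. f \<in> MK m K"
proof -
  have fE: "f \<in> space_E" and fH: "sl2_H f = cscale (of_nat m) f" and fp: "sl2_Xp f = 0"
    and fm: "(sl2_Xm ^^ Suc m) f = 0" using f unfolding hw_space_def by blast+
  obtain I F where IF: "block_decomp f I F" using space_E_decomp[OF fE] by blast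
  note I = block_decompD[OF IF]
  define c where "c = (\<lambda>(k, l :: nat, a :: nat, b :: nat). cas_val TYPE('p) k)"
  define d where "d = (\<lambda>(k :: nat, l, a :: nat, b :: nat). cas_val TYPE('q) l)"
  define \<mu> where "\<mu> = (\<lambda>(k, l, a, b). wt TYPE('p) TYPE('q) k l a b)"
  have J: "F i \<in> joint_eigen (c i) (d i) (\<mu> i)" if "i \<in> I" for i
    using block_joint_eigen I(3)[OF that] by (cases i) (simp add: block_at_def c_def d_def \<mu>_def)
  note n = joint_eigenD(1)[OF J]
  have inj: "inj_on (\<lambda>i. (c i, d i, \<mu> i)) I"
  proof (rule inj_onI)
    fix i j assume ij: "i \<in> I" "j \<in> I" "(c i, d i, \<mu> i) = (c j, d j, \<mu> j)"
    obtain k l a b where i: "i = (k, l, a, b)" by (cases i)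
    obtain k' l' a' b' where j: "j = (k', l', a', b')" by (cases j)
    have "a = 0 \<or> b = 0" "a' = 0 \<or> b' = 0" using ij(1,2) I(2) i j by (auto simp: keys_def)
    then show "i = j" unfolding i j
      by (rule key_inj[OF pq]) (use ij(3) i j in \<open>simp_all add: c_def d_def \<mu>_def\<close>)
  qed
  have inj2: "inj_on (\<lambda>i. (c i, d i, \<mu> i + e)) I" for e
    using inj by (auto simp: inj_on_def)
  have Xp0: "sl2_Xp (F i) = 0" if "i \<in> I" for i
  proof (rule joint_eigen_separate[OF I(1) _ _ inj2[of 2] that])
    show "sl2_Xp (F i) \<in> joint_eigen (c i) (d i) (\<mu> i + 2)" if "i \<in> I" for i by (rule joint_eigen_Xp[OF J[OF that]])
    have "sl2_Xp (\<Sum>i\<in>I. F i) = (\<Sum>i\<in>I. sl2_Xp (F i))"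
      by (rule lin_on_sum[OF lin_on_sl2(2) nice_subspace n])
    with fp show "(\<Sum>i\<in>I. sl2_Xp (F i)) = 0" unfolding I(4)[symmetric] by (rule trans[OF sym, rotated])
  qed
  have Xm0: "(sl2_Xm ^^ Suc m) (F i) = 0" if "i \<in> I" for i
  proof (rule joint_eigen_separate[OF I(1) _ _ inj2[of "- 2 * of_nat (Suc m)"] that])
    show "(sl2_Xm ^^ Suc m) (F i) \<in> joint_eigen (c i) (d i) (\<mu> i + - 2 * of_nat (Suc m))" if "i \<in> I" for i
      using joint_eigen_Xm_power[OF J[OF that], of "Suc m"] by (simp only: diff_conv_add_uminus mult_minus_left)
    have "(sl2_Xm ^^ Suc m) (\<Sum>i\<in>I. F i) = (\<Sum>i\<in>I. (sl2_Xm ^^ Suc m) (F i))"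
      by (rule lin_on_sum[OF lin_on_Xm_power nice_subspace n])
    with fm show "(\<Sum>i\<in>I. (sl2_Xm ^^ Suc m) (F i)) = 0"
      unfolding I(4)[symmetric] by (rule trans[OF sym, rotated])
  qed
  \<comment> \<open>H f = m f says that the sum of the (\<mu>_i - m) F_i vanishes, and this sum is
    separated.\<close>
  have wt0: "cscale (\<mu> i - of_nat m) (F i) = 0" if "i \<in> I" for i
  proof (rule joint_eigen_separate[OF I(1) _ _ inj that])
    show "cscale (\<mu> i - of_nat m) (F i) \<in> joint_eigen (c i) (d i) (\<mu> i)" if "i \<in> I" for i
      by (rule cfun.subspace_scale[OF joint_eigen_subspace J[OF that]])
    have "sl2_H (\<Sum>i\<in>I. F i) = (\<Sum>i\<in>I. sl2_H (F i))"
      by (rule lin_on_sum[OF lin_on_sl2(1) nice_subspace n])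
    also have "\<dots> = (\<Sum>i\<in>I. cscale (\<mu> i) (F i))" by (rule sum.cong[OF refl joint_eigenD(4)[OF J]])
    finally have "sl2_H f = (\<Sum>i\<in>I. cscale (\<mu> i) (F i))" unfolding I(4)[symmetric] .
    moreover have "cscale (of_nat m) f = (\<Sum>i\<in>I. cscale (of_nat m) (F i))"
      unfolding I(4) by (rule cfun.scale_sum_right)
    ultimately have "(\<Sum>i\<in>I. cscale (\<mu> i) (F i)) - (\<Sum>i\<in>I. cscale (of_nat m) (F i)) = 0" using fH by simp
    then show "(\<Sum>i\<in>I. cscale (\<mu> i - of_nat m) (F i)) = 0"
      by (simp only: cfun.scale_left_diff_distrib sum_subtractf)
  qed
  have mem: "F i \<in> MK m (fst i)" if i: "i \<in> I" for i
  proof (cases "F i = 0")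
    case True
    show ?thesis unfolding True by (rule cfun.subspace_0[OF MK_subspace])
  next
    case False
    obtain k l a b where ii: "i = (k, l, a, b)" by (cases i)
    have Fb: "F i \<in> block k l a b" using I(3)[OF i] by (simp add: ii block_at_def)
    have a: "a = 0"
    proof (cases a)
      case (Suc a')
      then show ?thesis using block_Xp_0_pos[of "F i" k l a' b] Fb Xp0[OF i] False by simp
    qed
    have "\<mu> i = of_nat m" using wt0[OF i] False by (simp only: cfun.scale_eq_0_iff right_minus_eq) simp
    then have w: "2 * l + 4 * b + CARD('q) = 2 * k + CARD('p) + 2 * m"
      unfolding \<mu>_def ii a by (simp only: prod.case wt_iff)
    obtain e where e: "F i = block_sum k l 0 b (\<lambda>h1 h2. fps_const (e h1 h2) * PsiF (kappa TYPE('p) k))"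
      using block_Xp_0_zero[OF Fb[unfolded a] Xp0[OF i]] by blast
    have b: "b \<le> m"
    proof (rule ccontr)
      assume "\<not> b \<le> m"
      then have "b \<ge> Suc m" by simp
      then have "F i = 0" unfolding e by (rule block_Xm_power_0[OF _ Xm0[OF i, unfolded e]])
      then show False using False by simp
    qed
    show ?thesis unfolding e block_sum_def
    proof (intro cfun.subspace_sum MK_subspace)
      fix h1 :: "real^'p \<Rightarrow> complex" and h2 :: "real^'q \<Rightarrow> complex"
      assume h: "h1 \<in> hbasis k" "h2 \<in> hbasis l"
      show "kterm h1 h2 0 b (fps_const (e h1 h2) * PsiF (kappa TYPE('p) k)) \<in> MK m (fst i)"
        unfolding kterm_cmult[OF entire_Psi_kappa]
        by (intro cfun.subspace_scale[OF MK_subspace] kterm_in_MK[OF _ b hbasis_harm[OF h(1)] hbasis_harm[OF h(2)] w])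
          (simp add: ii)
    qed
  qed
  \<comment> \<open>The sum of all degrees k serves as a common upper bound.\<close>
  have "F i \<in> MK m (\<Sum>i\<in>I. fst i)" if "i \<in> I" for i
  proof -
    have "fst i \<le> (\<Sum>i\<in>I. fst i)" using member_le_sum[OF that, of fst] I(1) by simp
    then show ?thesis using mem[OF that] MK_mono by blast
  qed
  then have "f \<in> MK m (\<Sum>i\<in>I. fst i)" unfolding I(4) by (rule cfun.subspace_sum[OF MK_subspace])
  then show ?thesis by blast
qed

lemma M_plus_eq_MK:
  assumes "CARD('p::finite) \<ge> 2" "CARD('q::finite) \<ge> 2"
  shows "(M_plus m :: ('p, 'q) funs set) = (\<Union>K. MK m K)"
  unfolding M_plus_eq
proof (intro set_eqI iffI)
  fix f :: "('p, 'q) funs" assume "f \<in> hw_space m"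
  from hw_MK[OF assms this] show "f \<in> (\<Union>K. MK m K)" by simp
next
  fix f :: "('p, 'q) funs" assume "f \<in> (\<Union>K. MK m K)"
  then show "f \<in> hw_space m" using subsetD[OF MK_hw] by blast
qed

section \<open>The action of the Lie algebra\<close>

text \<open>The noncompact root vectors up to the factor \<i>; the compact ones act by
  \<open>Rot\<close>.\<close>

definition Qop :: "'p::finite \<Rightarrow> 'q::finite \<Rightarrow> ('p, 'q) funs \<Rightarrow> ('p, 'q) funs" where
  "Qop i j f = xx.X i * (yy.X j * f) + xx.D i (yy.D j f)"

lemma pi_act_eq:
  "pi_act A f = (\<Sum>i\<in>UNIV. \<Sum>j\<in>UNIV. cscale (A $ Inl i $ Inl j / 2) (xx.Rot i j f))
    + (\<Sum>i\<in>UNIV. \<Sum>j\<in>UNIV. cscale (A $ Inr i $ Inr j / 2) (yy.Rot i j f))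
    + (\<Sum>i\<in>UNIV. \<Sum>j\<in>UNIV. cscale (A $ Inl i $ Inr j * \<i>) (Qop i j f))"
  by (rule ext) (simp add: pi_act_def defs_xy xx.Rot_def yy.Rot_def Qop_def cscale_def algebra_simps)

lemma lin_on_add:
  assumes T: "lin_on S T" and U: "lin_on S U"
  shows "lin_on S (\<lambda>f. T f + U f)"
proof (rule lin_onI)
  fix f g assume fg: "f \<in> S" "g \<in> S"
  show "T (f + g) + U (f + g) = (T f + U f) + (T g + U g)"
    unfolding lin_onD(1)[OF T fg] lin_onD(1)[OF U fg] by (simp only: add_ac)
next
  fix f c assume f: "f \<in> S"
  show "T (cscale c f) + U (cscale c f) = cscale c (T f + U f)"
    unfolding lin_onD(2)[OF T f] lin_onD(2)[OF U f] cscale_add_right ..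
qed

lemma lin_on_scale:
  assumes T: "lin_on S T"
  shows "lin_on S (\<lambda>f. cscale d (T f))"
proof (rule lin_onI)
  fix f g assume fg: "f \<in> S" "g \<in> S"
  show "cscale d (T (f + g)) = cscale d (T f) + cscale d (T g)"
    unfolding lin_onD(1)[OF T fg] cscale_add_right ..
next
  fix f c assume f: "f \<in> S"
  show "cscale d (T (cscale c f)) = cscale c (cscale d (T f))"
    unfolding lin_onD(2)[OF T f] cfun.scale_scale by (simp only: mult.commute)
qed

lemma lin_on_sum_ops:
  assumes T: "\<And>i. lin_on S (T i)"
  shows "lin_on S (\<lambda>f. \<Sum>i\<in>I. T i f)"
proof (rule lin_onI)
  fix f g assume fg: "f \<in> S" "g \<in> S"
  show "(\<Sum>i\<in>I. T i (f + g)) = (\<Sum>i\<in>I. T i f) + (\<Sum>i\<in>I. T i g)"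
    unfolding lin_onD(1)[OF T fg] sum.distrib ..
next
  fix f c assume f: "f \<in> S"
  show "(\<Sum>i\<in>I. T i (cscale c f)) = cscale c (\<Sum>i\<in>I. T i f)"
    unfolding lin_onD(2)[OF T f] cfun.scale_sum_right ..
qed

lemma lin_on_Qop: "lin_on nice (Qop i j)"
  by (rule lin_onI)
    (simp_all add: Qop_def yy.D_add yy.D_cscale xx.D_add xx.D_cscale mult_cscale cscale_add_right algebra_simps)

lemma lin_on_Rot: "lin_on nice (xx.Rot i j)" "lin_on nice (yy.Rot i' j')"
  by (rule lin_onI; simp add: xx.Rot_add yy.Rot_add cscale_eq xx.Rot_cst_mult yy.Rot_cst_mult)+

lemma lin_on_pi: "lin_on nice (pi_act A)"
  unfolding pi_act_eq[abs_def]
  by (intro lin_on_add lin_on_sum_ops lin_on_scale lin_on_Qop lin_on_Rot)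

lemma nice_Qop [simp, intro]: "f \<in> nice \<Longrightarrow> Qop i j f \<in> nice"
  by (simp add: Qop_def)

lemma nice_pi: "f \<in> nice \<Longrightarrow> pi_act A f \<in> nice"
  unfolding pi_act_eq by (intro nice_add nice_sum nice_cscale) auto

lemma pi_act_Xminus': "pi_act (Xminus i j) f = cscale \<i> (Qop i j f)"
  unfolding pi_act_Xminus by (simp add: fun_eq_iff cscale_def Qop_def defs_xy)

lemma kappa_Suc: "kappa TYPE('n::finite) (Suc k) = kappa TYPE('n) k + 1"
  by (simp add: kappa_def)

text \<open>The \<open>y\<close>-gradient of a radial function divided by \<open>y\<close>. For \<open>b = 0\<close> the factor \<open>w\<close> of \<open>theta 0 g\<close>
  supplies the missing \<open>\<rho>\<^sub>y\<close> and leaves a \<open>\<rho>\<^sub>x\<close>.\<close>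

definition phi_y :: "nat \<Rightarrow> complex fps \<Rightarrow> ('p::finite, 'q::finite) funs" where
  "phi_y b g = (if b = 0 then rad 1 0 (fps_deriv g) else rad 0 (b - 1) (theta b g))"

lemma D_phi_y: "entire g \<Longrightarrow> yy.D j (rad 0 b g) = yy.X j * phi_y b g"
  by (cases b) (simp_all add: phi_y_def D_rad)

lemma PsiF_kappa_deriv:
  "fps_deriv (PsiF (kappa TYPE('p::finite) k)) = fps_const (- 1 / kappa TYPE('p) k) * PsiF (kappa TYPE('p) (Suc k))"
  unfolding kappa_Suc by (rule PsiF_deriv[OF kappa_nonpos])

lemma PsiF_kappa_shift:
  "PsiF (kappa TYPE('p::finite) k) = PsiF (kappa TYPE('p) (Suc k))
    + fps_const (1 / kappa TYPE('p) k) * (fps_X * fps_deriv (PsiF (kappa TYPE('p) (Suc k))))"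
  unfolding kappa_Suc by (rule PsiF_shift[OF kappa_nonpos])

text \<open>The coefficient with which a noncompact root vector leads from (k, l, b) to (k + 1, l +
  1, b); see \<open>Qop_kterm_split\<close>.\<close>

definition raise_coeff :: "'p::finite itself \<Rightarrow> nat \<Rightarrow> nat \<Rightarrow> complex" where
  "raise_coeff _ k b = (kappa TYPE('p) k - 1 - of_nat b) / kappa TYPE('p) k"

lemma kappa_neq_0 [simp]: "kappa TYPE('p::finite) k \<noteq> 0"
  using kappa_nz[of k 0, where 'n = 'p] by simp

text \<open>By the contiguity relation the terms with the derivative of the series cancel, and 1 -
  (b + 1) / \<kappa> remains.\<close>

lemma rad_up:
  "rad 0 b (PsiF (kappa TYPE('p::finite) k)) + cscale (- 1 / kappa TYPE('p) k) (rad 0 b (theta (Suc b) (PsiF (kappa TYPE('p) (Suc k)))))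
    = cscale (raise_coeff TYPE('p) k b) (rad 0 b (PsiF (kappa TYPE('p) (Suc k))) :: ('p, 'q::finite) funs)"
proof -
  have "fps_nth (PsiF (kappa TYPE('p) k) + fps_const (- 1 / kappa TYPE('p) k) * theta (Suc b) (PsiF (kappa TYPE('p) (Suc k)))) n
      = fps_nth (fps_const (raise_coeff TYPE('p) k b) * PsiF (kappa TYPE('p) (Suc k))) n" for n
    unfolding PsiF_kappa_shift[of k]
    by (cases n) (simp_all add: raise_coeff_def field_simps)
  then have "PsiF (kappa TYPE('p) k) + fps_const (- 1 / kappa TYPE('p) k) * theta (Suc b) (PsiF (kappa TYPE('p) (Suc k)))
      = fps_const (raise_coeff TYPE('p) k b) * PsiF (kappa TYPE('p) (Suc k))" by (rule fps_ext)
  then have "rad 0 b (PsiF (kappa TYPE('p) k) + fps_const (- 1 / kappa TYPE('p) k) * theta (Suc b) (PsiF (kappa TYPE('p) (Suc k))))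
      = (rad 0 b (fps_const (raise_coeff TYPE('p) k b) * PsiF (kappa TYPE('p) (Suc k))) :: ('p, 'q) funs)" by (rule arg_cong)
  then show ?thesis
    by (simp only: rad_add rad_cmult entire_Psi_kappa entire_theta entire_mult fps_conv_radius_const)
qed

text \<open>The four terms record whether the x- and the y-derivative fall on the harmonic or on the
  radial factor. Multiplication by x_i y_j merges with the purely radial one through
  \<open>rad_up\<close>.\<close>

lemma Qop_kterm:
  fixes h1 :: "real^'p::finite \<Rightarrow> complex" and h2 :: "real^'q::finite \<Rightarrow> complex"
  assumes h: "h1 \<in> harmonic_polys k" "h2 \<in> harmonic_polys l"
  shows "Qop i j (kterm h1 h2 0 b (PsiF (kappa TYPE('p) k))) =
      lx (pl.D i h1) * (ly (pl.D j h2) * rad 0 b (PsiF (kappa TYPE('p) k)))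
    + lx (pl.D i h1) * ((yy.X j * ly h2) * phi_y b (PsiF (kappa TYPE('p) k)))
    + (xx.X i * lx h1) * (ly (pl.D j h2) * cscale (- 1 / kappa TYPE('p) k) (rad 0 (Suc b) (PsiF (kappa TYPE('p) (Suc k)))))
    + (xx.X i * lx h1) * ((yy.X j * ly h2) * cscale (raise_coeff TYPE('p) k b) (rad 0 b (PsiF (kappa TYPE('p) (Suc k)))))"
proof -
  let ?P = "PsiF (kappa TYPE('p) k)" and ?Q = "PsiF (kappa TYPE('p) (Suc k))"
  define c where "c = - 1 / kappa TYPE('p) k"
  have n: "h1 \<in> nice" "h2 \<in> nice" "pl.D i h1 \<in> nice" "pl.D j h2 \<in> nice"
    using nice_harm[OF h(1)] nice_harm[OF h(2)] by auto
  let ?f = "kterm h1 h2 0 b ?P"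
  have fn: "?f \<in> nice" by (rule nice_kterm[OF h entire_Psi_kappa])
  have du: "xx.D i (rad 0 b ?P) = xx.X i * cscale c (rad 0 (Suc b) ?Q)"
    unfolding D_rad(1)[OF entire_Psi_kappa] PsiF_kappa_deriv c_def by (simp only: rad_cmult entire_Psi_kappa)
  have x: "xx.D i ?f = lx (pl.D i h1) * ly h2 * rad 0 b ?P + lx h1 * ly h2 * (xx.X i * cscale c (rad 0 (Suc b) ?Q))"
    unfolding kterm_def using n by (simp add: xx.D_mult D_lx D_ly du)
  have y: "yy.D j (xx.D i ?f) = lx (pl.D i h1) * (ly (pl.D j h2) * rad 0 b ?P + ly h2 * (yy.X j * phi_y b ?P))
      + lx h1 * (ly (pl.D j h2) * (xx.X i * cscale c (rad 0 (Suc b) ?Q)) + ly h2 * (xx.X i * cscale c (yy.X j * rad 0 b (theta (Suc b) ?Q))))"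
    unfolding x using n by (simp add: yy.D_add yy.D_mult D_lx D_ly cross_X yy.D_cscale D_phi_y D_rad(4) distrib_left mult.assoc)
  have "Qop i j ?f = xx.X i * (yy.X j * ?f) + yy.D j (xx.D i ?f)"
    unfolding Qop_def D_cross[OF fn] ..
  also have "\<dots> = lx (pl.D i h1) * (ly (pl.D j h2) * rad 0 b ?P)
    + lx (pl.D i h1) * ((yy.X j * ly h2) * phi_y b ?P)
    + (xx.X i * lx h1) * (ly (pl.D j h2) * cscale c (rad 0 (Suc b) ?Q))
    + (xx.X i * lx h1) * ((yy.X j * ly h2) * (rad 0 b ?P + cscale c (rad 0 b (theta (Suc b) ?Q))))"
    unfolding y unfolding kterm_def by (rule ext) (simp add: cscale_def algebra_simps)
  finally show ?thesis unfolding c_def rad_up .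
qed

lemma X_up:
  fixes h1 :: "real^'p::finite \<Rightarrow> complex" and h2 :: "real^'q::finite \<Rightarrow> complex"
  shows "xx.X i * lx h1 = lx (harm_up k i h1) + cscale (1 / (kappa TYPE('p) k - 1)) (xx.rho * lx (pl.D i h1))"
    and "yy.X j * ly h2 = ly (harm_up l j h2) + cscale (1 / (kappa TYPE('q) l - 1)) (yy.rho * ly (pl.D j h2))"
  by (simp_all add: harm_up_def l_hom X_lx rho_lx)

lemma raise_coeff_identity: "- 1 / c + 1 / a * ((c - 1 - x) / c) = x * (1 / a * (- 1 / c))"
  if "c - 1 = a" "a \<noteq> 0" for a c x :: complex
proof -
  have "1 / a * ((a - x) / c) = 1 / c - x / (a * c)" using that(2) by (simp add: diff_divide_distrib)
  then show ?thesis unfolding that(1) by simp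
qed

text \<open>Counterpart of \<open>rad_up\<close> for lowering the degree, with \<open>k\<close> the
  target degree: the contiguity relation reassembles the series for k + 1 and k + 2 into that for k.
  For b = 0 the second combination cancels completely.\<close>

lemma rad_down:
  fixes k :: nat
  defines "S \<equiv> \<lambda>b. (rad 0 b (PsiF (kappa TYPE('p::finite) k)) :: ('p, 'q::finite) funs)"
  shows "rad 0 b (PsiF (kappa TYPE('p) (Suc k))) + cscale (1 / kappa TYPE('p) k)
      (xx.rho * cscale (- 1 / kappa TYPE('p) (Suc k)) (rad 0 (Suc b) (PsiF (kappa TYPE('p) (Suc (Suc k)))))) = S b"
    and "phi_y b (PsiF (kappa TYPE('p) (Suc k))) + cscale (1 / kappa TYPE('p) k)
      (xx.rho * cscale (raise_coeff TYPE('p) (Suc k) b) (rad 0 b (PsiF (kappa TYPE('p) (Suc (Suc k))))))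
      = (if b = 0 then 0 else cscale (of_nat b) (S (b - 1)))"
proof -
  let ?a = "kappa TYPE('p) k" and ?b = "kappa TYPE('p) (Suc k)"
  let ?P = "PsiF ?a" and ?Q = "PsiF ?b" and ?R = "PsiF (kappa TYPE('p) (Suc (Suc k)))"
  have b: "?b = ?a + 1" by (rule kappa_Suc)
  have sh: "?P = ?Q + fps_const (1 / ?a) * (fps_X * (fps_const (- 1 / ?b) * ?R))"
    using PsiF_kappa_shift[of k, where 'p = 'p] unfolding PsiF_kappa_deriv .
  have S: "S b = rad 0 b ?Q + cscale (1 / ?a) (cscale (- 1 / ?b) (rad 1 (Suc b) ?R))" for b
  proof -
    have "S b = rad 0 b (?Q + fps_const (1 / ?a) * (fps_const (- 1 / ?b) * (fps_X * ?R)))"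
      unfolding S_def sh by (simp only: mult.left_commute)
    also have "\<dots> = rad 0 b ?Q + cscale (1 / ?a) (cscale (- 1 / ?b) (rad 1 (Suc b) ?R))"
      by (simp only: rad_add rad_cmult rad_X_mult entire_Psi_kappa entire_mult fps_conv_radius_const fps_conv_radius_fps_X One_nat_def)
    finally show ?thesis .
  qed
  show "rad 0 b ?Q + cscale (1 / ?a) (xx.rho * cscale (- 1 / ?b) (rad 0 (Suc b) ?R)) = S b"
    unfolding S mult_cscale rho_rad by simp
  show "phi_y b ?Q + cscale (1 / ?a) (xx.rho * cscale (raise_coeff TYPE('p) (Suc k) b) (rad 0 b ?R))
      = (if b = 0 then 0 else cscale (of_nat b) (S (b - 1)))"
  proof (cases b)
    case 0
    have u: "raise_coeff TYPE('p) (Suc k) 0 = ?a / ?b" unfolding raise_coeff_def b by simp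
    have A: "phi_y 0 ?Q = (cscale (- 1 / ?b) (rad 1 0 ?R) :: ('p, 'q) funs)"
      unfolding phi_y_def PsiF_kappa_deriv by (simp only: rad_cmult entire_Psi_kappa) simp
    have B: "cscale (1 / ?a) (xx.rho * cscale (raise_coeff TYPE('p) (Suc k) 0) (rad 0 0 ?R)) = (cscale (1 / ?b) (rad 1 0 ?R) :: ('p, 'q) funs)"
      unfolding u mult_cscale rho_rad by simp
    show ?thesis unfolding 0 A B by (simp add: cscale_def fun_eq_iff)
  next
    case (Suc b')
    have th: "theta b ?Q = fps_const (of_nat b) * ?Q + fps_const (- 1 / ?b) * (fps_X * ?R)"
      unfolding theta_def PsiF_kappa_deriv by (simp only: mult.left_commute)
    have A: "phi_y b ?Q = (cscale (of_nat b) (rad 0 b' ?Q) + cscale (- 1 / ?b) (rad 1 b ?R) :: ('p, 'q) funs)"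
      unfolding phi_y_def th using Suc
      by (simp add: rad_add rad_cmult rad_X_mult)
    have B: "cscale (1 / ?a) (xx.rho * cscale (raise_coeff TYPE('p) (Suc k) b) (rad 0 b ?R))
        = (cscale (1 / ?a * raise_coeff TYPE('p) (Suc k) b) (rad 1 b ?R) :: ('p, 'q) funs)"
      unfolding mult_cscale rho_rad by simp
    have "- 1 / ?b + 1 / ?a * raise_coeff TYPE('p) (Suc k) b = of_nat b * (1 / ?a * (- 1 / ?b))"
      unfolding raise_coeff_def by (rule raise_coeff_identity) (use b in simp_all)
    then have C: "cscale (- 1 / ?b) r + cscale (1 / ?a * raise_coeff TYPE('p) (Suc k) b) r = cscale (of_nat b * (1 / ?a * (- 1 / ?b))) r"
      for r :: "('p, 'q) funs"
      by (simp only: cfun.scale_left_distrib[symmetric])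
    have "(phi_y b ?Q :: ('p, 'q) funs) + cscale (1 / ?a) (xx.rho * cscale (raise_coeff TYPE('p) (Suc k) b) (rad 0 b ?R))
        = cscale (of_nat b) (rad 0 b' ?Q) + cscale (of_nat b * (1 / ?a * (- 1 / ?b))) (rad 1 b ?R)"
      unfolding A B add.assoc C ..
    also have "\<dots> = cscale (of_nat b) (S b')"
      unfolding S Suc by (simp only: cscale_add_right cfun.scale_scale)
    finally show ?thesis using Suc by simp
  qed
qed

text \<open>The rearrangement behind \<open>Qop_kterm_split\<close>: \<open>d\<close> and
  \<open>e\<close> stand for derivatives of the harmonic factors, \<open>J\<close> and
  \<open>J'\<close> for their raised components, \<open>r\<close> and \<open>r'\<close> for
  \<open>rho_x\<close> and \<open>rho_y\<close>, and \<open>f\<close>, \<open>g\<close>,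
  \<open>R\<close> for radial functions.\<close>

lemma up_down_identity:
  fixes d e f g J J' r r' R :: "'a \<Rightarrow> complex"
  shows "d * (e * f) + d * ((J' + cscale t (r' * e)) * g) + (J + cscale s (r * d)) * (e * cscale c (r' * R))
      + (J + cscale s (r * d)) * ((J' + cscale t (r' * e)) * cscale u R)
    = cscale u (J * J' * R) + cscale (u * t + c) (J * e * (r' * R))
      + d * (e * (f + cscale s (r * cscale c (r' * R))) + (J' + cscale t (r' * e)) * (g + cscale s (r * cscale u R)))"
  by (rule ext) (simp add: cscale_def algebra_simps)

text \<open>Sorted by targets: (k + 1, l + 1, b), then (k + 1, l - 1, b + 1), and a last group that
  \<open>rad_down\<close> turns into (k - 1, l - 1, b) and (k - 1, l + 1, b - 1).\<close>

lemma Qop_kterm_split: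
  fixes h1 :: "real^'p::finite \<Rightarrow> complex" and h2 :: "real^'q::finite \<Rightarrow> complex"
  assumes h: "h1 \<in> harmonic_polys k" "h2 \<in> harmonic_polys l"
  shows "Qop i j (kterm h1 h2 0 b (PsiF (kappa TYPE('p) k))) =
      cscale (raise_coeff TYPE('p) k b) (kterm (harm_up k i h1) (harm_up l j h2) 0 b (PsiF (kappa TYPE('p) (Suc k))))
    + cscale (raise_coeff TYPE('p) k b / (kappa TYPE('q) l - 1) - 1 / kappa TYPE('p) k)
        (kterm (harm_up k i h1) (pl.D j h2) 0 (Suc b) (PsiF (kappa TYPE('p) (Suc k))))
    + lx (pl.D i h1) * (ly (pl.D j h2) * (rad 0 b (PsiF (kappa TYPE('p) k)) + cscale (1 / (kappa TYPE('p) k - 1))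
          (xx.rho * cscale (- 1 / kappa TYPE('p) k) (rad 0 (Suc b) (PsiF (kappa TYPE('p) (Suc k))))))
      + (yy.X j * ly h2) * (phi_y b (PsiF (kappa TYPE('p) k)) + cscale (1 / (kappa TYPE('p) k - 1))
          (xx.rho * cscale (raise_coeff TYPE('p) k b) (rad 0 b (PsiF (kappa TYPE('p) (Suc k)))))))"
proof -
  have r: "rad 0 (Suc b) g = yy.rho * rad 0 b g" for g by (rule rho_rad(2)[symmetric])
  have c: "raise_coeff TYPE('p) k b / (kappa TYPE('q) l - 1) - 1 / kappa TYPE('p) k
      = raise_coeff TYPE('p) k b * (1 / (kappa TYPE('q) l - 1)) + - 1 / kappa TYPE('p) k" by simp
  show ?thesis
    unfolding Qop_kterm[OF h] unfolding X_up(1)[of i h1 k] X_up(2)[of j h2 l] kterm_def r c by (rule up_down_identity)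
qed

text \<open>All targets satisfy the weight relation; the point is that b stays between 0 and m and
  no degree becomes negative. In degree 0 the derivatives vanish, for b = 0 the term with b - 1 is
  absent, and for b = m the coefficient of the term with b + 1 is 0.\<close>

lemma Qop_gen:
  fixes h1 :: "real^'p::finite \<Rightarrow> complex" and h2 :: "real^'q::finite \<Rightarrow> complex"
  assumes h: "h1 \<in> harmonic_polys k" "h2 \<in> harmonic_polys l" and k: "k \<le> K" and b: "b \<le> m"
    and w: "2 * l + 4 * b + CARD('q) = 2 * k + CARD('p) + 2 * m"
  shows "Qop i j (kterm h1 h2 0 b (PsiF (kappa TYPE('p) k))) \<in> MK m (Suc K)"
proof -
  have T1: "kterm (harm_up k i h1) (harm_up l j h2) 0 b (PsiF (kappa TYPE('p) (Suc k))) \<in> MK m (Suc K)"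
    by (rule kterm_in_MK[OF _ b harm_up[OF h(1)] harm_up[OF h(2)]]) (use k w in auto)
  have T2: "cscale (raise_coeff TYPE('p) k b / (kappa TYPE('q) l - 1) - 1 / kappa TYPE('p) k)
      (kterm (harm_up k i h1) (pl.D j h2) 0 (Suc b) (PsiF (kappa TYPE('p) (Suc k)))) \<in> MK m (Suc K)"
  proof (cases l)
    case 0
    then have "pl.D j h2 = 0" using h(2) harm_D_0 by blast
    then show ?thesis by (simp add: kterm_lin cfun.subspace_0[OF MK_subspace])
  next
    case (Suc l')
    show ?thesis
    proof (cases "b = m")
      case True
      \<comment> \<open>For b = m the weight relation says that \<kappa> for k equals \<kappa> for l
        plus m; then \<open>raise_coeff\<close> is (\<kappa>_l - 1) / \<kappa>_k and the two parts
        of the coefficient cancel.\<close>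
      have "complex_of_nat (2 * l + 2 * m + CARD('q)) = of_nat (2 * k + CARD('p))"
        using w True by (intro arg_cong[where f = of_nat]) simp
      then have kl: "kappa TYPE('p) k = kappa TYPE('q) l + of_nat m" by (simp add: kappa_def field_simps)
      have l1: "kappa TYPE('q) l - 1 \<noteq> 0" unfolding Suc kappa_Suc by simp
      have u: "raise_coeff TYPE('p) k b = (kappa TYPE('q) l - 1) / kappa TYPE('p) k"
        unfolding raise_coeff_def using kl True by simp
      have "raise_coeff TYPE('p) k b / (kappa TYPE('q) l - 1) - 1 / kappa TYPE('p) k = 0"
        unfolding u using l1 by simp
      then show ?thesis by (simp add: cfun.subspace_0[OF MK_subspace])
    next
      case False
      show ?thesis
        by (rule cfun.subspace_scale[OF MK_subspace], rule kterm_in_MK[OF _ _ harm_up[OF h(1)] harm_D_Suc[OF h(2)[unfolded Suc]]])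
          (use k b w False Suc in auto)
    qed
  qed
  have T3: "lx (pl.D i h1) * (ly (pl.D j h2) * (rad 0 b (PsiF (kappa TYPE('p) k)) + cscale (1 / (kappa TYPE('p) k - 1))
          (xx.rho * cscale (- 1 / kappa TYPE('p) k) (rad 0 (Suc b) (PsiF (kappa TYPE('p) (Suc k))))))
      + (yy.X j * ly h2) * (phi_y b (PsiF (kappa TYPE('p) k)) + cscale (1 / (kappa TYPE('p) k - 1))
          (xx.rho * cscale (raise_coeff TYPE('p) k b) (rad 0 b (PsiF (kappa TYPE('p) (Suc k)))))))
      \<in> MK m (Suc K)" (is "?T \<in> _")
  proof (cases k)
    case 0
    then have "pl.D i h1 = 0" using h(1) harm_D_0 by blast
    then have "lx (pl.D i h1) = (0 :: ('p, 'q) funs)" by (simp add: l_hom)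
    then show ?thesis by (simp only: mult_zero_left cfun.subspace_0[OF MK_subspace])
  next
    case (Suc k')
    let ?P = "PsiF (kappa TYPE('p) k')"
    have D: "pl.D i h1 \<in> harmonic_polys k'" using harm_D_Suc h(1) Suc by blast
    let ?V = "if b = 0 then 0 else cscale (of_nat b) (rad 0 (b - 1) ?P) :: ('p, 'q) funs"
    have k1: "kappa TYPE('p) k - 1 = kappa TYPE('p) k'" unfolding Suc kappa_Suc by simp
    have T: "?T = lx (pl.D i h1) * (ly (pl.D j h2) * rad 0 b ?P + (yy.X j * ly h2) * ?V)"
      unfolding k1 unfolding Suc rad_down ..
    have V: "yy.rho * ?V = cscale (of_nat b) (rad 0 b ?P)"
      by (cases b) (simp_all add: mult_cscale rho_rad)
    have "?T = cscale (1 + of_nat b / (kappa TYPE('q) l - 1)) (kterm (pl.D i h1) (pl.D j h2) 0 b ?P)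
        + lx (pl.D i h1) * (ly (harm_up l j h2) * ?V)"
    proof -
      \<comment> \<open>y_j h2 is split into its harmonic part and a multiple of
        \<open>rho_y\<close>; the latter restores the exponent that \<open>?V\<close> lacks.\<close>
      have "(yy.X j * ly h2) * ?V = ly (harm_up l j h2) * ?V
          + cscale (1 / (kappa TYPE('q) l - 1)) (ly (pl.D j h2) * (yy.rho * ?V))"
        unfolding X_up(2)[of j h2 l] distrib_right mult_cscale by (simp only: mult_ac)
      then show ?thesis unfolding T V kterm_def
        by (simp only:) (rule ext, simp add: cscale_def algebra_simps)
    qed
    moreover have "cscale (1 + of_nat b / (kappa TYPE('q) l - 1)) (kterm (pl.D i h1) (pl.D j h2) 0 b ?P) \<in> MK m (Suc K)"
    proof (cases l)
      case 0
      then have "pl.D j h2 = 0" using h(2) harm_D_0 by blast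
      then show ?thesis by (simp add: kterm_lin cfun.subspace_0[OF MK_subspace])
    next
      case l: (Suc l')
      show ?thesis
        by (rule cfun.subspace_scale[OF MK_subspace], rule kterm_in_MK[OF _ b D harm_D_Suc[OF h(2)[unfolded l]]])
          (use k w Suc l in auto)
    qed
    moreover have "lx (pl.D i h1) * (ly (harm_up l j h2) * ?V) \<in> MK m (Suc K)"
    proof (cases b)
      case 0
      then show ?thesis by (simp add: cfun.subspace_0[OF MK_subspace])
    next
      case b': (Suc b')
      have "lx (pl.D i h1) * (ly (harm_up l j h2) * ?V)
          = cscale (of_nat b) (kterm (pl.D i h1) (harm_up l j h2) 0 b' ?P)"
        unfolding kterm_def b' by (simp add: mult_cscale mult.assoc)
      moreover have "kterm (pl.D i h1) (harm_up l j h2) 0 b' ?P \<in> MK m (Suc K)"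
        by (rule kterm_in_MK[OF _ _ D harm_up[OF h(2)]]) (use k b w Suc b' in auto)
      ultimately show ?thesis by (simp only: cfun.subspace_scale[OF MK_subspace])
    qed
    ultimately show ?thesis by (simp only: cfun.subspace_add[OF MK_subspace])
  qed
  show ?thesis
    unfolding Qop_kterm_split[OF h]
    by (rule cfun.subspace_add[OF MK_subspace cfun.subspace_add[OF MK_subspace cfun.subspace_scale[OF MK_subspace T1] T2] T3])
qed

lemma Rot_kterm:
  fixes h1 :: "real^'p::finite \<Rightarrow> complex" and h2 :: "real^'q::finite \<Rightarrow> complex"
  assumes h: "h1 \<in> harmonic_polys k" "h2 \<in> harmonic_polys l" and g: "entire g"
  shows "xx.Rot i j (kterm h1 h2 a b g) = kterm (pl.Rot i j h1) h2 a b g"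
    and "yy.Rot i' j' (kterm h1 h2 a b g) = kterm h1 (pl.Rot i' j' h2) a b g"
  using nice_harm[OF h(1)] nice_harm[OF h(2)] g
  by (simp_all add: kterm_def xx.Rot_mult yy.Rot_mult Rot_l Rot_rad)

lemma gensE:
  fixes f :: "('p::finite, 'q::finite) funs"
  assumes "f \<in> gens m K"
  obtains h1 h2 k l b where "f = kterm h1 h2 0 b (PsiF (kappa TYPE('p) k))" "k \<le> K" "b \<le> m"
    "h1 \<in> harmonic_polys k" "h2 \<in> harmonic_polys l" "2 * l + 4 * b + CARD('q) = 2 * k + CARD('p) + 2 * m"
  using assms unfolding gens_def by blast

lemma Rot_MK:
  fixes f :: "('p::finite, 'q::finite) funs"
  assumes "f \<in> MK m K"
  shows "xx.Rot i j f \<in> MK m K" "yy.Rot i' j' f \<in> MK m K"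
proof -
  have gen: "xx.Rot i j g \<in> MK m K \<and> yy.Rot i' j' g \<in> MK m K" if "g \<in> gens m K" for g :: "('p, 'q) funs"
    using that
  proof (rule gensE)
    fix h1 :: "real^'p \<Rightarrow> complex" and h2 :: "real^'q \<Rightarrow> complex" and k l b
    assume g: "g = kterm h1 h2 0 b (PsiF (kappa TYPE('p) k))" and kb: "k \<le> K" "b \<le> m"
      and h: "h1 \<in> harmonic_polys k" "h2 \<in> harmonic_polys l" and w: "2 * l + 4 * b + CARD('q) = 2 * k + CARD('p) + 2 * m"
    show ?thesis
      unfolding g Rot_kterm[OF h entire_Psi_kappa]
      by (intro conjI kterm_in_MK[OF kb harm_Rot[OF h(1)] h(2) w] kterm_in_MK[OF kb h(1) harm_Rot[OF h(2)] w])
  qed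
  show "xx.Rot i j f \<in> MK m K"
    by (rule lin_on_image_span[OF lin_on_Rot(1) nice_subspace gens_nice conjunct1[OF gen] MK_subspace assms[unfolded MK_def]])
  show "yy.Rot i' j' f \<in> MK m K"
    by (rule lin_on_image_span[OF lin_on_Rot(2) nice_subspace gens_nice conjunct2[OF gen] MK_subspace assms[unfolded MK_def]])
qed

lemma Qop_MK:
  fixes f :: "('p::finite, 'q::finite) funs"
  assumes "f \<in> MK m K"
  shows "Qop i j f \<in> MK m (Suc K)"
proof (rule lin_on_image_span[OF lin_on_Qop nice_subspace gens_nice _ MK_subspace assms[unfolded MK_def]])
  fix g :: "('p, 'q) funs" assume "g \<in> gens m K"
  then show "Qop i j g \<in> MK m (Suc K)"
  proof (rule gensE)
    fix h1 :: "real^'p \<Rightarrow> complex" and h2 :: "real^'q \<Rightarrow> complex" and k l b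
    assume g: "g = kterm h1 h2 0 b (PsiF (kappa TYPE('p) k))" and kb: "k \<le> K" "b \<le> m"
      and h: "h1 \<in> harmonic_polys k" "h2 \<in> harmonic_polys l" and w: "2 * l + 4 * b + CARD('q) = 2 * k + CARD('p) + 2 * m"
    show ?thesis unfolding g by (rule Qop_gen[OF h kb w])
  qed
qed

lemma pi_MK:
  assumes f: "f \<in> MK m K"
  shows "pi_act A f \<in> MK m (Suc K)"
  unfolding pi_act_eq
  by (intro cfun.subspace_add[OF MK_subspace] cfun.subspace_sum[OF MK_subspace] cfun.subspace_scale[OF MK_subspace]
      Qop_MK[OF f] subsetD[OF MK_mono[of K "Suc K"]] Rot_MK[OF f]) simp_all

lemma double_sum_mult:
  "(\<Sum>i\<in>I. \<Sum>j\<in>J. a i * (b j * c)) = (\<Sum>i\<in>I. a i) * ((\<Sum>j\<in>J. b j) * c)"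
  for c :: "'a \<Rightarrow> complex"
  by (simp only: sum_distrib_left[symmetric] sum_distrib_right[symmetric])

text \<open>Three of the four terms of \<open>Qop_kterm\<close> sum to multiples of \<Delta>h1 or
  \<Delta>h2 and vanish; in the fourth, Euler's relation yields the two degrees.\<close>

lemma Qop_sum:
  fixes h1 :: "real^'p::finite \<Rightarrow> complex" and h2 :: "real^'q::finite \<Rightarrow> complex"
  assumes h: "h1 \<in> harmonic_polys (Suc k)" "h2 \<in> harmonic_polys (Suc l)"
  shows "(\<Sum>i\<in>UNIV. \<Sum>j\<in>UNIV. Qop i j (kterm (pl.D i h1) (pl.D j h2) 0 b (PsiF (kappa TYPE('p) k))))
    = cscale (of_nat (Suc k) * of_nat (Suc l) * raise_coeff TYPE('p) k b) (kterm h1 h2 0 b (PsiF (kappa TYPE('p) (Suc k))))"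
proof -
  have 1: "(\<Sum>i\<in>UNIV. lx (pl.D i (pl.D i h1))) = (0 :: ('p, 'q) funs)"
  proof -
    have "(\<Sum>i\<in>UNIV. lx (pl.D i (pl.D i h1))) = (lx (pl.Lap h1) :: ('p, 'q) funs)"
      by (simp only: pl.Lap_def l_hom)
    then show ?thesis unfolding harm_Lap[OF h(1)] l_hom .
  qed
  have 2: "(\<Sum>j\<in>UNIV. ly (pl.D j (pl.D j h2))) = (0 :: ('p, 'q) funs)"
  proof -
    have "(\<Sum>i\<in>UNIV. ly (pl.D i (pl.D i h2))) = (ly (pl.Lap h2) :: ('p, 'q) funs)"
      by (simp only: pl.Lap_def l_hom)
    then show ?thesis unfolding harm_Lap[OF h(2)] l_hom .
  qed
  have 3: "(\<Sum>i\<in>UNIV. xx.X i * lx (pl.D i h1)) = (cscale (of_nat (Suc k)) (lx h1) :: ('p, 'q) funs)"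
  proof -
    have "(\<Sum>i\<in>UNIV. xx.X i * lx (pl.D i h1)) = (lx (pl.Eul h1) :: ('p, 'q) funs)"
      by (simp only: pl.Eul_def l_hom X_lx)
    then show ?thesis unfolding hp_Eul[OF harm_hp[OF h(1)]] l_hom cscale_eq .
  qed
  have 4: "(\<Sum>j\<in>UNIV. yy.X j * ly (pl.D j h2)) = (cscale (of_nat (Suc l)) (ly h2) :: ('p, 'q) funs)"
  proof -
    have "(\<Sum>i\<in>UNIV. yy.X i * ly (pl.D i h2)) = (ly (pl.Eul h2) :: ('p, 'q) funs)"
      by (simp only: pl.Eul_def l_hom X_lx)
    then show ?thesis unfolding hp_Eul[OF harm_hp[OF h(2)]] l_hom cscale_eq .
  qed
  have "(\<Sum>i\<in>UNIV. \<Sum>j\<in>UNIV. Qop i j (kterm (pl.D i h1) (pl.D j h2) 0 b (PsiF (kappa TYPE('p) k))))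
    = cscale (of_nat (Suc k)) (lx h1) * (cscale (of_nat (Suc l)) (ly h2) * cscale (raise_coeff TYPE('p) k b) (rad 0 b (PsiF (kappa TYPE('p) (Suc k)))))"
    unfolding Qop_kterm[OF harm_D_Suc[OF h(1)] harm_D_Suc[OF h(2)]] sum.distrib double_sum_mult 1 2 3 4 by simp
  also have "\<dots> = cscale (of_nat (Suc k) * of_nat (Suc l) * raise_coeff TYPE('p) k b) (kterm h1 h2 0 b (PsiF (kappa TYPE('p) (Suc k))))"
    unfolding kterm_def by (rule ext) (simp add: cscale_def mult_ac del: of_nat_Suc)
  finally show ?thesis .
qed

section \<open>Elements of the Lie algebra and the filtration by the enveloping algebra\<close>

lemma o_pqI:
  assumes "\<And>a b. A $ b $ a * Ipq $ b $ b + Ipq $ a $ a * A $ a $ b = 0"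
  shows "A \<in> o_pq"
proof -
  have "(transpose A ** Ipq + Ipq ** A) $ a $ b = 0" for a b
  proof -
    have "(transpose A ** Ipq) $ a $ b = (\<Sum>k\<in>UNIV. if k = b then A $ b $ a * Ipq $ b $ b else 0)"
      unfolding matrix_matrix_mult_def transpose_def vec_lambda_beta
      by (rule sum.cong[OF refl]) (simp add: Ipq_def)
    moreover have "(Ipq ** A) $ a $ b = (\<Sum>k\<in>UNIV. if k = a then Ipq $ a $ a * A $ a $ b else 0)"
      unfolding matrix_matrix_mult_def vec_lambda_beta
      by (rule sum.cong[OF refl]) (simp add: Ipq_def)
    ultimately show ?thesis using assms[of b a] by simp
  qed
  then show ?thesis by (simp add: o_pq_def vec_eq_iff)
qed

lemma o_pq_entriesI:
  assumes "\<And>i j. A $ Inl i $ Inl j = - A $ Inl j $ Inl i" "\<And>k l. A $ Inr k $ Inr l = - A $ Inr l $ Inr k"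
    "\<And>i l. A $ Inr l $ Inl i = A $ Inl i $ Inr l"
  shows "A \<in> o_pq"
proof (rule o_pqI)
  fix a b :: "'a + 'b"
  show "A $ b $ a * Ipq $ b $ b + Ipq $ a $ a * A $ a $ b = 0"
  proof (cases a)
    case a: (Inl i)
    show ?thesis
    proof (cases b)
      case (Inl j)
      show ?thesis unfolding a Inl assms(1)[of j i] by (simp add: Ipq_def)
    next
      case (Inr j)
      show ?thesis unfolding a Inr assms(3)[of j i] by (simp add: Ipq_def)
    qed
  next
    case a: (Inr i)
    show ?thesis
    proof (cases b)
      case (Inl j)
      show ?thesis unfolding a Inl assms(3)[of i j] by (simp add: Ipq_def)
    next
      case (Inr j)
      show ?thesis unfolding a Inr assms(2)[of j i] by (simp add: Ipq_def)
    qed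
  qed
qed

lemma lie_gI:
  assumes "\<And>i j. A $ Inl i $ Inl j = - A $ Inl j $ Inl i" "\<And>k l. A $ Inr k $ Inr l = - A $ Inr l $ Inr k"
    "\<And>i l. A $ Inr l $ Inl i = A $ Inl i $ Inr l"
  shows "A \<in> lie_g"
proof -
  have 1: "Re (A $ Inl i $ Inl j) = - Re (A $ Inl j $ Inl i)" "Im (A $ Inl i $ Inl j) = - Im (A $ Inl j $ Inl i)" for i j
    by (subst assms(1), rule uminus_complex.sel)+
  have 2: "Re (A $ Inr i $ Inr j) = - Re (A $ Inr j $ Inr i)" "Im (A $ Inr i $ Inr j) = - Im (A $ Inr j $ Inr i)" for i j
    by (subst assms(2), rule uminus_complex.sel)+
  have "(\<chi> a b. Re (A $ a $ b)) \<in> o_pq"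
    by (rule o_pq_entriesI; unfold vec_lambda_beta) (rule 1 2 arg_cong[OF assms(3)])+
  moreover have "(\<chi> a b. Im (A $ a $ b)) \<in> o_pq"
    by (rule o_pq_entriesI; unfold vec_lambda_beta) (rule 1 2 arg_cong[OF assms(3)])+
  moreover have "A = (\<chi> a b. Complex ((\<chi> a b. Re (A $ a $ b)) $ a $ b) ((\<chi> a b. Im (A $ a $ b)) $ a $ b))"
    by (simp add: vec_eq_iff)
  ultimately show ?thesis unfolding lie_g_def by blast
qed

lemma Xminus_lie: "Xminus i j \<in> lie_g"
  by (rule lie_gI) (auto simp: X_entries)

text \<open>What the comparison of filtrations uses of the action: linear operators that preserve
  \<open>nice\<close>.\<close>

locale nice_action =
  fixes g :: "'g set" and act :: "'g \<Rightarrow> ('a::real_normed_vector \<Rightarrow> complex) \<Rightarrow> 'a \<Rightarrow> complex"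
  assumes lin: "A \<in> g \<Longrightarrow> lin_on nice (act A)"
    and nice_act: "A \<in> g \<Longrightarrow> f \<in> nice \<Longrightarrow> act A f \<in> nice"
begin

lemma nice_foldr: "set As \<subseteq> g \<Longrightarrow> v \<in> nice \<Longrightarrow> foldr act As v \<in> nice"
  by (induction As) (auto intro: nice_act)

lemma U_subspace: "cfun.subspace (U_filt g act n M0)"
  unfolding U_filt_def by (rule cfun.subspace_span)

lemma U_mono: "n \<le> n' \<Longrightarrow> U_filt g act n M0 \<subseteq> U_filt g act n' M0"
  unfolding U_filt_def by (rule cfun.span_mono) force

lemma U_gens_nice: "M0 \<subseteq> nice \<Longrightarrow> {foldr act As v | As v. set As \<subseteq> g \<and> length As \<le> n \<and> v \<in> M0} \<subseteq> nice"
  using nice_foldr by blast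

lemma U_base: "M0 \<subseteq> U_filt g act n M0"
proof
  fix v assume "v \<in> M0"
  then show "v \<in> U_filt g act n M0"
    unfolding U_filt_def by (intro cfun.span_base CollectI exI[of _ "[]"] exI[of _ v]) simp
qed

lemma U_act:
  assumes "M0 \<subseteq> nice" "A \<in> g" "f \<in> U_filt g act n M0"
  shows "act A f \<in> U_filt g act (Suc n) M0"
proof (rule lin_on_image_span[OF lin[OF assms(2)] nice_subspace U_gens_nice[OF assms(1)] _ U_subspace assms(3)[unfolded U_filt_def]])
  fix a assume "a \<in> {foldr act As v | As v. set As \<subseteq> g \<and> length As \<le> n \<and> v \<in> M0}"
  then obtain As v where "a = foldr act As v" "set As \<subseteq> g" "length As \<le> n" "v \<in> M0" by blast
  then show "act A a \<in> U_filt g act (Suc n) M0"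
    unfolding U_filt_def using assms(2)
    by (intro cfun.span_base CollectI exI[of _ "A # As"] exI[of _ v]) simp
qed

lemma U_foldr:
  assumes "M0 \<subseteq> nice" "set As \<subseteq> g" "f \<in> U_filt g act a M0"
  shows "foldr act As f \<in> U_filt g act (length As + a) M0"
  using assms(2)
proof (induction As)
  case (Cons A As)
  then show ?case using U_act[OF assms(1), of A "foldr act As f"] by simp
qed (use assms(3) in simp)

lemma U_U:
  assumes "M0 \<subseteq> nice" "M0' \<subseteq> U_filt g act a M0"
  shows "U_filt g act n M0' \<subseteq> U_filt g act (n + a) M0"
  unfolding U_filt_def[of g act n M0']
proof (rule cfun.span_minimal[OF _ U_subspace], rule subsetI)
  fix f assume "f \<in> {foldr act As v | As v. set As \<subseteq> g \<and> length As \<le> n \<and> v \<in> M0'}"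
  then obtain As v where f: "f = foldr act As v" "set As \<subseteq> g" "length As \<le> n" "v \<in> M0'" by blast
  have "f \<in> U_filt g act (length As + a) M0" unfolding f(1) using U_foldr[OF assms(1) f(2)] f(4) assms(2) by blast
  then show "f \<in> U_filt g act (n + a) M0" using U_mono[of "length As + a" "n + a" M0] f(3) by auto
qed

text \<open>\<open>M0\<close> is finitely spanned, so it lies in a single step of the filtration by
  \<open>M1\<close>; applying n further factors keeps the shift constant.\<close>

lemma generating_le:
  assumes M: "M \<subseteq> nice" and 1: "generating_subspace g act M M0" and 2: "generating_subspace g act M M1"
  shows "\<exists>a. \<forall>n. U_filt g act n M0 \<subseteq> U_filt g act (n + a) M1"
proof -
  obtain B where B: "finite B" "M0 = cfun.span B" and M0: "M = (\<Union>n. U_filt g act n M0)"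
    using 1 unfolding generating_subspace_def by blast
  have M1: "M = (\<Union>n. U_filt g act n M1)" using 2 unfolding generating_subspace_def by blast
  have M1n: "M1 \<subseteq> nice" using M M1 U_base by blast
  have "B \<subseteq> M" using B(2) M0 U_base[of M0 0] cfun.span_superset[of B] by blast
  then have "\<forall>b\<in>B. \<exists>n. b \<in> U_filt g act n M1" using M1 by blast
  then obtain N where N: "\<And>b. b \<in> B \<Longrightarrow> b \<in> U_filt g act (N b) M1" by metis
  have "B \<subseteq> U_filt g act (\<Sum>b\<in>B. N b) M1"
  proof
    fix b assume b: "b \<in> B"
    have "N b \<le> (\<Sum>b\<in>B. N b)" using member_le_sum[OF b, of N] B(1) by simp
    then show "b \<in> U_filt g act (\<Sum>b\<in>B. N b) M1" using U_mono N[OF b] by blast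
  qed
  then have "M0 \<subseteq> U_filt g act (\<Sum>b\<in>B. N b) M1"
    unfolding B(2) by (rule cfun.span_minimal[OF _ U_subspace])
  from U_U[OF M1n this] show ?thesis by blast
qed

end

interpretation pi: nice_action lie_g "pi_act :: complex^('p::finite + 'q::finite)^('p + 'q) \<Rightarrow> _"
  by unfold_locales (simp_all add: lin_on_pi nice_pi)

text \<open>From this level on, \<open>raise_coeff\<close> is nonzero and every admissible \<open>l\<close> is positive.\<close>

definition base_level :: "'q::finite itself \<Rightarrow> nat \<Rightarrow> nat" where
  "base_level _ m = CARD('q) + m + 2"

text \<open>The numerator is the value of \<open>kappa\<close> at the degree k - 1 - b, a true
  subtraction above the base level.\<close>

lemma raise_coeff_nz:
  assumes "b \<le> m" "k \<ge> base_level TYPE('q::finite) m"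
  shows "raise_coeff TYPE('p::finite) k b \<noteq> 0"
proof -
  define j where "j = k - 1 - b"
  have k: "k = j + 1 + b" using assms by (simp add: j_def base_level_def)
  have "kappa TYPE('p) k - 1 - of_nat b = kappa TYPE('p) j"
    unfolding k by (simp add: kappa_def algebra_simps)
  then show ?thesis by (simp add: raise_coeff_def)
qed

text \<open>One inclusion iterates \<open>pi_MK\<close>; the other gains the top degree from
  \<open>Qop_sum\<close>, whose scalar must not vanish from \<open>K0\<close> on.\<close>

lemma U_filt_MK:
  assumes K0: "K0 \<ge> base_level TYPE('q) m"
  shows "U_filt lie_g pi_act n (MK m K0) = (MK m (K0 + n) :: ('p::finite, 'q::finite) funs set)"
proof
  show "U_filt lie_g pi_act n (MK m K0) \<subseteq> (MK m (K0 + n) :: ('p, 'q) funs set)"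
    unfolding U_filt_def
  proof (rule cfun.span_minimal[OF _ MK_subspace], rule subsetI)
    fix f :: "('p, 'q) funs"
    assume "f \<in> {foldr pi_act As v | As v. set As \<subseteq> lie_g \<and> length As \<le> n \<and> v \<in> MK m K0}"
    then obtain As v where f: "f = foldr pi_act As v" "length As \<le> n" "v \<in> MK m K0"
      unfolding mem_Collect_eq by (elim exE conjE)
    have "foldr pi_act As v \<in> MK m (K0 + length As)"
    proof (induction As)
      case (Cons A As)
      then show ?case using pi_MK[of "foldr pi_act As v" m "K0 + length As" A] by simp
    qed (use f in simp)
    then show "f \<in> MK m (K0 + n)" unfolding f(1) using MK_mono[of "K0 + length As" "K0 + n"] f(2) by auto
  qed
  show "(MK m (K0 + n) :: ('p, 'q) funs set) \<subseteq> U_filt lie_g pi_act n (MK m K0)"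
  proof (induction n)
    case 0
    show "(MK m (K0 + 0) :: ('p, 'q) funs set) \<subseteq> U_filt lie_g pi_act 0 (MK m K0)"
      unfolding add_0_right by (rule pi.U_base)
  next
    case (Suc n)
    let ?U = "U_filt lie_g pi_act (Suc n) (MK m K0) :: ('p, 'q) funs set"
    have sub: "(MK m (K0 + n) :: ('p, 'q) funs set) \<subseteq> ?U"
      by (rule subset_trans[OF Suc pi.U_mono]) simp
    show "(MK m (K0 + Suc n) :: ('p, 'q) funs set) \<subseteq> ?U"
      unfolding MK_def[of m "K0 + Suc n"]
    proof (rule cfun.span_minimal[OF _ pi.U_subspace], rule subsetI)
      fix f :: "('p, 'q) funs" assume "f \<in> gens m (K0 + Suc n)"
      then show "f \<in> ?U"
      proof (rule gensE)
        fix h1 :: "real^'p \<Rightarrow> complex" and h2 :: "real^'q \<Rightarrow> complex" and k l b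
        assume f: "f = kterm h1 h2 0 b (PsiF (kappa TYPE('p) k))" and kb: "k \<le> K0 + Suc n" "b \<le> m"
          and h: "h1 \<in> harmonic_polys k" "h2 \<in> harmonic_polys l" and w: "2 * l + 4 * b + CARD('q) = 2 * k + CARD('p) + 2 * m"
        show ?thesis
        proof (cases "k \<le> K0 + n")
          case True
          have "f \<in> MK m (K0 + n)" unfolding f by (rule kterm_in_MK[OF True kb(2) h w])
          then show ?thesis by (rule subsetD[OF sub])
        next
          case False
          define k' where "k' = K0 + n"
          have k: "k = Suc k'" using False kb(1) by (simp add: k'_def)
          have "l > 0" using w k K0 kb(2) by (simp add: k'_def base_level_def)
          then obtain l' where l: "l = Suc l'" by (cases l) auto
          define c where "c = of_nat (Suc k') * of_nat (Suc l') * raise_coeff TYPE('p) k' b"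
          have c: "c \<noteq> 0" using raise_coeff_nz[OF kb(2), of k', where 'p = 'p and 'q = 'q] K0
            by (simp add: c_def k'_def del: of_nat_Suc)
          have Q: "Qop i j (kterm (pl.D i h1) (pl.D j h2) 0 b (PsiF (kappa TYPE('p) k'))) \<in> ?U" for i j
          proof -
            let ?g = "kterm (pl.D i h1) (pl.D j h2) 0 b (PsiF (kappa TYPE('p) k'))"
            have "?g \<in> MK m (K0 + n)"
              by (rule kterm_in_MK[OF _ kb(2) harm_D_Suc[OF h(1)[unfolded k]] harm_D_Suc[OF h(2)[unfolded l]]])
                (use w k l in \<open>auto simp: k'_def\<close>)
            then have "?g \<in> U_filt lie_g pi_act n (MK m K0)" by (rule subsetD[OF Suc])
            from pi.U_act[OF MK_nice Xminus_lie this, of i j]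
            have "cscale \<i> (Qop i j ?g) \<in> ?U" unfolding pi_act_Xminus' .
            from cfun.subspace_scale[OF pi.U_subspace this, of "- \<i>"] show ?thesis by simp
          qed
          \<comment> \<open>\<open>Qop_sum\<close> read from right to left: up to the scalar c, the
            missing vector is a sum of root vectors applied to vectors already reached.\<close>
          have "cscale c f \<in> ?U"
            unfolding c_def f k Qop_sum[OF h(1)[unfolded k] h(2)[unfolded l], symmetric]
            by (rule cfun.subspace_sum[OF pi.U_subspace], rule cfun.subspace_sum[OF pi.U_subspace], rule Q)
          from cfun.subspace_scale[OF pi.U_subspace this, of "1 / c"] show ?thesis using c by simp
        qed
      qed
    qed
  qed
qed

section \<open>Dimensions\<close>

text \<open>Each triple stands for one copy of the tensor product of H^k and H^l; b is determined by
  k and l.\<close>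

definition ktypes :: "'p::finite itself \<Rightarrow> 'q::finite itself \<Rightarrow> nat \<Rightarrow> nat \<Rightarrow> (nat \<times> nat \<times> nat) set" where
  "ktypes _ _ m K = {(k, l, b). k \<le> K \<and> b \<le> m \<and> 2 * l + 4 * b + CARD('q) = 2 * k + CARD('p) + 2 * m}"

lemma finite_ktypes: "finite (ktypes TYPE('p::finite) TYPE('q::finite) m K)"
proof (rule finite_subset)
  show "ktypes TYPE('p) TYPE('q) m K \<subseteq> {..K} \<times> {..2 * K + CARD('p) + 2 * m} \<times> {..m}"
    by (auto simp: ktypes_def)
qed auto

definition ktype_index :: "'p::finite itself \<Rightarrow> 'q::finite itself \<Rightarrow> nat \<Rightarrow> nat \<Rightarrow>
    ((nat \<times> nat \<times> nat) \<times> (real^'p \<Rightarrow> complex) \<times> (real^'q \<Rightarrow> complex)) set" where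
  "ktype_index p q m K = (SIGMA t : ktypes p q m K. hbasis (fst t) \<times> hbasis (fst (snd t)))"

definition ktype_vec :: "(nat \<times> nat \<times> nat) \<times> (real^'p::finite \<Rightarrow> complex) \<times> (real^'q::finite \<Rightarrow> complex) \<Rightarrow> ('p, 'q) funs" where
  "ktype_vec = (\<lambda>((k, l, b), h1, h2). kterm h1 h2 0 b (PsiF (kappa TYPE('p) k)))"

lemma finite_ktype_index: "finite (ktype_index TYPE('p::finite) TYPE('q::finite) m K)"
  unfolding ktype_index_def by (intro finite_SigmaI finite_ktypes finite_cartesian_product hbasis(1))

lemma span_ktype_index: "cfun.span (ktype_vec ` ktype_index TYPE('p::finite) TYPE('q::finite) m K) = (MK m K :: ('p, 'q) funs set)"
proof
  let ?B = "cfun.span (ktype_vec ` ktype_index TYPE('p) TYPE('q) m K) :: ('p, 'q) funs set"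
  show "?B \<subseteq> MK m K"
  proof (rule cfun.span_minimal[OF _ MK_subspace], rule subsetI)
    fix f assume "f \<in> ktype_vec ` ktype_index TYPE('p) TYPE('q) m K"
    then obtain i where i: "f = ktype_vec i" "i \<in> ktype_index TYPE('p) TYPE('q) m K" by blast
    obtain k l b h1 h2 where e: "i = ((k, l, b), h1, h2)" by (metis prod.exhaust)
    have t: "(k, l, b) \<in> ktypes TYPE('p) TYPE('q) m K" and h: "h1 \<in> hbasis k" "h2 \<in> hbasis l"
      using i(2) by (simp_all add: e ktype_index_def)
    show "f \<in> MK m K" unfolding i(1) e ktype_vec_def prod.case
      by (rule kterm_in_MK[OF _ _ hbasis_harm[OF h(1)] hbasis_harm[OF h(2)]]) (use t in \<open>simp_all add: ktypes_def\<close>)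
  qed
  show "MK m K \<subseteq> ?B"
    unfolding MK_def
  proof (rule cfun.span_minimal[OF _ cfun.subspace_span], rule subsetI)
    fix f :: "('p, 'q) funs" assume "f \<in> gens m K"
    then show "f \<in> ?B"
    proof (rule gensE)
      fix h1 :: "real^'p \<Rightarrow> complex" and h2 :: "real^'q \<Rightarrow> complex" and k l b
      assume f: "f = kterm h1 h2 0 b (PsiF (kappa TYPE('p) k))" and kb: "k \<le> K" "b \<le> m"
        and h: "h1 \<in> harmonic_polys k" "h2 \<in> harmonic_polys l" and w: "2 * l + 4 * b + CARD('q) = 2 * k + CARD('p) + 2 * m"
      let ?P = "PsiF (kappa TYPE('p) k)"
      have 1: "kterm b1 b2 0 b ?P \<in> ?B" if "b1 \<in> hbasis k" "b2 \<in> hbasis l"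
        for b1 :: "real^'p \<Rightarrow> complex" and b2 :: "real^'q \<Rightarrow> complex"
      proof (rule cfun.span_base, rule image_eqI)
        show "kterm b1 b2 0 b ?P = ktype_vec ((k, l, b), b1, b2)" by (simp add: ktype_vec_def)
        show "((k, l, b), b1, b2) \<in> ktype_index TYPE('p) TYPE('q) m K"
          using that kb w by (simp add: ktype_index_def ktypes_def)
      qed
      have l1: "lin_on UNIV (\<lambda>h2. kterm b1 h2 0 b ?P)" for b1 :: "real^'p \<Rightarrow> complex"
        by (rule lin_onI) (simp_all add: kterm_lin)
      have l2: "lin_on UNIV (\<lambda>h1. kterm h1 h2 0 b ?P)"
        by (rule lin_onI) (simp_all add: kterm_lin)
      have 2: "kterm b1 h2 0 b ?P \<in> ?B" if "b1 \<in> hbasis k" for b1 :: "real^'p \<Rightarrow> complex"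
        by (rule lin_on_image_span[OF l1 cfun.subspace_UNIV subset_UNIV 1[OF that] cfun.subspace_span])
          (use h(2) hbasis(3) in auto)
      show ?thesis unfolding f
        by (rule lin_on_image_span[OF l2 cfun.subspace_UNIV subset_UNIV 2 cfun.subspace_span])
          (use h(1) hbasis(3) in auto)
    qed
  qed
qed

text \<open>Different types are separated by their joint eigenvalues, and within a type
  \<open>block_sum_eq_0\<close> applies; since \<open>PsiF\<close> has constant term 1, the scalars
  themselves vanish.\<close>

lemma dim_MK_card:
  assumes pq: "CARD('p::finite) \<ge> 2" "CARD('q::finite) \<ge> 2"
  shows "cfun.dim (MK m K :: ('p, 'q) funs set) = card (ktype_index TYPE('p) TYPE('q) m K)"
  unfolding span_ktype_index[symmetric]
proof (rule dim_family[OF finite_ktype_index])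
  let ?T = "ktypes TYPE('p) TYPE('q) m K"
  fix c :: "(nat \<times> nat \<times> nat) \<times> (real^'p \<Rightarrow> complex) \<times> (real^'q \<Rightarrow> complex) \<Rightarrow> complex"
  define F :: "nat \<times> nat \<times> nat \<Rightarrow> ('p, 'q) funs" where
    "F = (\<lambda>(k, l, b). block_sum k l 0 b (\<lambda>h1 h2. fps_const (c ((k, l, b), h1, h2)) * PsiF (kappa TYPE('p) k)))"
  assume z: "(\<Sum>i\<in>ktype_index TYPE('p) TYPE('q) m K. cscale (c i) (ktype_vec i)) = 0"
  have "(\<Sum>i\<in>ktype_index TYPE('p) TYPE('q) m K. cscale (c i) (ktype_vec i))
      = (\<Sum>t\<in>?T. \<Sum>h\<in>hbasis (fst t) \<times> hbasis (fst (snd t)). cscale (c (t, h)) (ktype_vec (t, h)))"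
    unfolding ktype_index_def by (subst sum.Sigma) (auto simp: finite_ktypes hbasis(1) split_beta)
  also have "\<dots> = (\<Sum>t\<in>?T. F t)"
  proof (rule sum.cong[OF refl])
    fix t assume "t \<in> ?T"
    obtain k l b where t: "t = (k, l, b)" by (metis prod.exhaust)
    have "(\<Sum>h\<in>hbasis k \<times> hbasis l. cscale (c (t, h)) (ktype_vec (t, h)))
        = (\<Sum>h1\<in>hbasis k. \<Sum>h2\<in>hbasis l. cscale (c (t, h1, h2)) (ktype_vec (t, h1, h2)))"
      by (simp add: sum.cartesian_product split_beta)
    also have "\<dots> = F t"
      unfolding t F_def prod.case block_sum_def ktype_vec_def kterm_cmult[OF entire_Psi_kappa] ..
    finally show "(\<Sum>h\<in>hbasis (fst t) \<times> hbasis (fst (snd t)). cscale (c (t, h)) (ktype_vec (t, h))) = F t"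
      unfolding t by simp
  qed
  finally have Fz: "(\<Sum>t\<in>?T. F t) = 0" unfolding z ..
  define cc where "cc = (\<lambda>(k, l :: nat, b :: nat). cas_val TYPE('p) k)"
  define dd where "dd = (\<lambda>(k :: nat, l, b :: nat). cas_val TYPE('q) l)"
  define mu where "mu = (\<lambda>(k, l, b). wt TYPE('p) TYPE('q) k l 0 b)"
  have F0: "F t = 0" if t: "t \<in> ?T" for t
  proof (rule joint_eigen_separate[OF finite_ktypes _ Fz _ t])
    fix t assume "t \<in> ?T"
    obtain k l b where t: "t = (k, l, b)" by (metis prod.exhaust)
    have "F t \<in> block k l 0 b" unfolding t F_def prod.case block_def
      by (intro CollectI exI[of _ "\<lambda>h1 h2. fps_const (c ((k, l, b), h1, h2)) * PsiF (kappa TYPE('p) k)"]) simp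
    from block_joint_eigen[OF this] show "F t \<in> joint_eigen (cc t) (dd t) (mu t)" by (simp add: t cc_def dd_def mu_def)
  next
    show "inj_on (\<lambda>t. (cc t, dd t, mu t)) ?T"
    proof (rule inj_onI)
      fix s t :: "nat \<times> nat \<times> nat" assume st: "(cc s, dd s, mu s) = (cc t, dd t, mu t)"
      obtain k l b where t: "t = (k, l, b)" by (metis prod.exhaust)
      obtain k' l' b' where s: "s = (k', l', b')" by (metis prod.exhaust)
      have "(k', l', 0 :: nat, b') = (k, l, 0, b)"
        by (rule key_inj[OF pq]) (use st in \<open>simp_all add: s t cc_def dd_def mu_def\<close>)
      then show "s = t" by (simp add: s t)
    qed
  qed
  show "\<forall>i\<in>ktype_index TYPE('p) TYPE('q) m K. c i = 0"
  proof
    fix i assume i: "i \<in> ktype_index TYPE('p) TYPE('q) m K"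
    obtain k l b h1 h2 where e: "i = ((k, l, b), h1, h2)" by (metis prod.exhaust)
    have t: "(k, l, b) \<in> ?T" and h: "h1 \<in> hbasis k" "h2 \<in> hbasis l"
      using i by (simp_all add: e ktype_index_def)
    have "fps_const (c ((k, l, b), h1, h2)) * PsiF (kappa TYPE('p) k) = 0"
      by (rule block_sum_eq_0[OF _ F0[OF t, unfolded F_def prod.case] h]) simp
    then have "fps_nth (fps_const (c ((k, l, b), h1, h2)) * PsiF (kappa TYPE('p) k)) 0 = fps_nth 0 0"
      by (rule arg_cong)
    then have "c ((k, l, b), h1, h2) * fps_nth (PsiF (kappa TYPE('p) k)) 0 = 0"
      by (simp only: fps_mult_left_const_nth fps_zero_nth)
    then show "c i = 0" by (simp add: e PsiF_def)
  qed
qed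

definition hdim :: "'n::finite itself \<Rightarrow> nat \<Rightarrow> nat" where
  "hdim _ k = cfun.dim (harmonic_polys k :: (real^'n \<Rightarrow> complex) set)"

lemma dim_MK:
  assumes pq: "CARD('p::finite) \<ge> 2" "CARD('q::finite) \<ge> 2"
  shows "cfun.dim (MK m K :: ('p, 'q) funs set)
    = (\<Sum>(k, l, b)\<in>ktypes TYPE('p) TYPE('q) m K. hdim TYPE('p) k * hdim TYPE('q) l)"
proof -
  have "card (ktype_index TYPE('p) TYPE('q) m K)
      = (\<Sum>t\<in>ktypes TYPE('p) TYPE('q) m K. card ((hbasis (fst t) :: (real^'p \<Rightarrow> complex) set) \<times> (hbasis (fst (snd t)) :: (real^'q \<Rightarrow> complex) set)))"
    unfolding ktype_index_def by (rule card_SigmaI) (auto simp: finite_ktypes hbasis(1))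
  also have "\<dots> = (\<Sum>(k, l, b)\<in>ktypes TYPE('p) TYPE('q) m K. hdim TYPE('p) k * hdim TYPE('q) l)"
    by (intro sum.cong refl) (auto simp: card_cartesian_product hbasis(4) hdim_def)
  finally show ?thesis unfolding dim_MK_card[OF pq] .
qed

text \<open>The solution \<open>l\<close> of the equation in \<open>ktypes\<close>; the division is exact only for even \<open>p + q\<close>,
  the subtraction only for large \<open>K\<close>.\<close>

definition y_deg :: "'p::finite itself \<Rightarrow> 'q::finite itself \<Rightarrow> nat \<Rightarrow> nat \<Rightarrow> nat \<Rightarrow> nat" where
  "y_deg _ _ m K b = (2 * K + CARD('p) + 2 * m - CARD('q) - 4 * b) div 2"

lemma y_deg_eq:
  assumes ev: "even (CARD('p::finite) + CARD('q::finite))" and K: "K \<ge> base_level TYPE('q) m" and b: "b \<le> m"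
  shows "2 * y_deg TYPE('p) TYPE('q) m K b + 4 * b + CARD('q) = 2 * K + CARD('p) + 2 * m"
    and "y_deg TYPE('p) TYPE('q) m (K + n) b = y_deg TYPE('p) TYPE('q) m K b + n"
    and "y_deg TYPE('p) TYPE('q) m K b \<ge> 1"
proof -
  have 1: "2 * K + CARD('p) + 2 * m \<ge> CARD('q) + 4 * b + 2" using K b by (simp add: base_level_def)
  have "even (2 * K + CARD('p) + 2 * m - CARD('q) - 4 * b)"
    using ev 1 by auto
  then show e: "2 * y_deg TYPE('p) TYPE('q) m K b + 4 * b + CARD('q) = 2 * K + CARD('p) + 2 * m"
    using 1 by (simp add: y_deg_def)
  have "2 * (K + n) + CARD('p) + 2 * m - CARD('q) - 4 * b = (2 * K + CARD('p) + 2 * m - CARD('q) - 4 * b) + 2 * n"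
    using 1 by simp
  then show "y_deg TYPE('p) TYPE('q) m (K + n) b = y_deg TYPE('p) TYPE('q) m K b + n"
    unfolding y_deg_def by simp
  show "y_deg TYPE('p) TYPE('q) m K b \<ge> 1" using e 1 by linarith
qed

text \<open>The additional types have k = K + 1, and for each b the weight relation admits exactly
  one l.\<close>

lemma dim_MK_step:
  assumes pq: "CARD('p::finite) \<ge> 2" "CARD('q::finite) \<ge> 2" and ev: "even (CARD('p) + CARD('q))"
    and K: "Suc K \<ge> base_level TYPE('q) m"
  shows "cfun.dim (MK m (Suc K) :: ('p, 'q) funs set) = cfun.dim (MK m K :: ('p, 'q) funs set)
    + hdim TYPE('p) (Suc K) * (\<Sum>b\<le>m. hdim TYPE('q) (y_deg TYPE('p) TYPE('q) m (Suc K) b))"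
proof -
  let ?f = "\<lambda>(k, l, b :: nat). hdim TYPE('p) k * hdim TYPE('q) l"
  let ?g = "\<lambda>b. (Suc K, y_deg TYPE('p) TYPE('q) m (Suc K) b, b)"
  have T: "ktypes TYPE('p) TYPE('q) m (Suc K) = ktypes TYPE('p) TYPE('q) m K \<union> ?g ` {..m}"
  proof (intro set_eqI iffI)
    fix t assume t: "t \<in> ktypes TYPE('p) TYPE('q) m (Suc K)"
    obtain k l b where e: "t = (k, l, b)" by (metis prod.exhaust)
    show "t \<in> ktypes TYPE('p) TYPE('q) m K \<union> ?g ` {..m}"
    proof (cases "k = Suc K")
      case True
      have b: "b \<le> m" using t by (simp add: e ktypes_def)
      have "l = y_deg TYPE('p) TYPE('q) m (Suc K) b" using y_deg_eq(1)[OF ev K b] t True by (simp add: e ktypes_def)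
      then show ?thesis using b True by (simp add: e)
    qed (use t in \<open>simp add: e ktypes_def\<close>)
  next
    fix t assume "t \<in> ktypes TYPE('p) TYPE('q) m K \<union> ?g ` {..m}"
    then show "t \<in> ktypes TYPE('p) TYPE('q) m (Suc K)"
      using y_deg_eq(1)[OF ev K] by (auto simp: ktypes_def)
  qed
  have "(\<Sum>t\<in>ktypes TYPE('p) TYPE('q) m (Suc K). ?f t) = (\<Sum>t\<in>ktypes TYPE('p) TYPE('q) m K. ?f t) + (\<Sum>t\<in>?g ` {..m}. ?f t)"
    unfolding T by (rule sum.union_disjoint[OF finite_ktypes finite_imageI[OF finite_atMost]]) (auto simp: ktypes_def)
  also have "(\<Sum>t\<in>?g ` {..m}. ?f t) = (\<Sum>b\<le>m. hdim TYPE('p) (Suc K) * hdim TYPE('q) (y_deg TYPE('p) TYPE('q) m (Suc K) b))"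
    by (subst sum.reindex) (auto simp: inj_on_def)
  finally show ?thesis unfolding dim_MK[OF pq] by (simp add: sum_distrib_left)
qed

lemma MK_fin: "\<exists>A. finite A \<and> MK m K = cfun.span (A :: ('p::finite, 'q::finite) funs set)"
  by (intro exI[of _ "ktype_vec ` ktype_index TYPE('p) TYPE('q) m K"] conjI finite_imageI finite_ktype_index span_ktype_index[symmetric])

section \<open>Hilbert polynomials and independence of the generating subspace\<close>

text \<open>\<open>c = 0\<close> is allowed, so that sums need no side condition.\<close>

definition has_lc :: "nat \<Rightarrow> rat \<Rightarrow> rat poly \<Rightarrow> bool" where
  "has_lc k c p \<longleftrightarrow> degree p \<le> k \<and> coeff p k = c"

lemma has_lc_add: "has_lc k c p \<Longrightarrow> has_lc k d q \<Longrightarrow> has_lc k (c + d) (p + q)"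
  by (simp add: has_lc_def degree_add_le)

lemma has_lc_mult:
  assumes "has_lc k c p" "has_lc l d q"
  shows "has_lc (k + l) (c * d) (p * q)"
proof -
  have le: "degree (p * q) \<le> degree p + degree q" by (rule degree_mult_le)
  have "coeff (p * q) (k + l) = c * d"
  proof (cases "degree p = k \<and> degree q = l")
    case True
    then show ?thesis using coeff_mult_degree_sum[of p q] assms by (auto simp: has_lc_def)
  next
    case False
    then have lt: "degree p + degree q < k + l" using assms by (auto simp: has_lc_def)
    have "c = 0 \<or> d = 0" using False assms by (auto simp: has_lc_def coeff_eq_0)
    moreover have "coeff (p * q) (k + l) = 0" using le lt by (intro coeff_eq_0) simp
    ultimately show ?thesis by auto
  qed
  then show ?thesis using le assms by (auto simp: has_lc_def)
qed

lemma has_lc_smult: "has_lc k c p \<Longrightarrow> has_lc k (a * c) (smult a p)"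
  by (auto simp: has_lc_def intro: order.trans[OF degree_smult_le])

lemma has_lc_sum: "(\<And>i. i \<in> I \<Longrightarrow> has_lc k c (p i)) \<Longrightarrow> finite I \<Longrightarrow> has_lc k (of_nat (card I) * c) (\<Sum>i\<in>I. p i)"
proof (induction I rule: infinite_finite_induct)
  case (insert i I)
  then have "has_lc k (c + of_nat (card I) * c) (p i + sum p I)" by (intro has_lc_add) auto
  then show ?case using insert by (simp add: algebra_simps)
qed (simp_all add: has_lc_def)

text \<open>The polynomial n -> (n + s + k choose k), written as a product so that the leading
  coefficient 1 / k! can be read off.\<close>

definition binom_poly :: "nat \<Rightarrow> nat \<Rightarrow> rat poly" where
  "binom_poly s k = smult (1 / fact k) (\<Prod>i<k. [:of_nat (s + Suc i), 1:])"

lemma binom_poly_lc: "has_lc k (1 / fact k) (binom_poly s k)"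
proof -
  have "has_lc k 1 (\<Prod>i<k. [:of_nat (s + Suc i), 1:])"
  proof (induction k)
    case (Suc k)
    have "has_lc 1 1 ([:of_nat (s + Suc k), 1:] :: rat poly)" by (simp add: has_lc_def)
    from has_lc_mult[OF Suc this] show ?case by simp
  qed (simp add: has_lc_def)
  from has_lc_smult[OF this, of "1 / fact k"] show ?thesis by (simp add: binom_poly_def)
qed

lemma binom_poly_poly: "poly (binom_poly s k) (of_nat n) = of_nat ((n + s + k) choose k)"
proof -
  have "(\<Prod>i<k. of_nat n + of_nat s + (1 + of_nat i) :: rat) = pochhammer (of_nat (n + s) + 1) k"
    unfolding pochhammer_prod by (rule prod.cong) (auto simp: atLeast0LessThan)
  also have "\<dots> = fact k * of_nat ((n + s + k) choose k)"
  proof -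
    have "of_nat ((n + s + k) choose k) = (of_nat (n + s + k) gchoose k :: rat)" by (rule binomial_gbinomial)
    also have "\<dots> = pochhammer (of_nat (n + s + k) - of_nat k + 1) k / fact k" by (rule gbinomial_pochhammer')
    finally show ?thesis by simp
  qed
  finally show ?thesis by (simp add: binom_poly_def poly_prod algebra_simps)
qed

section \<open>Growth of polynomials and of Hilbert functions\<close>

lemma poly_asymp:
  fixes p :: "real poly"
  assumes "degree p \<le> k"
  shows "(\<lambda>n. poly p (real n) / real n ^ k) \<longlonglongrightarrow> coeff p k"
  using assms
proof (induction k arbitrary: p)
  case 0
  then obtain a where "p = [:a:]" by (auto elim: degree_eq_zeroE)
  then show ?case by simp
next
  case (Suc k)
  obtain a q where p: "p = pCons a q" by (rule pCons_cases)
  have q: "degree q \<le> k" using Suc.prems p by (cases "q = 0") auto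
  have "(\<lambda>n. a * (1 / real n) ^ Suc k + poly q (real n) / real n ^ k) \<longlonglongrightarrow> a * 0 ^ Suc k + coeff q k"
    by (intro tendsto_intros Suc.IH[OF q] lim_1_over_n)
  moreover have "a * 0 ^ Suc k + coeff q k = coeff p (Suc k)" by (simp add: p)
  moreover have "\<forall>\<^sub>F n in sequentially. a * (1 / real n) ^ Suc k + poly q (real n) / real n ^ k = poly p (real n) / real n ^ Suc k"
    using eventually_gt_at_top[of 0]
  proof eventually_elim
    case (elim n)
    then show ?case by (simp add: p power_divide add_divide_distrib)
  qed
  ultimately show ?case by (simp only: Lim_transform_eventually)
qed

lemma poly_map_of_rat: "poly (map_poly of_rat p) (of_rat x) = (of_rat (poly p x) :: real)"
  by (induction p) (auto simp: map_poly_pCons of_rat_add of_rat_mult)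

lemma of_rat_fact: "real_of_rat (fact k) = fact k"
  using of_rat_of_nat_eq[of "fact k", where 'a = real] by simp

lemma rat_poly_asymp:
  assumes "has_lc k c p"
  shows "(\<lambda>n. real_of_rat (poly p (of_nat n)) / real n ^ k) \<longlonglongrightarrow> real_of_rat c"
proof -
  have "degree (map_poly real_of_rat p) \<le> k"
    by (rule degree_le) (use assms in \<open>auto simp: has_lc_def coeff_map_poly coeff_eq_0\<close>)
  from poly_asymp[OF this]
  have "(\<lambda>n. poly (map_poly real_of_rat p) (real n) / real n ^ k) \<longlonglongrightarrow> real_of_rat (coeff p k)"
    by (simp add: coeff_map_poly)
  moreover have "poly (map_poly real_of_rat p) (real n) = real_of_rat (poly p (of_nat n))" for n
    using poly_map_of_rat[of p "of_nat n"] by simp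
  ultimately show ?thesis using assms by (simp add: has_lc_def)
qed

lemma binomial_asymp: "(\<lambda>n. real ((n + s + k) choose k) / real n ^ k) \<longlonglongrightarrow> 1 / fact k"
  using rat_poly_asymp[OF binom_poly_lc[of k s]] by (simp add: binom_poly_poly of_rat_divide of_rat_fact)

text \<open>For z = x - q y the increments of z are bounded by e times those of y from some index
  on; summing them and dividing by y gives the claim.\<close>

lemma stolz_cesaro:
  fixes x y :: "nat \<Rightarrow> real"
  assumes y: "strict_mono y" "filterlim y at_top sequentially"
    and q: "(\<lambda>n. (x (Suc n) - x n) / (y (Suc n) - y n)) \<longlonglongrightarrow> q"
  shows "(\<lambda>n. x n / y n) \<longlonglongrightarrow> q"
proof (rule LIMSEQ_I)
  fix r :: real assume r: "r > 0"
  \<comment> \<open>One half of r for the accumulated increments, the other for the starting value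
    \<open>z N\<close>.\<close>
  define e where "e = r / 2"
  have e: "e > 0" using r by (simp add: e_def)
  from q[THEN LIMSEQ_D, OF e] obtain N1
    where N1: "\<And>n. n \<ge> N1 \<Longrightarrow> \<bar>(x (Suc n) - x n) / (y (Suc n) - y n) - q\<bar> < e" by auto
  obtain N2 where N2: "\<And>n. n \<ge> N2 \<Longrightarrow> y n \<ge> 1"
    using y(2) unfolding filterlim_at_top eventually_sequentially by metis
  define N where "N = max N1 N2"
  define z where "z n = x n - q * y n" for n
  have yinc: "y (Suc n) - y n > 0" for n using y(1) by (simp add: strict_mono_def)
  have dz: "\<bar>z (Suc n) - z n\<bar> \<le> e * (y (Suc n) - y n)" if "n \<ge> N" for n
  proof -
    have "z (Suc n) - z n = ((x (Suc n) - x n) / (y (Suc n) - y n) - q) * (y (Suc n) - y n)"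
      using yinc[of n] by (simp add: z_def field_simps)
    then have "\<bar>z (Suc n) - z n\<bar> = \<bar>(x (Suc n) - x n) / (y (Suc n) - y n) - q\<bar> * (y (Suc n) - y n)"
      using yinc[of n] by (simp add: abs_mult)
    also have "\<dots> \<le> e * (y (Suc n) - y n)"
      using N1[of n] that yinc[of n] by (intro mult_right_mono) (auto simp: N_def less_imp_le)
    finally show ?thesis .
  qed
  have zb: "\<bar>z n\<bar> \<le> \<bar>z N\<bar> + e * (y n - y N)" if "n \<ge> N" for n
    using that
  proof (induction n rule: dec_induct)
    case (step n)
    have "\<bar>z (Suc n)\<bar> \<le> \<bar>z n\<bar> + \<bar>z (Suc n) - z n\<bar>" by simp
    also have "\<dots> \<le> \<bar>z N\<bar> + e * (y n - y N) + e * (y (Suc n) - y n)" using step dz[of n] by simp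
    finally show ?case by (simp add: algebra_simps)
  qed simp
  obtain N3 where N3: "\<And>n. n \<ge> N3 \<Longrightarrow> y n \<ge> (\<bar>z N\<bar> + 1) / e"
    using y(2) unfolding filterlim_at_top eventually_sequentially by metis
  have "norm (x n / y n - q) < r" if n: "n \<ge> max N N3" for n
  proof -
    have y1: "y n \<ge> 1" using n N2 by (simp add: N_def)
    have "\<bar>z n\<bar> \<le> \<bar>z N\<bar> + e * (y n - y N)" using zb n by simp
    also have "\<dots> \<le> \<bar>z N\<bar> + e * y n" using N2[of N] e by (simp add: N_def right_diff_distrib)
    also have "\<bar>z N\<bar> < e * y n" using N3[of n] n e by (simp add: field_simps)
    finally have "\<bar>z n\<bar> < r * y n" by (simp add: e_def)
    moreover have "x n / y n - q = z n / y n" using y1 by (simp add: z_def field_simps)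
    ultimately show ?thesis using y1 by (simp add: abs_divide divide_less_eq)
  qed
  then show "\<exists>no. \<forall>n\<ge>no. norm (x n / y n - q) < r" by blast
qed

text \<open>Stolz-Cesaro against (n + d choose d), chosen because its increments are again
  binomials, asymptotic to n^(d-1) / (d-1)!.\<close>

lemma hilbert_asymp:
  fixes D :: "nat \<Rightarrow> nat" and \<psi> :: "rat poly"
  assumes mono: "\<And>n. D n \<le> D (Suc n)" and d: "d \<ge> 1"
    and ev: "\<forall>\<^sub>F n in sequentially. poly \<psi> (of_nat n) = of_nat (D n - D (n - 1))"
    and lc: "has_lc (d - 1) (e / fact (d - 1)) \<psi>"
  shows "(\<lambda>n. real (D n) / real ((n + d) choose d)) \<longlonglongrightarrow> real_of_rat e"
proof (rule stolz_cesaro)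
  obtain k where k: "d = Suc k" using d by (cases d) auto
  have step: "real ((Suc n + d) choose d) - real ((n + d) choose d) = real ((n + Suc k) choose k)" for n
    unfolding k by simp
  show "strict_mono (\<lambda>n. real ((n + d) choose d))"
  proof (rule strict_mono_Suc_iff[THEN iffD2], rule allI)
    fix n
    have "real ((n + Suc k) choose k) > 0" by simp
    then show "real ((n + d) choose d) < real ((Suc n + d) choose d)" using step[of n] by linarith
  qed
  show "filterlim (\<lambda>n. real ((n + d) choose d)) at_top sequentially"
  proof (rule filterlim_at_top_mono[OF filterlim_real_sequentially])
    have "n \<le> (n + d) choose d" for n
    proof -
      have "n + 1 \<le> (n + 1 + k) choose (Suc k)"
      proof (induction k)
        case (Suc k)
        then show ?case by (simp add: le_trans)
      qed simp
      then show ?thesis by (simp add: k)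
    qed
    then show "\<forall>\<^sub>F n in sequentially. real n \<le> real ((n + d) choose d)" by simp
  qed
  have "(\<lambda>n. real_of_rat (poly \<psi> (of_nat n)) / real n ^ k) \<longlonglongrightarrow> real_of_rat (e / fact k)"
    using rat_poly_asymp[OF lc] k by simp
  then have "(\<lambda>n. (real_of_rat (poly \<psi> (of_nat n)) / real n ^ k) / (real ((n + 0 + k) choose k) / real n ^ k))
      \<longlonglongrightarrow> real_of_rat (e / fact k) / (1 / fact k)"
    by (intro tendsto_divide binomial_asymp) auto
  moreover have "real_of_rat (e / fact k) / (1 / fact k) = real_of_rat e"
    by (simp add: of_rat_divide of_rat_fact)
  moreover have "\<forall>\<^sub>F n in sequentially. (real_of_rat (poly \<psi> (of_nat n)) / real n ^ k) / (real ((n + 0 + k) choose k) / real n ^ k)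
      = real (D n - D (n - 1)) / real ((n + k) choose k)"
    using ev eventually_gt_at_top[of 0]
  proof eventually_elim
    case (elim n)
    then show ?case by simp
  qed
  ultimately have "(\<lambda>n. real (D n - D (n - 1)) / real ((n + k) choose k)) \<longlonglongrightarrow> real_of_rat e"
    by (simp only: Lim_transform_eventually)
  then have "(\<lambda>n. real (D (Suc n) - D (Suc n - 1)) / real ((Suc n + k) choose k)) \<longlonglongrightarrow> real_of_rat e"
    by (rule LIMSEQ_Suc)
  then show "(\<lambda>n. (real (D (Suc n)) - real (D n)) / (real ((Suc n + d) choose d) - real ((n + d) choose d))) \<longlonglongrightarrow> real_of_rat e"
    unfolding step using mono by (simp add: of_nat_diff)
qed

text \<open>Filtrations by two generating subspaces interleave up to a shift of the index, so applying this in both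
  directions shows that dimension and degree do not depend on the choice.\<close>

lemma hilbert_compare:
  fixes D D' :: "nat \<Rightarrow> nat"
  assumes le: "\<And>n. D' n \<le> D (n + a)"
    and D: "(\<lambda>n. real (D n) / real ((n + d) choose d)) \<longlonglongrightarrow> e"
    and D': "(\<lambda>n. real (D' n) / real ((n + d') choose d')) \<longlonglongrightarrow> e'" and e': "e' > 0"
  shows "d' \<le> d \<and> (d' = d \<longrightarrow> e' \<le> e)"
proof -
  have 1: "(\<lambda>n. real (D (n + a)) / real ((n + a + d) choose d)) \<longlonglongrightarrow> e"
    using LIMSEQ_ignore_initial_segment[OF D, of a] .
  have up: "(\<lambda>n. (real (D (n + a)) / real ((n + a + d) choose d)) * ((real ((n + a + d) choose d) / real n ^ d)
      / (real ((n + 0 + d') choose d') / real n ^ d'))) \<longlonglongrightarrow> e * ((1 / fact d) / (1 / fact d'))"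
    by (intro tendsto_mult tendsto_divide 1 binomial_asymp) auto
  have le': "real (D' n) / real ((n + d') choose d') * (real n ^ d' / real n ^ d)
      \<le> (real (D (n + a)) / real ((n + a + d) choose d)) * ((real ((n + a + d) choose d) / real n ^ d)
      / (real ((n + 0 + d') choose d') / real n ^ d'))" if "n > 0" for n
  proof -
    have "(real (D (n + a)) / real ((n + a + d) choose d)) * ((real ((n + a + d) choose d) / real n ^ d)
      / (real ((n + 0 + d') choose d') / real n ^ d')) = real (D (n + a)) / real ((n + d') choose d') * (real n ^ d' / real n ^ d)"
      using that by simp
    moreover have "real (D' n) / real ((n + d') choose d') * (real n ^ d' / real n ^ d)
      \<le> real (D (n + a)) / real ((n + d') choose d') * (real n ^ d' / real n ^ d)"
      using le[of n] by (intro mult_right_mono divide_right_mono) auto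
    ultimately show ?thesis by (simp only:)
  qed
  have "d' \<le> d"
  proof (rule ccontr)
    assume "\<not> d' \<le> d"
    then obtain j where j: "d' = d + Suc j" by (metis add_Suc_right less_iff_Suc_add not_le)
    \<comment> \<open>\<open>u\<close> converges and bounds the quotient for \<open>D'\<close> times
      the surplus power n^(j+1); dividing by that power forces the limit 0, against e' > 0.\<close>
    define u where "u n = (real (D (n + a)) / real ((n + a + d) choose d)) * ((real ((n + a + d) choose d) / real n ^ d)
      / (real ((n + 0 + d') choose d') / real n ^ d'))" for n
    have "(\<lambda>n. u n * (1 / real n) ^ Suc j) \<longlonglongrightarrow> e * ((1 / fact d) / (1 / fact d')) * 0 ^ Suc j"
      unfolding u_def by (intro tendsto_mult up tendsto_power lim_1_over_n)
    then have u0: "(\<lambda>n. u n * (1 / real n) ^ Suc j) \<longlonglongrightarrow> 0" by simp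
    have "\<forall>\<^sub>F n in sequentially. real (D' n) / real ((n + d') choose d') \<le> u n * (1 / real n) ^ Suc j"
      using eventually_gt_at_top[of 0]
    proof eventually_elim
      case (elim n)
      have "real n ^ d' / real n ^ d * (1 / real n) ^ Suc j = 1" using elim by (simp add: j power_add field_simps)
      then have "real (D' n) / real ((n + d') choose d')
        = (real (D' n) / real ((n + d') choose d') * (real n ^ d' / real n ^ d)) * (1 / real n) ^ Suc j"
        by (simp only: mult.assoc mult_1_right)
      also have "\<dots> \<le> u n * (1 / real n) ^ Suc j"
        using le'[OF elim] unfolding u_def by (intro mult_right_mono) auto
      finally show ?case .
    qed
    from tendsto_le[OF _ u0 D' this] e' show False by simp
  qed
  moreover have "e' \<le> e" if "d' = d"
  proof -
    have "e' \<le> e * ((1 / fact d) / (1 / fact d'))"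
    proof (rule tendsto_le[OF _ up D'])
      show "\<forall>\<^sub>F n in sequentially. real (D' n) / real ((n + d') choose d')
        \<le> (real (D (n + a)) / real ((n + a + d) choose d)) * ((real ((n + a + d) choose d) / real n ^ d)
        / (real ((n + 0 + d') choose d') / real n ^ d'))"
        using eventually_gt_at_top[of 0]
      proof eventually_elim
        case (elim n)
        have "real n ^ d' / real n ^ d = 1" using elim that by simp
        then show ?case using le'[OF elim] by (simp only: mult_1_right)
      qed
    qed simp
    then show ?thesis using that by simp
  qed
  ultimately show ?thesis by blast
qed

context nice_action
begin

lemma has_Dim_Deg_asymp:
  assumes M: "M \<subseteq> nice" and gen: "generating_subspace g act M M0"
    and fin: "\<And>n. \<exists>A. finite A \<and> U_filt g act n M0 \<subseteq> cfun.span A"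
    and ev: "\<forall>\<^sub>F n in sequentially. poly \<psi> (of_nat n) = of_nat (quot_dim (U_filt g act n M0) (U_filt g act (n - 1) M0))"
    and \<psi>: "\<psi> \<noteq> 0" "d \<ge> 1" "degree \<psi> = d - 1" "lead_coeff \<psi> = e / fact (d - 1)"
  shows "(\<lambda>n. real (cfun.dim (U_filt g act n M0)) / real ((n + d) choose d)) \<longlonglongrightarrow> real_of_rat e" and "e > 0"
proof -
  have mono: "cfun.dim (U_filt g act n M0) \<le> cfun.dim (U_filt g act (Suc n) M0)" for n
  proof -
    obtain A where A: "finite A" "U_filt g act (Suc n) M0 \<subseteq> cfun.span A" using fin by blast
    show ?thesis by (rule dim_mono_fin[OF U_subspace U_subspace U_mono A(2,1)]) simp
  qed
  have lc: "has_lc (d - 1) (e / fact (d - 1)) \<psi>" using \<psi>(3,4) by (simp add: has_lc_def)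
  show lim: "(\<lambda>n. real (cfun.dim (U_filt g act n M0)) / real ((n + d) choose d)) \<longlonglongrightarrow> real_of_rat e"
    by (rule hilbert_asymp[OF mono \<psi>(2) ev[unfolded quot_dim_def] lc])
  \<comment> \<open>Positivity of the degree, which \<open>hilbert_compare\<close> requires: a limit
    of nonnegative numbers with nonzero leading coefficient.\<close>
  have "real_of_rat e \<ge> 0"
    by (rule tendsto_lowerbound[OF lim]) (auto intro: always_eventually)
  moreover have "e \<noteq> 0"
  proof
    assume "e = 0"
    then have "lead_coeff \<psi> = 0" using \<psi>(4) by simp
    then show False using \<psi>(1) by simp
  qed
  ultimately show "e > 0" by simp
qed

lemma has_Dim_Deg_unique:
  assumes M: "M \<subseteq> nice" and 1: "has_Dim_Deg g act M d e"
    and fin: "\<And>M0 n. generating_subspace g act M M0 \<Longrightarrow> \<exists>A. finite A \<and> U_filt g act n M0 \<subseteq> cfun.span A"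
    and 2: "has_Dim_Deg g act M d' e'"
  shows "d' = d \<and> e' = e"
proof -
  have half: "d2 \<le> d1 \<and> (d2 = d1 \<longrightarrow> e2 \<le> e1)" if a: "has_Dim_Deg g act M d1 e1" and b: "has_Dim_Deg g act M d2 e2"
    for d1 d2 e1 e2
  proof -
    obtain M1 \<psi>1 where g1: "generating_subspace g act M M1"
      and p1: "\<forall>\<^sub>F n in sequentially. poly \<psi>1 (of_nat n) = of_nat (quot_dim (U_filt g act n M1) (U_filt g act (n - 1) M1))"
        "\<psi>1 \<noteq> 0" "d1 \<ge> 1" "degree \<psi>1 = d1 - 1" "lead_coeff \<psi>1 = e1 / fact (d1 - 1)"
      using a unfolding has_Dim_Deg_def by blast
    obtain M2 \<psi>2 where g2: "generating_subspace g act M M2"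
      and p2: "\<forall>\<^sub>F n in sequentially. poly \<psi>2 (of_nat n) = of_nat (quot_dim (U_filt g act n M2) (U_filt g act (n - 1) M2))"
        "\<psi>2 \<noteq> 0" "d2 \<ge> 1" "degree \<psi>2 = d2 - 1" "lead_coeff \<psi>2 = e2 / fact (d2 - 1)"
      using b unfolding has_Dim_Deg_def by blast
    note as1 = has_Dim_Deg_asymp[OF M g1 fin[OF g1] p1] and as2 = has_Dim_Deg_asymp[OF M g2 fin[OF g2] p2]
    obtain c where c: "\<And>n. U_filt g act n M2 \<subseteq> U_filt g act (n + c) M1"
      using generating_le[OF M g2 g1] by blast
    have le: "cfun.dim (U_filt g act n M2) \<le> cfun.dim (U_filt g act (n + c) M1)" for n
    proof -
      obtain A where A: "finite A" "U_filt g act (n + c) M1 \<subseteq> cfun.span A" using fin[OF g1] by blast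
      show ?thesis by (rule dim_mono_fin[OF U_subspace U_subspace c A(2,1)])
    qed
    have "d2 \<le> d1 \<and> (d2 = d1 \<longrightarrow> real_of_rat e2 \<le> real_of_rat e1)"
      by (rule hilbert_compare[OF le as1(1) as2(1)]) (use as2(2) in simp)
    then show ?thesis by (simp add: of_rat_less_eq)
  qed
  show ?thesis using half[OF 1 2] half[OF 2 1] by auto
qed

lemma GK_Bernstein_eq:
  assumes "M \<subseteq> nice" "has_Dim_Deg g act M d e"
    and "\<And>M0 n. generating_subspace g act M M0 \<Longrightarrow> \<exists>A. finite A \<and> U_filt g act n M0 \<subseteq> cfun.span A"
  shows "GK_Dim g act M = d" "Bernstein_Deg g act M = e"
proof -
  note u = has_Dim_Deg_unique[OF assms(1,2,3)]
  show "GK_Dim g act M = d"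
    unfolding GK_Dim_def
  proof (rule the_equality)
    show "\<exists>e. has_Dim_Deg g act M d e" using assms(2) by blast
    fix d' assume "\<exists>e. has_Dim_Deg g act M d' e"
    then obtain e' where "has_Dim_Deg g act M d' e'" by blast
    then show "d' = d" using u by blast
  qed
  show "Bernstein_Deg g act M = e"
    unfolding Bernstein_Deg_def
  proof (rule the_equality)
    show "\<exists>d. has_Dim_Deg g act M d e" using assms(2) by blast
    fix e' assume "\<exists>d. has_Dim_Deg g act M d e'"
    then obtain d' where "has_Dim_Deg g act M d' e'" by blast
    then show "e' = e" using u by blast
  qed
qed

end

section \<open>The Hilbert polynomial of M^+(m)\<close>

definition dim_poly :: "nat \<Rightarrow> nat \<Rightarrow> rat poly" where
  "dim_poly N s = binom_poly s (N - 2) + binom_poly (s - 1) (N - 2)"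

lemma dim_poly_lc: "has_lc (N - 2) (2 / fact (N - 2)) (dim_poly N s)"
  using has_lc_add[OF binom_poly_lc binom_poly_lc, of "N - 2" s "s - 1"] by (simp add: dim_poly_def)

text \<open>The two binomials of \<open>dim_harm\<close>, with s \<ge> 1 so that s - 1 is not
  truncated.\<close>

lemma dim_poly_hdim:
  assumes "CARD('n::finite) \<ge> 2" "s \<ge> 1"
  shows "poly (dim_poly CARD('n) s) (of_nat n) = of_nat (hdim TYPE('n) (s + n))"
proof -
  have 1: "s + n + CARD('n) - 2 = n + s + (CARD('n) - 2)" "s + n + CARD('n) - 3 = n + (s - 1) + (CARD('n) - 2)"
    using assms by simp_all
  have "hdim TYPE('n) (s + n) = ((n + s + (CARD('n) - 2)) choose (CARD('n) - 2)) + ((n + (s - 1) + (CARD('n) - 2)) choose (CARD('n) - 2))"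
    unfolding hdim_def using assms by (subst dim_harm) (auto simp: 1)
  then show ?thesis by (simp add: dim_poly_def binom_poly_poly)
qed

lemma M_plus_generating:
  assumes pq: "CARD('p::finite) \<ge> 2" "CARD('q::finite) \<ge> 2"
  shows "generating_subspace lie_g pi_act (M_plus m :: ('p, 'q) funs set) (MK m (base_level TYPE('q) m))"
proof -
  let ?K = "base_level TYPE('q) m"
  have "(\<Union>K. MK m K) = (\<Union>n. MK m (?K + n) :: ('p, 'q) funs set)"
  proof (rule antisym)
    show "(\<Union>K. MK m K) \<subseteq> (\<Union>n. MK m (?K + n) :: ('p, 'q) funs set)"
    proof
      fix f :: "('p, 'q) funs" assume "f \<in> (\<Union>K. MK m K)"
      then obtain K where "f \<in> MK m K" by blast
      then have "f \<in> MK m (?K + K)" by (rule rev_subsetD[OF _ MK_mono]) simp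
      then show "f \<in> (\<Union>n. MK m (?K + n))" by blast
    qed
  qed blast
  moreover have "U_filt lie_g pi_act n (MK m ?K) = (MK m (?K + n) :: ('p, 'q) funs set)" for n
    by (rule U_filt_MK) simp
  moreover have "\<exists>B. finite B \<and> (MK m ?K :: ('p, 'q) funs set) = cfun.span B" by (rule MK_fin)
  ultimately show ?thesis
    unfolding generating_subspace_def M_plus_eq_MK[OF pq] by (simp only: simp_thms)
qed

lemma M_plus_nice: "M_plus m \<subseteq> nice"
  unfolding M_plus_eq using space_E_nice by (auto simp: hw_space_def)

text \<open>For an arbitrary generating subspace, \<open>generating_le\<close> puts the filtration
  inside the one by \<open>MK\<close>, whose members are finite-dimensional.\<close>

lemma M_plus_fin:
  assumes pq: "CARD('p::finite) \<ge> 2" "CARD('q::finite) \<ge> 2"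
    and gen: "generating_subspace lie_g pi_act (M_plus m :: ('p, 'q) funs set) M0"
  shows "\<exists>A. finite A \<and> U_filt lie_g pi_act n M0 \<subseteq> cfun.span A"
proof -
  obtain a where a: "U_filt lie_g pi_act n M0 \<subseteq> U_filt lie_g pi_act (n + a) (MK m (base_level TYPE('q) m) :: ('p, 'q) funs set)"
    using pi.generating_le[OF M_plus_nice gen M_plus_generating[OF pq]] by blast
  obtain A :: "('p, 'q) funs set" where "finite A" "MK m (base_level TYPE('q) m + (n + a)) = cfun.span A"
    using MK_fin by blast
  then show ?thesis using a unfolding U_filt_MK[OF order.refl] by blast
qed

lemma M_plus_Dim_Deg:
  assumes pq: "CARD('p::finite) \<ge> 2" "CARD('q::finite) \<ge> 2" and ev: "even (CARD('p) + CARD('q))"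
  shows "has_Dim_Deg lie_g pi_act (M_plus m :: ('p, 'q) funs set) (CARD('p) + CARD('q) - 3)
    (4 * (of_nat m + 1) * fact (CARD('p) + CARD('q) - 4) / (fact (CARD('p) - 2) * fact (CARD('q) - 2)))"
proof -
  let ?K = "base_level TYPE('q) m" and ?p = "CARD('p)" and ?q = "CARD('q)"
  define s where "s b = y_deg TYPE('p) TYPE('q) m ?K b" for b
  \<comment> \<open>k = K + n and l = s b + n both grow with slope one in n, so each summand is a
    product of two dimension polynomials.\<close>
  define \<psi> where "\<psi> = dim_poly ?p ?K * (\<Sum>b\<le>m. dim_poly ?q (s b))"
  \<comment> \<open>This is e / (d - 1)! with d - 1 = (p - 2) + (q - 2): a factor 2 / (p-2)! from x
    and, for each of the m + 1 values of b, a factor 2 / (q-2)! from y.\<close>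
  define c :: rat where "c = 4 * (of_nat m + 1) / (fact (?p - 2) * fact (?q - 2))"
  have "has_lc ((?p - 2) + (?q - 2)) ((2 / fact (?p - 2)) * (of_nat (card {..m}) * (2 / fact (?q - 2)))) \<psi>"
    unfolding \<psi>_def by (intro has_lc_mult has_lc_sum dim_poly_lc) auto
  moreover have "(2 / fact (?p - 2)) * (of_nat (card {..m}) * (2 / fact (?q - 2))) = c" by (simp add: c_def algebra_simps)
  moreover have "(?p - 2) + (?q - 2) = ?p + ?q - 4" using pq by simp
  ultimately have lc: "has_lc (?p + ?q - 4) c \<psi>" by simp
  have c0: "c \<noteq> 0"
  proof -
    have "(of_nat m + 1 :: rat) \<noteq> 0" by (metis add.commute of_nat_Suc of_nat_neq_0)
    then show ?thesis by (simp add: c_def)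
  qed
  have deg: "degree \<psi> = ?p + ?q - 4"
    using lc c0 by (auto simp: has_lc_def intro!: antisym le_degree)
  have \<psi>0: "\<psi> \<noteq> 0" using lc c0 by (auto simp: has_lc_def)
  have quot: "poly \<psi> (of_nat n) = of_nat (quot_dim (U_filt lie_g pi_act n (MK m ?K :: ('p, 'q) funs set))
      (U_filt lie_g pi_act (n - 1) (MK m ?K)))" if n: "n > 0" for n
  proof -
    obtain n' where n': "n = Suc n'" using n by (cases n) auto
    have K1: "?K \<ge> 1" by (simp add: base_level_def)
    have step: "cfun.dim (MK m (?K + n) :: ('p, 'q) funs set) = cfun.dim (MK m (?K + n') :: ('p, 'q) funs set)
      + hdim TYPE('p) (?K + n) * (\<Sum>b\<le>m. hdim TYPE('q) (y_deg TYPE('p) TYPE('q) m (?K + n) b))"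
      using dim_MK_step[OF pq ev, of m "?K + n'"] by (simp add: n')
    have y_deg: "y_deg TYPE('p) TYPE('q) m (?K + n) b = s b + n" "s b \<ge> 1" if "b \<le> m" for b
      unfolding s_def by (rule y_deg_eq[OF ev order.refl that])+
    have "poly \<psi> (of_nat n) = of_nat (hdim TYPE('p) (?K + n)) * (\<Sum>b\<le>m. of_nat (hdim TYPE('q) (s b + n)))"
      unfolding \<psi>_def poly_mult poly_sum dim_poly_hdim[OF pq(1) K1]
      by (intro arg_cong2[where f = "(*)"] refl sum.cong dim_poly_hdim[OF pq(2)] y_deg(2)) simp
    also have "(\<Sum>b\<le>m. of_nat (hdim TYPE('q) (s b + n)))
        = (of_nat (\<Sum>b\<le>m. hdim TYPE('q) (y_deg TYPE('p) TYPE('q) m (?K + n) b)) :: rat)"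
      unfolding of_nat_sum by (intro sum.cong refl) (simp add: y_deg(1))
    finally show ?thesis
      unfolding quot_dim_def U_filt_MK[OF order.refl] step by (simp add: n' step)
  qed
  show ?thesis
    unfolding has_Dim_Deg_def
  proof (intro exI conjI)
    show "generating_subspace lie_g pi_act (M_plus m :: ('p, 'q) funs set) (MK m ?K)"
      by (rule M_plus_generating[OF pq])
    show "\<forall>\<^sub>F n in sequentially. poly \<psi> (of_nat n) = of_nat (quot_dim (U_filt lie_g pi_act n (MK m ?K :: ('p, 'q) funs set))
      (U_filt lie_g pi_act (n - 1) (MK m ?K)))"
      using eventually_gt_at_top[of 0] by eventually_elim (rule quot)
    show "\<psi> \<noteq> 0" by (rule \<psi>0)
    show "1 \<le> ?p + ?q - 3" using pq by simp
    show "degree \<psi> = ?p + ?q - 3 - 1" unfolding deg by simp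
    have "lead_coeff \<psi> = c" using lc deg by (simp add: has_lc_def)
    moreover have "?p + ?q - 3 - 1 = ?p + ?q - 4" by simp
    ultimately show "lead_coeff \<psi> = 4 * (of_nat m + 1) * fact (?p + ?q - 4) / (fact (?p - 2) * fact (?q - 2)) / fact (?p + ?q - 3 - 1)"
      by (simp only: c_def) simp
  qed
qed

lemma M_plus_GK:
  assumes pq: "CARD('p::finite) \<ge> 2" "CARD('q::finite) \<ge> 2" and ev: "even (CARD('p) + CARD('q))"
  shows "GK_Dim lie_g pi_act (M_plus m :: ('p, 'q) funs set) = CARD('p) + CARD('q) - 3"
    and "Bernstein_Deg lie_g pi_act (M_plus m :: ('p, 'q) funs set)
      = 4 * (of_nat m + 1) * fact (CARD('p) + CARD('q) - 4) / (fact (CARD('p) - 2) * fact (CARD('q) - 2))"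
  by (rule pi.GK_Bernstein_eq[OF M_plus_nice M_plus_Dim_Deg[OF pq ev] M_plus_fin[OF pq]]; assumption)+

section \<open>Exchanging the two groups of variables\<close>

definition swap_xy :: "('p::finite, 'q::finite) funs \<Rightarrow> ('q, 'p) funs" where
  "swap_xy f = (\<lambda>z. f (snd z, fst z))"

lemma swap_xy_swap_xy [simp]: "swap_xy (swap_xy f) = f"
  by (simp add: swap_xy_def)

lemma swap_xy_lin: "swap_xy (f + g) = swap_xy f + swap_xy g" "swap_xy (cscale c f) = cscale c (swap_xy f)" "swap_xy (- f) = - swap_xy f" "swap_xy 0 = 0"
  by (simp_all add: swap_xy_def fun_eq_iff cscale_def)

lemma swap_xy_eq_iff: "swap_xy f = swap_xy g \<longleftrightarrow> f = g"
  by (metis swap_xy_swap_xy)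

lemma inj_swap_xy: "inj swap_xy"
  by (rule injI) (simp add: swap_xy_eq_iff)

lemma lin_on_swap_xy: "lin_on UNIV swap_xy"
  by (rule lin_onI) (rule swap_xy_lin)+

lemma nice_swap_xy: "f \<in> nice \<Longrightarrow> swap_xy f \<in> nice"
  unfolding swap_xy_def
  by (rule nice_compose_linear) (auto intro!: bounded_linear_Pair bounded_linear_fst bounded_linear_snd)

lemma swap_xy_coord: "cx i (snd z, fst z) = cy i z" "cy j (snd z, fst z) = cx j z"
  by (simp_all add: cx_def cy_def)

lemma swap_xy_D: "dx i (swap_xy f) = swap_xy (dy i f)" "dy j (swap_xy f) = swap_xy (dx j f)"
  by (simp_all add: dx_def dy_def dir_deriv_def swap_xy_def fun_eq_iff)

text \<open>Exchanging x and y sends H, X^+, X^- to -H, -X^-, -X^+, an automorphism of sl2 that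
  interchanges highest and lowest weight vectors.\<close>

lemma swap_xy_sl2:
  "sl2_H (swap_xy f) = cscale (- 1) (swap_xy (sl2_H f))"
  "sl2_Xp (swap_xy f) = cscale (- 1) (swap_xy (sl2_Xm f))"
  "sl2_Xm (swap_xy f) = cscale (- 1) (swap_xy (sl2_Xp f))"
proof -
  have a: "swap_xy f z = f (snd z, fst z)" for f :: "('c::finite, 'd::finite) funs" and z by (simp add: swap_xy_def)
  have r: "r2_x (snd z, fst z) = r2_y z" "r2_y (snd z, fst z) = r2_x z" for z :: "(real^'c::finite) \<times> (real^'d::finite)"
    by (simp_all add: r2_x_def r2_y_def cx_def cy_def)
  show "sl2_H (swap_xy f) = cscale (- 1) (swap_xy (sl2_H f))"
    by (rule ext) (simp add: sl2_H_def Euler_x_def Euler_y_def swap_xy_D a swap_xy_coord cscale_def)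
  show "sl2_Xp (swap_xy f) = cscale (- 1) (swap_xy (sl2_Xm f))"
    by (rule ext, simp add: sl2_Xp_def sl2_Xm_def Lap_x_def Lap_y_def swap_xy_D a r cscale_def add.commute,
      simp add: add_divide_distrib)
  show "sl2_Xm (swap_xy f) = cscale (- 1) (swap_xy (sl2_Xp f))"
    by (rule ext) (simp add: sl2_Xp_def sl2_Xm_def Lap_x_def Lap_y_def swap_xy_D a r cscale_def field_simps)
qed

lemma swap_xy_Xp_power:
  assumes f: "f \<in> nice"
  shows "(sl2_Xp ^^ j) (swap_xy f) = cscale ((- 1) ^ j) (swap_xy ((sl2_Xm ^^ j) f))"
proof (induction j)
  case 0
  show "(sl2_Xp ^^ 0) (swap_xy f) = cscale ((- 1) ^ 0) (swap_xy ((sl2_Xm ^^ 0) f))" by simp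
next
  case (Suc j)
  have n: "swap_xy ((sl2_Xm ^^ j) f) \<in> nice" using f by (intro nice_swap_xy) simp
  have "(sl2_Xp ^^ Suc j) (swap_xy f) = sl2_Xp (cscale ((- 1) ^ j) (swap_xy ((sl2_Xm ^^ j) f)))"
    by (simp only: funpow.simps o_apply Suc)
  also have "\<dots> = cscale ((- 1) ^ j) (cscale (- 1) (swap_xy (sl2_Xm ((sl2_Xm ^^ j) f))))"
    unfolding lin_onD(2)[OF lin_on_sl2(2) n] swap_xy_sl2 ..
  also have "\<dots> = cscale ((- 1) ^ Suc j) (swap_xy ((sl2_Xm ^^ Suc j) f))"
    by (simp only: cfun.scale_scale funpow.simps o_apply power_Suc mult.commute)
  finally show "(sl2_Xp ^^ Suc j) (swap_xy f) = cscale ((- 1) ^ Suc j) (swap_xy ((sl2_Xm ^^ Suc j) f))" .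
qed

lemma swap_xy_space_E:
  fixes f :: "('p::finite, 'q::finite) funs"
  assumes "f \<in> space_E"
  shows "swap_xy f \<in> space_E"
proof (rule lin_on_image_span[OF lin_on_swap_xy cfun.subspace_UNIV subset_UNIV _ _ assms[unfolded space_E_def]])
  show "cfun.subspace (space_E :: ('q, 'p) funs set)" unfolding space_E_def by (rule cfun.subspace_span)
  fix a :: "('p, 'q) funs"
  assume "a \<in> {\<lambda>z. h1 (fst z) * h2 (snd z) * rho_x z ^ a * rho_y z ^ b * psi \<alpha> z | h1 h2 k l a b \<alpha>.
        h1 \<in> harmonic_polys k \<and> h2 \<in> harmonic_polys l \<and> \<alpha> \<notin> \<int>\<^sub>\<le>\<^sub>0}"
  then obtain h1 :: "real^'p \<Rightarrow> complex" and h2 :: "real^'q \<Rightarrow> complex" and k l i j \<alpha>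
    where a: "a = (\<lambda>z. h1 (fst z) * h2 (snd z) * rho_x z ^ i * rho_y z ^ j * psi \<alpha> z)"
      and h: "h1 \<in> harmonic_polys k" "h2 \<in> harmonic_polys l" "\<alpha> \<notin> \<int>\<^sub>\<le>\<^sub>0" by blast
  have r: "rho_x (snd z, fst z) = rho_y z" "rho_y (snd z, fst z) = rho_x z" for z :: "(real^'q) \<times> (real^'p)"
    by (simp_all add: rho_x_def rho_y_def r2_x_def r2_y_def cx_def cy_def)
  have "swap_xy a = (\<lambda>z. h2 (fst z) * h1 (snd z) * rho_x z ^ j * rho_y z ^ i * psi \<alpha> z)"
    by (rule ext) (simp add: a swap_xy_def psi_def r mult_ac)
  then show "swap_xy a \<in> space_E"
    unfolding space_E_def using h by (intro cfun.span_base) blast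
qed

lemma M_minus_nice: "M_minus m \<subseteq> nice"
  using space_E_nice by (auto simp: M_minus_def)

lemma swap_xy_M_plus:
  fixes f :: "('p::finite, 'q::finite) funs"
  assumes f: "f \<in> M_plus m"
  shows "swap_xy f \<in> M_minus m"
proof (cases "f = 0")
  case True
  then show ?thesis by (simp add: M_minus_def swap_xy_lin)
next
  case False
  then have fE: "f \<in> space_E" and H: "sl2_H f = cscale (of_nat m) f" and Xp: "sl2_Xp f = 0"
    and nz: "\<forall>j\<in>{1..m}. (sl2_Xm ^^ j) f \<noteq> 0" and z: "(sl2_Xm ^^ (m + 1)) f = 0"
    using f unfolding M_plus_def by blast+
  have n: "f \<in> nice" using fE space_E_nice by blast
  have "sl2_H (swap_xy f) = cscale (- of_nat m) (swap_xy f)" unfolding swap_xy_sl2 H swap_xy_lin by simp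
  moreover have "sl2_Xm (swap_xy f) = 0" unfolding swap_xy_sl2 Xp swap_xy_lin by simp
  moreover have "(sl2_Xp ^^ (m + 1)) (swap_xy f) = 0" unfolding swap_xy_Xp_power[OF n] z swap_xy_lin by simp
  moreover have "\<forall>j\<in>{1..m}. (sl2_Xp ^^ j) (swap_xy f) \<noteq> 0"
  proof
    fix j assume "j \<in> {1..m}"
    then have "(sl2_Xm ^^ j) f \<noteq> 0" using nz by blast
    then have "swap_xy ((sl2_Xm ^^ j) f) \<noteq> 0" using swap_xy_eq_iff[of "(sl2_Xm ^^ j) f" 0] unfolding swap_xy_lin by blast
    then show "(sl2_Xp ^^ j) (swap_xy f) \<noteq> 0" unfolding swap_xy_Xp_power[OF n] cfun.scale_eq_0_iff by simp
  qed
  ultimately show ?thesis unfolding M_minus_def using swap_xy_space_E[OF fE] by blast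
qed

text \<open>From \<open>swap_xy_Xp_power\<close> at the exchanged function; the sign (-1)^j is its
  own inverse.\<close>

lemma swap_xy_Xm_power:
  assumes f: "f \<in> nice"
  shows "(sl2_Xm ^^ j) (swap_xy f) = cscale ((- 1) ^ j) (swap_xy ((sl2_Xp ^^ j) f))"
proof -
  have "(sl2_Xp ^^ j) f = cscale ((- 1) ^ j) (swap_xy ((sl2_Xm ^^ j) (swap_xy f)))"
    using swap_xy_Xp_power[OF nice_swap_xy[OF f], of j] by (simp only: swap_xy_swap_xy)
  then have "swap_xy ((sl2_Xp ^^ j) f) = cscale ((- 1) ^ j) ((sl2_Xm ^^ j) (swap_xy f))"
    by (simp only: swap_xy_lin swap_xy_swap_xy)
  then show ?thesis by (simp only: cfun.scale_scale power_mult_distrib[symmetric]) simp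
qed

lemma swap_xy_M_minus:
  fixes f :: "('p::finite, 'q::finite) funs"
  assumes f: "f \<in> M_minus m"
  shows "swap_xy f \<in> M_plus m"
proof (cases "f = 0")
  case True
  then show ?thesis by (simp add: M_plus_def swap_xy_lin)
next
  case False
  then have fE: "f \<in> space_E" and H: "sl2_H f = cscale (- of_nat m) f" and Xm: "sl2_Xm f = 0"
    and nz: "\<forall>j\<in>{1..m}. (sl2_Xp ^^ j) f \<noteq> 0" and z: "(sl2_Xp ^^ (m + 1)) f = 0"
    using f unfolding M_minus_def by blast+
  have n: "f \<in> nice" using fE space_E_nice by blast
  have "sl2_H (swap_xy f) = cscale (of_nat m) (swap_xy f)" unfolding swap_xy_sl2 H swap_xy_lin by simp
  moreover have "sl2_Xp (swap_xy f) = 0" unfolding swap_xy_sl2 Xm swap_xy_lin by simp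
  moreover have "(sl2_Xm ^^ (m + 1)) (swap_xy f) = 0" unfolding swap_xy_Xm_power[OF n] z swap_xy_lin by simp
  moreover have "\<forall>j\<in>{1..m}. (sl2_Xm ^^ j) (swap_xy f) \<noteq> 0"
  proof
    fix j assume "j \<in> {1..m}"
    then have "(sl2_Xp ^^ j) f \<noteq> 0" using nz by blast
    then have "swap_xy ((sl2_Xp ^^ j) f) \<noteq> 0" using swap_xy_eq_iff[of "(sl2_Xp ^^ j) f" 0] unfolding swap_xy_lin by blast
    then show "(sl2_Xm ^^ j) (swap_xy f) \<noteq> 0" unfolding swap_xy_Xm_power[OF n] cfun.scale_eq_0_iff by simp
  qed
  ultimately show ?thesis unfolding M_plus_def using swap_xy_space_E[OF fE] by blast
qed

lemma M_minus_eq: "M_minus m = swap_xy ` M_plus m"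
proof (intro set_eqI iffI)
  fix f :: "('a, 'b) funs" assume "f \<in> M_minus m"
  then have "swap_xy f \<in> M_plus m" by (rule swap_xy_M_minus)
  then show "f \<in> swap_xy ` M_plus m" by (intro image_eqI[of f swap_xy "swap_xy f"]) simp
qed (use swap_xy_M_plus in blast)

text \<open>Conjugation by the permutation of the two blocks. It carries I_(p,q) to -I_(q,p), and
  the equation defining the Lie algebra is unchanged by this sign.\<close>

definition swap_mat :: "complex^('p::finite + 'q::finite)^('p + 'q) \<Rightarrow> complex^('q + 'p)^('q + 'p)" where
  "swap_mat A = (\<chi> a b. A $ (case a of Inl j \<Rightarrow> Inr j | Inr i \<Rightarrow> Inl i) $ (case b of Inl j \<Rightarrow> Inr j | Inr i \<Rightarrow> Inl i))"

lemma swap_mat_swap_mat: "swap_mat (swap_mat A) = A"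
  by (simp add: swap_mat_def vec_eq_iff split: sum.split)

lemma swap_mat_lie: "A \<in> lie_g \<Longrightarrow> swap_mat A \<in> lie_g"
  by (rule lie_gI; unfold swap_mat_def vec_lambda_beta sum.case) (rule lie_g_entries lie_g_entries(3)[symmetric]; assumption)+

text \<open>\<open>pi_act\<close> reads only the upper right block, so the noncompact part uses that
  the two off-diagonal blocks of \<open>A\<close> are transposes of each other, and that x- and
  y-derivatives commute on \<open>nice\<close>.\<close>

lemma swap_xy_pi_act:
  fixes f :: "('p::finite, 'q::finite) funs"
  assumes A: "A \<in> lie_g" and f: "f \<in> nice"
  shows "pi_act (swap_mat A) (swap_xy f) = swap_xy (pi_act A f)"
proof
  fix z :: "(real^'q) \<times> (real^'p)"
  have a: "swap_xy f z = f (snd z, fst z)" for f :: "('p, 'q) funs" and z by (simp add: swap_xy_def)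
  have dd: "dx i (dy j (swap_xy f)) = swap_xy (dx j (dy i f))" for i j
    unfolding swap_xy_D unfolding defs_xy D_cross[OF f] ..
  have "(\<Sum>i\<in>UNIV. \<Sum>j\<in>UNIV. swap_mat A $ Inl i $ Inr j * (\<i> * (cx i z * cy j z * swap_xy f z + dx i (dy j (swap_xy f)) z)))
     = (\<Sum>j\<in>UNIV. \<Sum>i\<in>UNIV. A $ Inl j $ Inr i * (\<i> * (cx j (snd z, fst z) * cy i (snd z, fst z) * f (snd z, fst z)
        + dx j (dy i f) (snd z, fst z))))"
    unfolding dd unfolding a swap_xy_coord
    by (subst sum.swap) (simp add: swap_mat_def lie_g_entries(3)[OF A] mult.commute)
  then show "pi_act (swap_mat A) (swap_xy f) z = swap_xy (pi_act A f) z"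
    unfolding a[of "pi_act A f"] pi_act_def unfolding swap_xy_D unfolding a swap_xy_coord
    by (simp add: swap_mat_def add.commute add.left_commute)
qed

lemma swap_xy_foldr:
  assumes "set As \<subseteq> lie_g" "v \<in> nice"
  shows "foldr pi_act (map swap_mat As) (swap_xy v) = swap_xy (foldr pi_act As v)"
  using assms(1)
proof (induction As)
  case (Cons A As)
  have n: "foldr pi_act As v \<in> nice" by (rule pi.nice_foldr) (use Cons.prems assms(2) in auto)
  have IH: "foldr pi_act (map swap_mat As) (swap_xy v) = swap_xy (foldr pi_act As v)" using Cons by simp
  show "foldr pi_act (map swap_mat (A # As)) (swap_xy v) = swap_xy (foldr pi_act (A # As) v)"
    unfolding list.map foldr.simps o_apply IH by (rule swap_xy_pi_act[OF _ n]) (use Cons.prems in simp)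
qed simp

lemma swap_xy_span: "cfun.span (swap_xy ` G) = swap_xy ` cfun.span G"
proof
  have im: "swap_xy f \<in> cfun.span (swap_xy ` H)" if "f \<in> cfun.span H" for f and H :: "('c::finite, 'd::finite) funs set"
    by (rule lin_on_image_span[OF lin_on_swap_xy cfun.subspace_UNIV subset_UNIV _ cfun.subspace_span that])
      (auto intro: cfun.span_base)
  show "swap_xy ` cfun.span G \<subseteq> cfun.span (swap_xy ` G)" using im by blast
  show "cfun.span (swap_xy ` G) \<subseteq> swap_xy ` cfun.span G"
  proof
    fix f assume "f \<in> cfun.span (swap_xy ` G)"
    from im[OF this] have "swap_xy f \<in> cfun.span G" by (simp add: image_image)
    then show "f \<in> swap_xy ` cfun.span G" by (intro image_eqI[of f swap_xy "swap_xy f"]) simp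
  qed
qed

lemma swap_xy_dim: "cfun.dim (swap_xy ` V) = cfun.dim V"
proof -
  obtain B where B: "B \<subseteq> V" "cfun.independent B" "V \<subseteq> cfun.span B" "card B = cfun.dim V"
    by (rule cfun.basis_exists)
  have "cfun.independent (swap_xy ` B)"
    unfolding cfun.dependent_def
  proof
    assume "\<exists>a\<in>swap_xy ` B. a \<in> cfun.span (swap_xy ` B - {a})"
    then obtain b where b: "b \<in> B" "swap_xy b \<in> cfun.span (swap_xy ` B - {swap_xy b})" by blast
    have "swap_xy ` B - {swap_xy b} = swap_xy ` (B - {b})" using inj_swap_xy by (auto simp: swap_xy_eq_iff)
    then have "swap_xy b \<in> swap_xy ` cfun.span (B - {b})" using b(2) swap_xy_span by metis
    then have "b \<in> cfun.span (B - {b})" by (auto simp: swap_xy_eq_iff)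
    then show False using b(1) B(2) unfolding cfun.dependent_def by blast
  qed
  moreover have "swap_xy ` V \<subseteq> cfun.span (swap_xy ` B)" unfolding swap_xy_span using B(3) by blast
  ultimately have "card (swap_xy ` B) = cfun.dim (swap_xy ` V)"
    using B(1) by (intro cfun.basis_card_eq_dim) auto
  moreover have "card (swap_xy ` B) = card B" by (rule card_image) (rule inj_on_subset[OF inj_swap_xy], simp)
  ultimately show ?thesis using B(4) by simp
qed

text \<open>\<open>swap_mat\<close> is an involution that exchanges the two Lie algebras, so words
  in one correspond to words in the other of the same length.\<close>

lemma swap_xy_U_filt:
  assumes M0: "M0 \<subseteq> nice"
  shows "U_filt lie_g pi_act n (swap_xy ` M0) = swap_xy ` U_filt lie_g pi_act n M0"
proof -
  have "{foldr pi_act As v | As v. set As \<subseteq> lie_g \<and> length As \<le> n \<and> v \<in> swap_xy ` M0}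
      = swap_xy ` {foldr pi_act As v | As v. set As \<subseteq> lie_g \<and> length As \<le> n \<and> v \<in> M0}" (is "?L = swap_xy ` ?R")
  proof (intro set_eqI iffI)
    fix f assume "f \<in> ?L"
    then obtain As v where f: "f = foldr pi_act As (swap_xy v)" "set As \<subseteq> lie_g" "length As \<le> n" "v \<in> M0" by blast
    have s: "set (map swap_mat As) \<subseteq> lie_g" using f(2) swap_mat_lie by auto
    have "map swap_mat (map swap_mat As) = As" by (simp add: swap_mat_swap_mat map_idI)
    then have "f = swap_xy (foldr pi_act (map swap_mat As) v)"
      using swap_xy_foldr[OF s, of v] f(1,4) M0 by auto
    moreover have "foldr pi_act (map swap_mat As) v \<in> ?R" using s f(3,4) by force
    ultimately show "f \<in> swap_xy ` ?R" by blast
  next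
    fix f assume "f \<in> swap_xy ` ?R"
    then obtain As v where f: "f = swap_xy (foldr pi_act As v)" "set As \<subseteq> lie_g" "length As \<le> n" "v \<in> M0" by blast
    have s: "set (map swap_mat As) \<subseteq> lie_g" using f(2) swap_mat_lie by auto
    have "f = foldr pi_act (map swap_mat As) (swap_xy v)"
      using swap_xy_foldr[OF f(2), of v] f(1,4) M0 by auto
    then show "f \<in> ?L" using s f(3,4) by force
  qed
  then show ?thesis unfolding U_filt_def swap_xy_span[symmetric] by (rule arg_cong)
qed

lemma swap_xy_has_Dim_Deg:
  assumes M: "M \<subseteq> nice" and d: "has_Dim_Deg lie_g pi_act M d e"
  shows "has_Dim_Deg lie_g pi_act (swap_xy ` M) d e"
proof -
  obtain M0 \<psi> where g: "generating_subspace lie_g pi_act M M0"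
    and p: "\<forall>\<^sub>F n in sequentially. poly \<psi> (of_nat n) = of_nat (quot_dim (U_filt lie_g pi_act n M0) (U_filt lie_g pi_act (n - 1) M0))"
    and \<psi>: "\<psi> \<noteq> 0 \<and> d \<ge> 1 \<and> degree \<psi> = d - 1 \<and> lead_coeff \<psi> = e / fact (d - 1)"
    using d unfolding has_Dim_Deg_def by blast
  obtain B where B: "finite B" "M0 = cfun.span B" and MU: "M = (\<Union>n. U_filt lie_g pi_act n M0)"
    using g unfolding generating_subspace_def by blast
  have "M0 \<subseteq> M" unfolding MU using pi.U_base[of M0 0] by blast
  then have M0: "M0 \<subseteq> nice" using M by blast
  have "generating_subspace lie_g pi_act (swap_xy ` M) (swap_xy ` M0)"
    unfolding generating_subspace_def swap_xy_U_filt[OF M0]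
  proof (intro conjI exI[of _ "swap_xy ` B"])
    show "finite (swap_xy ` B)" using B(1) by simp
    show "swap_xy ` M0 = cfun.span (swap_xy ` B)" unfolding B(2) swap_xy_span ..
    show "swap_xy ` M = (\<Union>n. swap_xy ` U_filt lie_g pi_act n M0)" unfolding MU by (rule image_UN)
  qed
  moreover have "\<forall>\<^sub>F n in sequentially. poly \<psi> (of_nat n)
      = of_nat (quot_dim (U_filt lie_g pi_act n (swap_xy ` M0)) (U_filt lie_g pi_act (n - 1) (swap_xy ` M0)))"
    using p unfolding swap_xy_U_filt[OF M0] quot_dim_def swap_xy_dim .
  ultimately show ?thesis unfolding has_Dim_Deg_def using \<psi> by blast
qed

text \<open>An equivalence for all d and e, because the invariants are definite descriptions and the
  whole predicate has to be transferred.\<close>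

lemma M_minus_has_Dim_Deg:
  "has_Dim_Deg lie_g pi_act (M_minus m :: ('p::finite, 'q::finite) funs set) d e
    \<longleftrightarrow> has_Dim_Deg lie_g pi_act (M_plus m :: ('q, 'p) funs set) d e"
proof
  have "swap_xy ` (M_minus m :: ('p, 'q) funs set) = M_plus m"
    unfolding M_minus_eq image_image swap_xy_swap_xy by simp
  moreover assume "has_Dim_Deg lie_g pi_act (M_minus m :: ('p, 'q) funs set) d e"
  ultimately show "has_Dim_Deg lie_g pi_act (M_plus m :: ('q, 'p) funs set) d e"
    using swap_xy_has_Dim_Deg[OF M_minus_nice] by metis
next
  assume "has_Dim_Deg lie_g pi_act (M_plus m :: ('q, 'p) funs set) d e"
  then show "has_Dim_Deg lie_g pi_act (M_minus m :: ('p, 'q) funs set) d e"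
    unfolding M_minus_eq by (rule swap_xy_has_Dim_Deg[OF M_plus_nice])
qed

theorem corollary4p8:
  fixes m :: nat
  assumes "CARD('p::finite) \<ge> 2" and "CARD('q::finite) \<ge> 2"
    and "even (CARD('p) + CARD('q))"
    and "m + 3 \<le> (CARD('p) + CARD('q)) div 2"
  shows "GK_Dim lie_g pi_act (M_plus m :: ('p, 'q) funs set) = CARD('p) + CARD('q) - 3
    \<and> GK_Dim lie_g pi_act (M_minus m :: ('p, 'q) funs set) = CARD('p) + CARD('q) - 3
    \<and> Bernstein_Deg lie_g pi_act (M_plus m :: ('p, 'q) funs set) =
      4 * (of_nat m + 1) * fact (CARD('p) + CARD('q) - 4) / (fact (CARD('p) - 2) * fact (CARD('q) - 2))
    \<and> Bernstein_Deg lie_g pi_act (M_minus m :: ('p, 'q) funs set) =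
      4 * (of_nat m + 1) * fact (CARD('p) + CARD('q) - 4) / (fact (CARD('p) - 2) * fact (CARD('q) - 2))"
proof -
  have ev: "even (CARD('q) + CARD('p))" using assms(3) by (simp only: add.commute)
  \<comment> \<open>\<open>swapped\<close> is the result for M^+ with p and q interchanged; the
    formulas are symmetric in p and q.\<close>
  note plus = M_plus_GK[OF assms(1,2,3), of m] and swapped = M_plus_GK[OF assms(2,1) ev, of m]
  have "GK_Dim lie_g pi_act (M_minus m :: ('p, 'q) funs set) = CARD('p) + CARD('q) - 3"
    using swapped(1) unfolding GK_Dim_def M_minus_has_Dim_Deg by (simp only: add.commute)
  moreover have "Bernstein_Deg lie_g pi_act (M_minus m :: ('p, 'q) funs set) =
      4 * (of_nat m + 1) * fact (CARD('p) + CARD('q) - 4) / (fact (CARD('p) - 2) * fact (CARD('q) - 2))"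
    using swapped(2) unfolding Bernstein_Deg_def M_minus_has_Dim_Deg by (simp only: add.commute mult.commute)
  ultimately show ?thesis using plus by (intro conjI)
qed

end
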